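(* Let $Y_\nu$ denote the Bessel function of the second kind. For $1<\mathrm{Re}(s)<2$, $$\mathcal{L}_2(s)=\zeta^2(s)-s\zeta(s-1)\zeta(s+1)+\frac{\Gamma(1-s)\Gamma(2s-1)\zeta(2s-1)}{\Gamma(s)}-\frac{(2\pi)^s}{2\Gamma(s)\cos(\frac{\pi s}{2})}\sum_{n=1}^\infty\frac{\sigma_{2s-1}(n)}{n^{s-\frac12}}\left(\frac1{\sqrt n}+\frac{\pi}{\sqrt2}\frac{(-1)^n}{\sin(\frac{\pi s}2)}Y_{s-\frac12}(\pi n)+\frac{s(1-s)}{2\pi n^{3/2}}\cot\!\left(\frac{\pi s}{2}\right)\right).$$
   Context: For $\mathrm{Re}(s)>1$, $\mathcal{L}_2(s):=\sum_{m=1}^\infty\sum_{n=1}^\infty(m^2+mn)^{-s}$. $\sigma_z(n):=\sum_{d\mid n}d^z$. $\zeta$ is the Riemann zeta function. *)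

theory Defs
  imports "HOL-Complex_Analysis.Complex_Analysis"
begin

text \<open>
  The Riemann zeta function on the whole plane without 1: the Dirichlet series where it converges
  absolutely, and the unique holomorphic continuation elsewhere (the value at the pole 1 is
  unspecified).
\<close>
definition zeta :: "complex \<Rightarrow> complex" where
  "zeta s = (THE w. \<exists>f. f holomorphic_on (- {1}) \<and>
     (\<forall>z. Re z > 1 \<longrightarrow> f z = (\<Sum>n. of_nat (Suc n) powr (- z))) \<and> w = f s)"

text \<open>The iterated series; the indices are shifted so that both variables run over
  the positive integers.\<close>
definition L2 :: "complex \<Rightarrow> complex" where
  "L2 s = (\<Sum>m. \<Sum>n. of_nat ((Suc m)\<^sup>2 + Suc m * Suc n) powr (- s))"

definition divisor_sigma :: "complex \<Rightarrow> nat \<Rightarrow> complex" where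
  "divisor_sigma z n = (\<Sum>d | d dvd n. of_nat d powr z)"

text \<open>
  Bessel functions on the principal branch. In the first one, \<open>rGamma\<close> is the entire function
  1/Gamma, so terms at poles of Gamma vanish. At integer orders, the function of the second kind
  is the limit in the order, as usual.
\<close>
definition Bessel_J :: "complex \<Rightarrow> complex \<Rightarrow> complex" where
  "Bessel_J \<nu> z =
     (\<Sum>k. (- 1) ^ k / fact k * rGamma (\<nu> + of_nat k + 1) * (z / 2) powr (\<nu> + 2 * of_nat k))"

definition Bessel_Y_quotient :: "complex \<Rightarrow> complex \<Rightarrow> complex" where
  "Bessel_Y_quotient \<nu> z =
     (Bessel_J \<nu> z * cos (\<nu> * of_real pi) - Bessel_J (- \<nu>) z) / sin (\<nu> * of_real pi)"

definition Bessel_Y :: "complex \<Rightarrow> complex \<Rightarrow> complex" where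
  "Bessel_Y \<nu> z =
     (if \<nu> \<in> \<int> then Lim (at \<nu>) (\<lambda>\<mu>. Bessel_Y_quotient \<mu> z) else Bessel_Y_quotient \<nu> z)"

end

theory Submission
  imports Defs "HOL-Real_Asymp.Real_Asymp"
begin

text \<open>
  Write \<open>F d u = (u + i d)\<^sup>s\<^sup>-\<^sup>1 + (u - i d)\<^sup>s\<^sup>-\<^sup>1\<close> minus its first order Taylor polynomial at \<open>u = 0\<close>. Hankel's
  integral represents the Bessel function, and the two correction terms in the series are exactly
  what removes the Taylor polynomial: up to a constant the bracket at \<open>n\<close> is the integral of
  \<open>e\<^sup>-\<^sup>2\<^sup>\<pi>\<^sup>n\<^sup>u u\<^sup>s\<^sup>-\<^sup>1 F 1 u\<close>. With \<open>n = d e\<close> and \<open>v = d u\<close> the series becomes the absolutely convergent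
  double sum over \<open>d\<close>, \<open>e\<close> of the integrals of \<open>e\<^sup>-\<^sup>2\<^sup>\<pi>\<^sup>e\<^sup>v v\<^sup>s\<^sup>-\<^sup>1 F d v\<close>. By the Lipschitz summation formula, integrated
  twice, the sum of \<open>F d v\<close> over \<open>d\<close> is a multiple of \<open>\<Sum>n. n\<^sup>-\<^sup>s e\<^sup>-\<^sup>2\<^sup>\<pi>\<^sup>n\<^sup>v\<close> minus \<open>v\<^sup>s\<^sup>-\<^sup>1\<close> and an affine function
  of \<open>v\<close> with coefficients \<open>\<zeta>(s)\<close> and \<open>\<zeta>(s - 1)\<close>. The remaining integrals are Gamma integrals, and the
  exponential series produces \<open>\<Sum>n e. n\<^sup>-\<^sup>s (n + e)\<^sup>-\<^sup>s\<close>, which is the series to be evaluated.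
\<close>

section \<open>Integrals over the positive half-line\<close>

text \<open>The subtraction in \<open>F\<close> is forced by convergence: the bare powers grow with
  \<open>d\<close> like d^(Re s - 1), whereas \<open>F d v\<close> is O(d^(Re s - 3) v^2), summable
  over \<open>d\<close> because \<open>Re s < 2\<close>. The same strip fits the other tools: the
  Lipschitz formula is used with exponent \<open>3 - s\<close>, of real part between 1 and 2, and
  the slope at \<open>v = 0\<close> involves \<zeta> at \<open>s - 1\<close>, inside the critical
  strip. There the Dirichlet series diverges, so \<zeta> enters as an Abel limit with its divergent
  part removed, which rests on a Mellin integral valid in that strip. After integration,
  \<open>v powr (s - 1)\<close> yields the term with \<zeta>(2s - 1), the constant \<zeta>(s) yields
  \<zeta>(s)^2, and the linear term yields \<zeta>(s - 1) \<zeta>(s + 1). \<open>Bessel_Y\<close> is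
  given by power series, so Hankel's integral has to be earned: Poisson's integral for real orders
  above 1/2, a half-strip contour, then continuation in the order. Integer orders cannot be avoided,
  since \<open>s = 3/2\<close> gives order 1. At the points \<open>pi * n\<close> the two
  exponentials of Hankel's formula both equal \<open>(- 1) ^ n\<close>, which cancels the sign in
  the series.\<close>

lemma holomorphic_on_integral:
  fixes f :: "complex \<Rightarrow> 'a \<Rightarrow> complex"
  assumes S: "open S"
    and meas: "\<And>z. z \<in> S \<Longrightarrow> f z \<in> borel_measurable M"
    and hol: "\<And>x. x \<in> space M \<Longrightarrow> (\<lambda>z. f z x) holomorphic_on S"
    and dom: "\<And>z. z \<in> S \<Longrightarrow> \<exists>r>0. \<exists>g. cball z r \<subseteq> S \<and> integrable M g \<and>
                 (\<forall>w\<in>cball z r. \<forall>x\<in>space M. norm (f w x) \<le> g x)"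
  shows "(\<lambda>z. integral\<^sup>L M (f z)) holomorphic_on S"
proof -
  have "(\<lambda>z. integral\<^sup>L M (f z)) field_differentiable at z" if z: "z \<in> S" for z
  proof -
    obtain r g where r: "r > 0" and sub: "cball z r \<subseteq> S" and g: "integrable M g"
      and le: "\<And>w x. w \<in> cball z r \<Longrightarrow> x \<in> space M \<Longrightarrow> norm (f w x) \<le> g x"
      using dom[OF z] by blast
    let ?B = "ball z (r/2)"
    let ?D = "\<lambda>x. deriv (\<lambda>z. f z x) z"
    have int: "integrable M (f w)" if "w \<in> cball z r" for w
      by (rule Bochner_Integration.integrable_bound[OF g])
        (use that sub meas le in \<open>auto intro!: AE_I2 order_trans[OF le abs_ge_self]\<close>)
    \<comment> \<open>Only \<open>f\<close> itself is dominated. Cauchy's estimate on discs of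
      radius \<open>r/2\<close> about the points of \<open>?B\<close> bounds the
      \<open>z\<close>-derivative by \<open>2 * g x / r\<close>, and this dominates every difference
      quotient at \<open>z\<close>.\<close>
    have lip: "norm (f w x - f z x) \<le> 2 * g x / r * norm (w - z)"
      if w: "w \<in> ?B" and x: "x \<in> space M" for w x
    proof (rule field_differentiable_bound[of ?B "\<lambda>z. f z x" "deriv (\<lambda>z. f z x)"])
      fix u assume u: "u \<in> ?B"
      have cb: "cball u (r/2) \<subseteq> cball z r"
      proof
        fix y assume "y \<in> cball u (r/2)"
        thus "y \<in> cball z r" using u dist_triangle[of z y u] by (simp add: dist_commute)
      qed
      have "((\<lambda>z. f z x) has_field_derivative deriv (\<lambda>z. f z x) u) (at u)"
        using hol[OF x] S subsetD[OF sub, of u] u r by (intro holomorphic_derivI[of _ S]) auto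
      thus "((\<lambda>z. f z x) has_field_derivative deriv (\<lambda>z. f z x) u) (at u within ?B)"
        by (rule has_field_derivative_at_within)
      have "norm ((deriv ^^ 1) (\<lambda>z. f z x) u) \<le> fact 1 * g x / (r/2) ^ 1"
      proof (rule Cauchy_inequality)
        show "(\<lambda>z. f z x) holomorphic_on ball u (r/2)"
          by (rule holomorphic_on_subset[OF hol[OF x]])
            (rule subset_trans[OF ball_subset_cball subset_trans[OF cb sub]])
        show "continuous_on (cball u (r/2)) (\<lambda>z. f z x)"
          by (rule holomorphic_on_imp_continuous_on, rule holomorphic_on_subset[OF hol[OF x]])
            (rule subset_trans[OF cb sub])
        show "norm (f w x) \<le> g x" if "norm (u - w) = r/2" for w
          using that cb x by (intro le) (auto simp: dist_norm subset_iff)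
      qed (use r in auto)
      thus "norm (deriv (\<lambda>z. f z x) u) \<le> 2 * g x / r" by (simp add: mult.commute)
    qed (use w r in auto)
    have "((\<lambda>w. (integral\<^sup>L M (f w) - integral\<^sup>L M (f z)) / (w - z)) \<longlongrightarrow> integral\<^sup>L M ?D) (at z within ?B)"
      unfolding tendsto_at_iff_sequentially o_def
    proof (intro allI impI)
      fix X assume X: "\<forall>i. X i \<in> ?B - {z}" and lim: "X \<longlonglongrightarrow> z"
      have Xc: "X i \<in> cball z r" for i using X[rule_format, of i] r by auto
      have zc: "z \<in> cball z r" using r by auto
      have conv: "(\<lambda>i. (f (X i) x - f z x) / (X i - z)) \<longlonglongrightarrow> ?D x" if x: "x \<in> space M" for x
      proof -
        have "((\<lambda>z. f z x) has_field_derivative ?D x) (at z)"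
          using hol[OF x] S z by (intro holomorphic_derivI[of _ S]) auto
        thus ?thesis
          unfolding has_field_derivative_iff tendsto_at_iff_sequentially o_def using X lim by auto
      qed
      have m: "(\<lambda>x. (f (X i) x - f z x) / (X i - z)) \<in> borel_measurable M" for i
        using Xc[of i] zc sub by (intro borel_measurable_divide borel_measurable_diff meas) auto
      have "(\<lambda>i. \<integral>x. (f (X i) x - f z x) / (X i - z) \<partial>M) \<longlonglongrightarrow> integral\<^sup>L M ?D"
      proof (rule integral_dominated_convergence)
        \<comment> \<open>The derivative is measurable in \<open>x\<close> as a pointwise limit of
          measurable difference quotients.\<close>
        show "?D \<in> borel_measurable M"
          by (rule borel_measurable_LIMSEQ_metric[OF m conv])
        show "integrable M (\<lambda>x. 2 * g x / r)" using g by auto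
        show "AE x in M. norm ((f (X i) x - f z x) / (X i - z)) \<le> 2 * g x / r" for i
          using lip[of "X i"] X by (intro AE_I2) (simp add: norm_divide divide_le_eq)
      qed (use m conv in auto)
      also have "(\<lambda>i. \<integral>x. (f (X i) x - f z x) / (X i - z) \<partial>M) =
          (\<lambda>i. (integral\<^sup>L M (f (X i)) - integral\<^sup>L M (f z)) / (X i - z))"
        using int[OF Xc] int[OF zc] by simp
      finally show "(\<lambda>i. (integral\<^sup>L M (f (X i)) - integral\<^sup>L M (f z)) / (X i - z))
         \<longlonglongrightarrow> integral\<^sup>L M ?D" .
    qed
    hence "((\<lambda>z. integral\<^sup>L M (f z)) has_field_derivative integral\<^sup>L M ?D) (at z within ?B)"
      unfolding has_field_derivative_iff .
    thus ?thesis using r at_within_open[of z ?B] by (auto simp: field_differentiable_def)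
  qed
  thus ?thesis by (simp add: holomorphic_on_open[OF S] field_differentiable_def)
qed

text \<open>A measure of its own in place of set integrals: it is sigma-finite, so Fubini's theorem
  applies to \<open>lhalf \<Otimes>\<^sub>M lhalf\<close> without indicator functions.\<close>

abbreviation lhalf :: "real measure" where
  "lhalf \<equiv> restrict_space lborel {0<..}"

lemma space_lhalf [simp]: "space lhalf = {0<..}"
  by (simp add: space_restrict_space)

lemma sigma_finite_lhalf: "sigma_finite_measure lhalf"
  by (rule sigma_finite_measure_restrict_space) (auto simp: lborel.sigma_finite_measure_axioms)

lemma measurable_lhalf_continuous:
  fixes f :: "real \<Rightarrow> 'b::topological_space"
  assumes "continuous_on {0<..} f"
  shows "f \<in> borel_measurable lhalf"
proof -
  have "f \<in> borel_measurable (restrict_space borel {0<..})"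
    using assms by (rule borel_measurable_continuous_on_restrict)
  moreover have "sets lhalf = sets (restrict_space borel {0<..})"
    by (simp add: sets_restrict_space)
  ultimately show ?thesis by (subst measurable_cong_sets) auto
qed

lemma integrable_lhalf_iff:
  fixes f :: "real \<Rightarrow> 'b::euclidean_space"
  shows "integrable lhalf f \<longleftrightarrow> set_integrable lborel {0<..} f"
  by (subst integrable_restrict_space) (auto simp: set_integrable_def)

text \<open>Absolute gauge integrability gives measurability only for the completed measure;
  continuity supplies the Borel measurability that \<open>lborel\<close> asks for. This is how the
  Gamma integral, known as a gauge integral, is imported.\<close>

lemma has_bochner_integral_lhalf:
  fixes f :: "real \<Rightarrow> complex"
  assumes "f absolutely_integrable_on {0<..}" "(f has_integral I) {0<..}" "continuous_on {0<..} f"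
  shows "has_bochner_integral lhalf f I"
proof -
  have m: "f \<in> borel_measurable lhalf" by (rule measurable_lhalf_continuous) fact
  have mi: "(\<lambda>x. indicator {0<..} x *\<^sub>R f x) \<in> borel_measurable lborel"
    using m by (subst (asm) borel_measurable_restrict_space_iff) auto
  have si: "set_integrable lborel {0<..} f"
    using assms(1) mi unfolding set_integrable_def by (simp add: integrable_completion)
  have "integral\<^sup>L lhalf f = set_lebesgue_integral lborel {0<..} f"
    by (subst integral_restrict_space) (auto simp: set_lebesgue_integral_def)
  also have "\<dots> = I" using set_borel_integral_eq_integral(2)[OF si] assms(2) by auto
  finally show ?thesis using si by (simp add: has_bochner_integral_iff integrable_lhalf_iff)
qed

lemma lhalf_scale:
  fixes f :: "real \<Rightarrow> 'b::{banach, second_countable_topology, euclidean_space}"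
  assumes a: "a > 0" and f: "has_bochner_integral lhalf f I"
  shows "has_bochner_integral lhalf (\<lambda>x. f (a * x)) (I /\<^sub>R a)"
proof -
  have "has_bochner_integral lborel (\<lambda>x. indicator {0<..} x *\<^sub>R f x) I"
    using f by (simp add: has_bochner_integral_iff integrable_restrict_space integral_restrict_space)
  hence "has_bochner_integral lborel (\<lambda>x. indicator {0<..} (0 + a * x) *\<^sub>R f (0 + a * x)) (I /\<^sub>R \<bar>a\<bar>)"
    using lborel_has_bochner_integral_real_affine_iff[of a "\<lambda>x. indicator {0<..} x *\<^sub>R f x" I 0] a by simp
  moreover have "(\<lambda>x. indicator {0<..} (0 + a * x) *\<^sub>R f (0 + a * x)) = (\<lambda>x. indicator {0<..} x *\<^sub>R f (a * x))"
    using a by (auto simp: fun_eq_iff indicator_def zero_less_mult_iff)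
  ultimately show ?thesis using a
    by (simp add: has_bochner_integral_iff integrable_restrict_space integral_restrict_space)
qed

lemma has_bochner_integral_Gamma:
  assumes "Re z > 0"
  shows "has_bochner_integral lhalf (\<lambda>t. of_real t powr (z - 1) * exp (- of_real t)) (Gamma z)"
proof -
  have eq: "(\<lambda>t. complex_of_real t powr (z - 1) * exp (- of_real t)) =
        (\<lambda>t. complex_of_real t powr (z - 1) / of_real (exp t))"
    by (simp add: fun_eq_iff exp_minus exp_of_real divide_inverse)
  have cont: "continuous_on {0<..} (\<lambda>t. complex_of_real t powr (z - 1) / of_real (exp t))"
    by (auto intro!: continuous_intros)
  show ?thesis unfolding eq
    by (rule has_bochner_integral_lhalf[OF absolutely_integrable_Gamma_integral'[OF assms]
          Gamma_integral_complex'[OF assms] cont])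
qed

lemma has_bochner_integral_Gamma_scaled_real:
  assumes "Re z > 0" "a > 0"
  shows "has_bochner_integral lhalf (\<lambda>t. of_real t powr (z - 1) * exp (- (of_real a * of_real t)))
           (Gamma z * of_real a powr (- z))"
proof -
  have "has_bochner_integral lhalf (\<lambda>t. of_real (a * t) powr (z - 1) * exp (- of_real (a * t))) (Gamma z /\<^sub>R a)"
    by (rule lhalf_scale[OF assms(2) has_bochner_integral_Gamma[OF assms(1)]])
  hence "has_bochner_integral lhalf (\<lambda>t. of_real a powr (1 - z) * (of_real (a * t) powr (z - 1) * exp (- of_real (a * t))))
     (of_real a powr (1 - z) * (Gamma z /\<^sub>R a))"
    by (rule has_bochner_integral_mult_right)
  moreover have "of_real a powr (1 - z) * (Gamma z /\<^sub>R a) = Gamma z * of_real a powr (- z)"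
    using assms(2) powr_add[of "of_real a :: complex" 1 "-z"]
    by (simp add: scaleR_conv_of_real field_simps)
  moreover have "of_real a powr (1 - z) * (of_real (a * t) powr (z - 1) * exp (- of_real (a * t))) =
     of_real t powr (z - 1) * exp (- (of_real a * of_real t))" if "t > 0" for t
  proof -
    have "complex_of_real (a * t) powr (z - 1) = of_real a powr (z - 1) * of_real t powr (z - 1)"
      using assms that by (simp add: powr_times_real)
    moreover have "of_real a powr (1 - z) * of_real a powr (z - 1) = (1::complex)"
      using assms(2) by (simp flip: powr_add)
    ultimately show ?thesis by (simp add: mult.assoc[symmetric])
  qed
  ultimately show ?thesis
    by (subst has_bochner_integral_cong) (auto simp: )
qed

lemma has_bochner_integral_Gamma_real:
  fixes z a :: real
  assumes "z > 0" "a > 0"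
  shows "has_bochner_integral lhalf (\<lambda>t. t powr (z - 1) * exp (- (a * t))) (Gamma z * a powr (- z))"
proof -
  have "has_bochner_integral lhalf (\<lambda>t. Re (of_real t powr (of_real z - 1) * exp (- (of_real a * of_real t))))
           (Re (Gamma (of_real z) * of_real a powr (- of_real z)))"
    using has_bochner_integral_Gamma_scaled_real[of "of_real z" a] assms
    by (intro has_bochner_integral_Re) auto
  moreover have "Re (of_real t powr (of_real z - 1) * exp (- (of_real a * of_real t))) = t powr (z - 1) * exp (- (a * t))"
    if "t > 0" for t
  proof -
    have "of_real t powr (of_real z - 1) * exp (- (of_real a * of_real t)) = complex_of_real (t powr (z - 1) * exp (- (a * t)))"
      using that by (simp add: powr_of_real[symmetric] exp_of_real[symmetric])
    thus ?thesis by (simp only: Re_complex_of_real)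
  qed
  moreover have "Gamma (of_real z) * of_real a powr (- of_real z) = complex_of_real (Gamma z * a powr (- z))"
    using assms by (simp add: powr_of_real[symmetric] Gamma_complex_of_real)
  ultimately show ?thesis
    by (subst has_bochner_integral_cong) (auto simp: )
qed

lemma norm_powr_of_real: "t > 0 \<Longrightarrow> norm (complex_of_real t powr z) = t powr Re z"
  by (simp add: norm_powr_real_powr)

text \<open>Controls all exponents between \<open>a\<close> and \<open>c\<close> at once, for small
  and for large \<open>t\<close>; locally uniform majorants in a complex exponent come from
  it.\<close>

lemma powr_real_le_sum: 
  fixes t :: real
  assumes "t > 0" "a \<le> b" "b \<le> c" shows "t powr b \<le> t powr a + t powr c"
proof (cases "t \<ge> 1")
  case True
  have "t powr b \<le> t powr c" using True assms by (intro powr_mono) auto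
  thus ?thesis by (simp add: add_increasing)
next
  case False
  have "t powr b \<le> t powr a" using False assms by (intro powr_mono') auto
  thus ?thesis by (simp add: add_increasing2)
qed

text \<open>The path of integration is not rotated: both sides are holomorphic in \<open>c\<close>
  for \<open>Re c > 0\<close> and agree for positive real \<open>c\<close>.\<close>

theorem has_bochner_integral_Gamma_scaled:
  assumes z: "Re z > 0" and c: "Re c > 0"
  shows "has_bochner_integral lhalf (\<lambda>t. of_real t powr (z - 1) * exp (- (c * of_real t)))
           (Gamma z * c powr (- z))"
proof -
  let ?f = "\<lambda>c t. complex_of_real t powr (z - 1) * exp (- (c * of_real t))"
  have meas: "?f c \<in> borel_measurable lhalf" for c
    by (rule measurable_lhalf_continuous) (auto intro!: continuous_intros)
  have nf: "norm (?f c t) = t powr (Re z - 1) * exp (- (Re c * t))" if "t > 0" for c t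
    using that by (simp add: norm_mult norm_powr_of_real)
  have gi: "integrable lhalf (\<lambda>t. t powr (Re z - 1) * exp (- (a * t)))" if "a > 0" for a
    using has_bochner_integral_Gamma_real[OF z that] by (simp add: has_bochner_integral_iff)
  have int: "integrable lhalf (?f c)" if "Re c > 0" for c
    by (rule Bochner_Integration.integrable_bound[OF gi[OF that] meas]) (auto intro!: AE_I2 simp: nf simp del: norm_mult)
  have "integral\<^sup>L lhalf (?f c) = Gamma z * c powr (- z)"
  proof -
    have o: "open {c. Re c > 0}" and cn: "connected {c. Re c > 0}"
      by (auto simp: open_halfspace_Re_gt convex_halfspace_Re_gt convex_connected)
    have hol: "(\<lambda>c. integral\<^sup>L lhalf (?f c)) holomorphic_on {c. Re c > 0}"
    proof (rule holomorphic_on_integral[OF o])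
      fix c :: complex assume c: "c \<in> {c. Re c > 0}"
      define r where "r = Re c / 2"
      have *: "Re w \<ge> r" if "w \<in> cball c r" for w
        using that abs_Re_le_cmod[of "c - w"] by (auto simp: dist_norm r_def)
      have "norm (?f w t) \<le> t powr (Re z - 1) * exp (- (r * t))" if "w \<in> cball c r" "t > 0" for w t
        using that *[OF that(1)] by (subst nf) (auto intro!: mult_left_mono)
      moreover have "cball c r \<subseteq> {c. Re c > 0}" using c * by (force simp: r_def)
      ultimately show "\<exists>r>0. \<exists>g. cball c r \<subseteq> {c. 0 < Re c} \<and> integrable lhalf g \<and>
            (\<forall>w\<in>cball c r. \<forall>x\<in>space lhalf. cmod (?f w x) \<le> g x)"
        using gi[of r] c by (intro exI[of _ r] conjI exI[of _ "\<lambda>t. t powr (Re z - 1) * exp (- (r * t))"]) (auto simp: r_def)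
    qed (use meas in \<open>auto intro!: holomorphic_intros\<close>)
    have lim: "1 islimpt (complex_of_real ` {0<..})"
      unfolding islimpt_approachable
    proof (intro allI impI)
      fix e :: real assume "e > 0"
      thus "\<exists>x'\<in>complex_of_real ` {0<..}. x' \<noteq> 1 \<and> dist x' 1 < e"
        by (intro bexI[of _ "of_real (1 + e/2)"] imageI) (auto simp: dist_norm)
    qed
    have "integral\<^sup>L lhalf (?f c) - Gamma z * c powr (- z) = 0"
    proof (rule analytic_continuation[where f = "\<lambda>c. integral\<^sup>L lhalf (?f c) - Gamma z * c powr (- z)", OF _ o cn _ _ lim])
      show "(\<lambda>c. integral\<^sup>L lhalf (?f c) - Gamma z * c powr (- z)) holomorphic_on {c. Re c > 0}"
        by (intro holomorphic_intros hol) (auto simp: complex_nonpos_Reals_iff)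
      show "integral\<^sup>L lhalf (?f c) - Gamma z * c powr (- z) = 0" if "c \<in> complex_of_real ` {0<..}" for c
        using that has_bochner_integral_Gamma_scaled_real[OF z] by (auto simp: has_bochner_integral_iff)
    qed (use c in auto)
    thus ?thesis by simp
  qed
  thus ?thesis using int[OF c] by (simp add: has_bochner_integral_iff)
qed

section \<open>Hankel's integral and the Bessel functions\<close>

lemma Gamma_neq_0:
  assumes "Re z > 0" shows "Gamma z \<noteq> 0"
  using assms by (auto simp: Gamma_eq_zero_iff elim!: nonpos_Ints_cases)

lemma norm_powr_le_exp:
  assumes "w \<noteq> 0"
  shows "norm (w powr a) \<le> norm w powr Re a * exp (pi * \<bar>Im a\<bar>)"
proof -
  have "- Im a * Arg w \<le> \<bar>Im a\<bar> * \<bar>Arg w\<bar>"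
    by (metis abs_ge_self abs_minus abs_mult mult_minus_left)
  also have "\<dots> \<le> \<bar>Im a\<bar> * pi"
    using Arg_le_pi[of w] mpi_less_Arg[of w] by (intro mult_left_mono) auto
  finally show ?thesis by (simp add: norm_powr_complex mult.commute mult_left_mono)
qed

lemma one_plus_powr_le:
  fixes y R :: real
  assumes "y \<ge> 0" "R \<ge> 0"
  shows "(1 + y) powr R \<le> 2 powr R * (1 + y powr R)"
proof -
  have "(1 + y) powr R \<le> (2 * max 1 y) powr R"
    using assms by (intro powr_mono2) auto
  also have "\<dots> = 2 powr R * max 1 y powr R" by (simp add: powr_mult)
  also have "max 1 y powr R \<le> 1 + y powr R" by (auto simp: max_def)
  finally show ?thesis by simp
qed

definition hankel_integrand :: "complex \<Rightarrow> complex \<Rightarrow> real \<Rightarrow> complex" where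
  "hankel_integrand s c t = of_real t powr (s - 1) * (1 + c * of_real t) powr (s - 1) * exp (- of_real t)"

text \<open>In classical terms this is c^(-s) U(s, 2s, 1/c) with Tricomi's confluent hypergeometric
  function U. The factor \<open>rGamma s\<close> makes it invariant under the exchange of
  \<open>s\<close> and \<open>1 - s\<close>.\<close>

definition hankel_int :: "complex \<Rightarrow> complex \<Rightarrow> complex" where
  "hankel_int s c = rGamma s * integral\<^sup>L lhalf (hankel_integrand s c)"

lemma one_plus_not_nonpos: "Re c = 0 \<Longrightarrow> 1 + c * of_real t \<notin> \<real>\<^sub>\<le>\<^sub>0"
  by (auto simp: complex_nonpos_Reals_iff)

lemma one_plus_neq_0: "Re c = 0 \<Longrightarrow> 1 + c * of_real t \<noteq> 0"
  by (auto simp: complex_eq_iff)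

lemma measurable_hankel_integrand [measurable]:
  "Re c = 0 \<Longrightarrow> hankel_integrand s c \<in> borel_measurable lhalf"
  unfolding hankel_integrand_def
  by (rule measurable_lhalf_continuous)
    (auto intro!: continuous_intros dest: one_plus_not_nonpos one_plus_neq_0)

definition hankel_bound :: "real \<Rightarrow> real \<Rightarrow> complex \<Rightarrow> real \<Rightarrow> real" where
  "hankel_bound \<delta> R c t = exp (pi * R) * 2 powr R *
     ((t powr (\<delta> - 1) + t powr (R - 1)) * (1 + norm c powr R * t powr R) * exp (- t))"

lemma integrable_hankel_bound:
  assumes "\<delta> > 0" "R \<ge> 1"
  shows "integrable lhalf (hankel_bound \<delta> R c)"
proof -
  have I: "integrable lhalf (\<lambda>t. t powr (a - 1) * exp (- t))" if "a > 0" for a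
    using has_bochner_integral_Gamma_real[OF that, of 1] by (simp add: has_bochner_integral_iff)
  have "hankel_bound \<delta> R c t = exp (pi * R) * 2 powr R *
      (t powr (\<delta> - 1) * exp (- t) + t powr (R - 1) * exp (- t) +
       norm c powr R * (t powr ((\<delta> + R) - 1) * exp (- t)) +
       norm c powr R * (t powr ((R + R) - 1) * exp (- t)))" for t
  proof -
    have "t powr (a + R - 1) = t powr (a - 1) * t powr R" for a
      by (simp add: algebra_simps flip: powr_add)
    thus ?thesis by (simp only: hankel_bound_def) (simp only: ring_distribs mult_1_left mult_1_right mult_ac)
  qed
  hence "hankel_bound \<delta> R c = (\<lambda>t. exp (pi * R) * 2 powr R *
      (t powr (\<delta> - 1) * exp (- t) + t powr (R - 1) * exp (- t) +
       norm c powr R * (t powr ((\<delta> + R) - 1) * exp (- t)) +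
       norm c powr R * (t powr ((R + R) - 1) * exp (- t))))" by (rule ext)
  thus ?thesis using assms
    by (simp only:) (intro integrable_mult_right Bochner_Integration.integrable_add I; simp)
qed

text \<open>For imaginary \<open>c\<close> the modulus of \<open>1 + c * of_real t\<close> is at
  least 1, so its exponent \<open>Re s - 1\<close>, of either sign, may be raised to
  \<open>R\<close>. One majorant then serves a whole neighbourhood of \<open>s\<close>, as
  differentiation under the integral requires.\<close>

lemma norm_hankel_integrand_le:
  assumes "Re c = 0" "t > 0" "\<delta> \<le> Re s" "Re s \<le> R" "\<bar>Im s\<bar> \<le> R" "R \<ge> 1"
  shows "norm (hankel_integrand s c t) \<le> hankel_bound \<delta> R c t"
proof -
  let ?w = "1 + c * of_real t"
  have w1: "norm ?w \<ge> 1"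
    using abs_Re_le_cmod[of ?w] assms by simp
  have w2: "norm ?w \<le> 1 + norm c * t"
    by (rule order_trans[OF norm_triangle_ineq]) (use assms in \<open>simp add: norm_mult\<close>)
  have "norm (?w powr (s - 1)) \<le> norm ?w powr Re (s - 1) * exp (pi * \<bar>Im (s - 1)\<bar>)"
    using one_plus_neq_0[of c t] assms by (intro norm_powr_le_exp) auto
  also have "\<dots> \<le> norm ?w powr R * exp (pi * R)"
    using assms w1 by (intro mult_mono powr_mono) auto
  also have "norm ?w powr R \<le> (1 + norm c * t) powr R"
    using assms w2 by (intro powr_mono2) auto
  also have "\<dots> \<le> 2 powr R * (1 + (norm c * t) powr R)"
    using assms by (intro one_plus_powr_le) auto
  also have "(norm c * t) powr R = norm c powr R * t powr R"
    using assms by (simp add: powr_mult)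
  finally have A: "norm (?w powr (s - 1)) \<le> 2 powr R * (1 + norm c powr R * t powr R) * exp (pi * R)"
    by simp
  have B: "norm (complex_of_real t powr (s - 1)) \<le> t powr (\<delta> - 1) + t powr (R - 1)"
    using assms by (simp add: norm_powr_of_real powr_real_le_sum)
  have "norm (hankel_integrand s c t) \<le>
      (t powr (\<delta> - 1) + t powr (R - 1)) * (2 powr R * (1 + norm c powr R * t powr R) * exp (pi * R)) * exp (- t)"
    unfolding hankel_integrand_def norm_mult using A B
    by (intro mult_mono) auto
  thus ?thesis by (simp add: hankel_bound_def mult_ac)
qed

lemma integrable_hankel_integrand:
  assumes "Re c = 0" "Re s > 0"
  shows "integrable lhalf (hankel_integrand s c)"
proof -
  define R where "R = 1 + norm s"
  have "Re s \<le> R" "\<bar>Im s\<bar> \<le> R" "R \<ge> 1"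
    using abs_Re_le_cmod[of s] abs_Im_le_cmod[of s] by (auto simp: R_def)
  hence "norm (hankel_integrand s c t) \<le> hankel_bound (Re s) R c t" if "t > 0" for t
    using norm_hankel_integrand_le[of c t "Re s" s R] assms that by auto
  thus ?thesis
    by (intro Bochner_Integration.integrable_bound[OF integrable_hankel_bound[of "Re s" R c]])
      (use assms \<open>R \<ge> 1\<close> in \<open>auto intro!: AE_I2 order_trans[OF _ abs_ge_self]\<close>)
qed

lemma holomorphic_hankel_int:
  assumes "Re c = 0"
  shows "(\<lambda>s. hankel_int s c) holomorphic_on {s. Re s > 0}"
proof -
  have "(\<lambda>s. integral\<^sup>L lhalf (hankel_integrand s c)) holomorphic_on {s. Re s > 0}"
  proof (rule holomorphic_on_integral)
    fix s assume s: "s \<in> {s. Re s > 0}"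
    define r where "r = Re s / 2"
    define R where "R = 1 + norm s + r"
    have r: "r > 0" using s by (simp add: r_def)
    have *: "Re w \<ge> r \<and> Re w \<le> R \<and> \<bar>Im w\<bar> \<le> R" if "w \<in> cball s r" for w
    proof -
      have n: "norm (s - w) \<le> r" using that by (simp add: dist_norm)
      hence "norm w \<le> R" using norm_triangle_ineq4[of s "s - w"] by (simp add: R_def)
      thus ?thesis using abs_Re_le_cmod[of w] abs_Im_le_cmod[of w] abs_Re_le_cmod[of "s - w"] n
        by (auto simp: r_def abs_le_iff)
    qed
    have "R \<ge> 1" using r by (simp add: R_def)
    show "\<exists>r>0. \<exists>g. cball s r \<subseteq> {s. 0 < Re s} \<and> integrable lhalf g \<and>
            (\<forall>w\<in>cball s r. \<forall>x\<in>space lhalf. cmod (hankel_integrand w c x) \<le> g x)"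
    proof (intro exI conjI ballI)
      show "cball s r \<subseteq> {s. 0 < Re s}" using * r by force
      show "integrable lhalf (hankel_bound r R c)"
        using r \<open>R \<ge> 1\<close> by (rule integrable_hankel_bound)
      fix w x assume "w \<in> cball s r" "x \<in> space lhalf"
      thus "cmod (hankel_integrand w c x) \<le> hankel_bound r R c x"
        using *[of w] assms \<open>R \<ge> 1\<close> by (intro norm_hankel_integrand_le) auto
    qed fact
  next
    fix x assume "x \<in> space lhalf"
    thus "(\<lambda>z. hankel_integrand z c x) holomorphic_on {s. 0 < Re s}"
      using one_plus_not_nonpos[OF assms, of x] unfolding hankel_integrand_def
      by (auto intro!: holomorphic_intros)
  qed (use assms in \<open>auto simp: open_halfspace_Re_gt\<close>)
  thus ?thesis unfolding hankel_int_def by (intro holomorphic_intros)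
qed

text \<open>The double integral in the proof is symmetric in \<open>s\<close> and \<open>1 - s\<close>.\<close>

lemma hankel_int_reflect:
  assumes c: "Re c = 0" and s: "0 < Re s" "Re s < 1"
  shows "hankel_int (1 - s) c = hankel_int s c"
proof -
  interpret L: sigma_finite_measure lhalf by (rule sigma_finite_lhalf)
  interpret P: pair_sigma_finite lhalf lhalf ..
  let ?p = "\<lambda>s t. complex_of_real t powr (s - 1) * exp (- of_real t)"
  let ?F = "\<lambda>t y. ?p s t * ?p (1 - s) y * exp (- (c * of_real t * of_real y))"
  have m: "?p z \<in> borel_measurable lhalf" for z
    by (rule measurable_lhalf_continuous) (auto intro!: continuous_intros)
  have idm: "(\<lambda>x. x) \<in> borel_measurable lhalf"
    by (rule measurable_lhalf_continuous) (auto intro!: continuous_intros)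
  \<comment> \<open>The power \<open>(1 + c * of_real t) powr (z - 1)\<close> is itself a Gamma
    integral over \<open>y\<close>, with parameter \<open>1 + c * of_real t\<close> of real part 1;
    its convergence at 0 is where \<open>Re z < 1\<close> enters.\<close>
  have inner: "has_bochner_integral lhalf (\<lambda>y. ?p z t * ?p (1 - z) y * exp (- (c * of_real t * of_real y)))
      (Gamma (1 - z) * hankel_integrand z c t)" if "t > 0" "0 < Re z" "Re z < 1" for z t
  proof -
    have "has_bochner_integral lhalf (\<lambda>y. of_real y powr ((1 - z) - 1) * exp (- ((1 + c * of_real t) * of_real y)))
       (Gamma (1 - z) * (1 + c * of_real t) powr (- (1 - z)))"
      by (rule has_bochner_integral_Gamma_scaled) (use that c in auto)
    from has_bochner_integral_mult_right[OF this, of "?p z t"]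
    show ?thesis by (simp add: hankel_integrand_def mult_ac ring_distribs exp_add exp_diff exp_minus divide_inverse)
  qed
  have int: "integrable (lhalf \<Otimes>\<^sub>M lhalf) (case_prod ?F)"
  proof (rule P.Fubini_integrable)
    have m1: "(\<lambda>x. ?p z (fst x)) \<in> borel_measurable (lhalf \<Otimes>\<^sub>M lhalf)"
         "(\<lambda>x. ?p z (snd x)) \<in> borel_measurable (lhalf \<Otimes>\<^sub>M lhalf)"
         "fst \<in> borel_measurable (lhalf \<Otimes>\<^sub>M lhalf)" "snd \<in> borel_measurable (lhalf \<Otimes>\<^sub>M lhalf)" for z
      using measurable_compose[OF measurable_fst m] measurable_compose[OF measurable_snd m]
        measurable_compose[OF measurable_fst idm] measurable_compose[OF measurable_snd idm] by auto
    have "(\<lambda>x. ?p s (fst x) * ?p (1 - s) (snd x) * exp (- (c * of_real (fst x) * of_real (snd x))))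
        \<in> borel_measurable (lhalf \<Otimes>\<^sub>M lhalf)"
      using m1 by (intro borel_measurable_times m1 borel_measurable_exp borel_measurable_uminus) auto
    thus "case_prod ?F \<in> borel_measurable (lhalf \<Otimes>\<^sub>M lhalf)" by (simp add: case_prod_beta')
    show "AE x in lhalf. integrable lhalf (\<lambda>y. case_prod ?F (x, y))"
      using inner s by (auto intro!: AE_I2 simp: has_bochner_integral_iff)
    \<comment> \<open>Since \<open>c\<close> is imaginary the mixed exponential has modulus 1, so
      the majorant is a product of two convergent Gamma integrands.\<close>
    have nF: "norm (?F t y) = norm (?p s t) * norm (?p (1 - s) y)" for t y
      using c by (simp add: norm_mult)
    have "integrable lhalf (\<lambda>t. norm (?p s t) * integral\<^sup>L lhalf (\<lambda>y. norm (?p (1 - s) y)))"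
      using has_bochner_integral_Gamma[of s] s
      by (intro integrable_mult_left integrable_norm) (auto simp: has_bochner_integral_iff)
    also have "(\<lambda>t. norm (?p s t) * integral\<^sup>L lhalf (\<lambda>y. norm (?p (1 - s) y))) =
        (\<lambda>t. integral\<^sup>L lhalf (\<lambda>y. norm (case_prod ?F (t, y))))"
      by (simp only: split nF integral_mult_right_zero)
    finally show "integrable lhalf (\<lambda>x. \<integral>y. norm (case_prod ?F (x, y)) \<partial>lhalf)" .
  qed
  have "Gamma (1 - s) * integral\<^sup>L lhalf (hankel_integrand s c) = (\<integral>t. Gamma (1 - s) * hankel_integrand s c t \<partial>lhalf)"
    by simp
  also have "\<dots> = (\<integral>t. (\<integral>y. ?F t y \<partial>lhalf) \<partial>lhalf)"
    using inner[of _ s] s by (intro Bochner_Integration.integral_cong) (auto simp: has_bochner_integral_iff)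
  also have "\<dots> = (\<integral>y. (\<integral>t. ?F t y \<partial>lhalf) \<partial>lhalf)"
    by (rule P.Fubini_integral[OF int, symmetric])
  also have "\<dots> = (\<integral>y. Gamma s * hankel_integrand (1 - s) c y \<partial>lhalf)"
    using inner[of _ "1 - s"] s
    by (intro Bochner_Integration.integral_cong) (auto simp: has_bochner_integral_iff mult_ac)
  also have "\<dots> = Gamma s * integral\<^sup>L lhalf (hankel_integrand (1 - s) c)" by simp
  finally have eq: "Gamma (1 - s) * integral\<^sup>L lhalf (hankel_integrand s c) = \<dots>" .
  have "Gamma s \<noteq> 0" "Gamma (1 - s) \<noteq> 0"
    using s by (simp_all add: Gamma_neq_0)
  thus ?thesis using eq by (simp add: hankel_int_def rGamma_inverse_Gamma field_simps)
qed

lemma lhalf_FTC: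
  fixes G f :: "real \<Rightarrow> complex"
  assumes G: "\<And>y. y \<ge> 0 \<Longrightarrow> (G has_vector_derivative f y) (at y within {0..})"
    and f: "continuous_on {0..} f" "integrable lhalf f"
  shows "((\<lambda>T. G T) \<longlongrightarrow> G 0 + integral\<^sup>L lhalf f) at_top"
proof -
  let ?f = "\<lambda>x. indicator {0<..} x *\<^sub>R f x"
  have "integrable lborel ?f" using f(2) by (simp add: integrable_restrict_space)
  from tendsto_integral_at_top[OF _ this]
  have "((\<lambda>y. \<integral>x. indicator {..y} x *\<^sub>R ?f x \<partial>lborel) \<longlongrightarrow> integral\<^sup>L lborel ?f) at_top" by simp
  moreover have "integral\<^sup>L lborel ?f = integral\<^sup>L lhalf f" by (simp add: integral_restrict_space)
  moreover have "\<forall>\<^sub>F y in at_top. (\<integral>x. indicator {..y} x *\<^sub>R ?f x \<partial>lborel) = G y - G 0"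
    using eventually_ge_at_top[of "0::real"]
  proof eventually_elim
    case (elim T)
    have "(\<integral>x. indicator {..T} x *\<^sub>R ?f x \<partial>lborel) = (\<integral>x. indicator {0..T} x *\<^sub>R f x \<partial>lborel)"
      by (rule integral_discrete_difference[of "{0}"]) (auto simp: indicator_def)
    also have "\<dots> = G T - G 0"
      by (rule integral_FTC_Icc[OF elim])
        (auto intro!: has_vector_derivative_within_subset[OF G] continuous_on_subset[OF f(1)])
    finally show ?case .
  qed
  ultimately have "((\<lambda>y. G y - G 0) \<longlongrightarrow> integral\<^sup>L lhalf f) at_top"
    by (simp add: tendsto_cong)
  from tendsto_add[OF tendsto_const[of "G 0"] this] show ?thesis by simp
qed

text \<open>The cuts of the principal power of \<open>1 - z\<^sup>2\<close> lie on the real axis, to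
  the left of -1 and to the right of 1, so the power is holomorphic above the axis.\<close>

lemma one_minus_square_nonpos_iff:
  assumes "Im z > 0"
  shows "1 - z\<^sup>2 \<notin> \<real>\<^sub>\<le>\<^sub>0"
proof
  assume *: "1 - z\<^sup>2 \<in> \<real>\<^sub>\<le>\<^sub>0"
  hence "Im (z\<^sup>2) = 0" "Re (z\<^sup>2) \<ge> 1" by (auto simp: complex_nonpos_Reals_iff)
  hence "Re z = 0" "Re (z\<^sup>2) \<ge> 1" using assms by (auto simp: power2_eq_square)
  moreover from this(1) have "Re (z\<^sup>2) = - ((Im z)\<^sup>2)" by (simp add: power2_eq_square)
  ultimately show False using zero_le_power2[of "Im z"] by linarith
qed

text \<open>A positive exponent keeps the principal power continuous at zeros of the base. This is
  needed at the corners -1 and 1 of the half-strip, where \<open>1 - z\<^sup>2\<close> vanishes, and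
  is the reason for taking \<open>r > 1\<close> there.\<close>

lemma continuous_powr_pos:
  fixes f :: "'a::t2_space \<Rightarrow> complex" and r :: real
  assumes "continuous_on S f" "r > 0" "\<And>x. x \<in> S \<Longrightarrow> f x \<in> \<real>\<^sub>\<le>\<^sub>0 \<Longrightarrow> f x = 0"
  shows "continuous_on S (\<lambda>x. f x powr of_real r)"
  unfolding continuous_on_def
proof
  fix x assume x: "x \<in> S"
  have lim: "(f \<longlongrightarrow> f x) (at x within S)" using assms(1) x by (simp add: continuous_on_def)
  show "((\<lambda>x. f x powr of_real r) \<longlongrightarrow> f x powr of_real r) (at x within S)"
  proof (cases "f x = 0")
    case False
    thus ?thesis using assms(3)[OF x] by (intro tendsto_intros lim) auto
  next
    case True
    have "((\<lambda>x. norm (f x) powr r) \<longlongrightarrow> norm (f x) powr r) (at x within S)"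
      by (rule tendsto_powr2) (use lim assms(2) True in \<open>auto intro!: tendsto_intros tendsto_norm_zero\<close>)
    thus ?thesis using True assms(2)
      by (intro tendsto_norm_zero_cancel[where f = "\<lambda>x. f x powr of_real r", THEN tendsto_eq_rhs])
        (auto simp: norm_powr_real_powr')
  qed
qed

section \<open>Poisson's integral for the Bessel function of the first kind\<close>

lemma Poisson_moment:
  fixes r :: real
  assumes r: "r > 1"
  shows "integral {0..1} (\<lambda>t. t ^ (2 * k) * (1 - t\<^sup>2) powr (r - 1)) = Beta (real k + 1/2) r / 2"
proof -
  let ?f = "\<lambda>t. t ^ (2 * k) * (1 - t\<^sup>2) powr (r - 1)"
  \<comment> \<open>The substitution \<open>t = sqrt y\<close>, differentiable except at 0, leads to
    Euler's Beta integral.\<close>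
  have sub: "((\<lambda>y. (1 / (2 * sqrt y)) *\<^sub>R ?f (sqrt y)) has_integral
          (integral {sqrt 0..sqrt 1} ?f - integral {sqrt 1..sqrt 0} ?f)) {0..1}"
  proof (rule has_integral_substitution_general[where s = "{0}" and c = 0 and d = 1])
    show "(sqrt has_real_derivative 1 / (2 * sqrt x)) (at x within {0..1})" if "x \<in> {0..1} - {0}" for x
      
    proof (rule has_field_derivative_at_within)
      have "x > 0" using that by auto
      thus "(sqrt has_real_derivative 1 / (2 * sqrt x)) (at x)"
        by (simp add: DERIV_real_sqrt_generic inverse_eq_divide)
    qed
    show "continuous_on {0..1} (\<lambda>t::real. t ^ (2 * k) * (1 - t\<^sup>2) powr (r - 1))"
      using r by (intro continuous_intros continuous_on_powr') (auto simp: abs_square_le_1)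
  qed (auto intro!: continuous_intros)
  have B: "((\<lambda>t. t powr (real k + 1/2 - 1) * (1 - t) powr (r - 1)) has_integral Beta (real k + 1/2) r) {0..1}"
    using r by (intro has_integral_Beta_real) auto
  have "((\<lambda>y. (1 / (2 * sqrt y)) *\<^sub>R ?f (sqrt y)) has_integral Beta (real k + 1/2) r / 2) {0..1}"
  proof (rule has_integral_spike_finite[OF _ _ has_integral_divide[OF B, of 2]])
    fix y :: real assume "y \<in> {0..1} - {0}"
    hence y: "y > 0" by auto
    have "sqrt y ^ (2 * k) = y powr real k" using y by (simp add: power_mult powr_realpow)
    moreover have "y powr (real k + 1/2 - 1) = y powr real k * y powr (-1/2)"
      by (simp flip: powr_add)
    moreover have "y powr (-1/2) = 1 / sqrt y"
    proof -
      have "y powr (-1/2) = inverse (y powr (1/2))" using powr_minus[of y "1/2"] by simp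
      thus ?thesis by (simp only: powr_half_sqrt[OF less_imp_le[OF y]] inverse_eq_divide)
    qed
    ultimately show "(1 / (2 * sqrt y)) *\<^sub>R ?f (sqrt y) = y powr (real k + 1/2 - 1) * (1 - y) powr (r - 1) / 2"
      using y by simp
  qed auto
  from has_integral_unique[OF sub this] show ?thesis by simp
qed

lemma Gamma_nat_plus_half:
  "Gamma (real k + 1/2) = fact (2 * k) * sqrt pi / (4 ^ k * fact k)"
proof (induction k)
  case (Suc k)
  have "Gamma (real (Suc k) + 1/2) = (real k + 1/2) * Gamma (real k + 1/2)"
  proof -
    have "real k + 1/2 \<notin> \<int>\<^sub>\<le>\<^sub>0" by (auto elim!: nonpos_Ints_cases)
    from Gamma_plus1[OF this] show ?thesis by (simp add: add_ac)
  qed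
  moreover have "fact (2 * Suc k) = 4 * (real k + 1) * (real k + 1/2) * fact (2 * k)"
    by (simp add: algebra_simps)
  moreover have "fact (Suc k) = (real k + 1) * fact k" by simp
  moreover have "real k + 1 \<noteq> 0" by linarith
  ultimately show ?case unfolding Suc by (simp only:) (simp add: divide_simps)
qed (simp add: Gamma_one_half_real)

text \<open>The cosine series is integrated term by term, with majorant
  \<open>x ^ (2 * k) / fact (2 * k)\<close> on \<open>[0, 1]\<close>. By
  \<open>Gamma_nat_plus_half\<close> the factor \<open>fact (2 * k)\<close> cancels between the
  series and the Beta moments, which leaves the power series of \<open>Bessel_J\<close>.\<close>

lemma Bessel_J_Poisson:
  fixes r x :: real
  assumes r: "r > 1" and x: "x > 0"
  shows "Bessel_J (of_real (r - 1/2)) (of_real x) =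
    of_real ((x / 2) powr (r - 1/2) / (sqrt pi * Gamma r) *
      (2 * integral {0..1} (\<lambda>t. cos (x * t) * (1 - t\<^sup>2) powr (r - 1))))"
proof -
  let ?w = "\<lambda>t. (1 - t\<^sup>2) powr (r - 1)"
  let ?c = "\<lambda>k. (- 1) ^ k / fact (2 * k) :: real"
  let ?u = "\<lambda>k t. ?c k * (x * t) ^ (2 * k) * ?w t"
  have cw: "continuous_on {0..1} ?w"
    using r by (intro continuous_intros continuous_on_powr') (auto simp: abs_square_le_1)
  have w1: "0 \<le> ?w t" "?w t \<le> 1" if "t \<in> {0..1}" for t
    using that r by (auto intro!: powr_le1 simp: abs_square_le_1)
  have cs: "(\<lambda>k. ?c k * y ^ (2 * k)) sums cos y" for y :: real
    using cos_paired[of y] .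
  have ul: "uniform_limit {0..1} (\<lambda>n t. \<Sum>k<n. ?u k t) (\<lambda>t. cos (x * t) * ?w t) sequentially"
  proof -
    have "uniform_limit {0..1} (\<lambda>n t. \<Sum>k<n. ?u k t) (\<lambda>t. \<Sum>k. ?u k t) sequentially"
    proof (rule Weierstrass_m_test)
      fix k t assume t: "t \<in> {0..1::real}"
      have "norm (?u k t) = \<bar>x * t\<bar> ^ (2 * k) / fact (2 * k) * ?w t"
        using w1[OF t] by (simp add: abs_mult power_abs)
      also have "\<dots> \<le> x ^ (2 * k) / fact (2 * k) * 1"
        using w1[OF t] t x by (intro mult_mono divide_right_mono power_mono)
          (auto simp: abs_mult mult_left_le)
      finally show "norm (?u k t) \<le> x ^ (2 * k) / fact (2 * k)" by simp
    next
      have "summable (\<lambda>n. x ^ n / fact n)" using summable_exp[of x] by (simp add: field_simps)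
      from summable_reindex[OF this, of "\<lambda>k. 2 * k"]
      show "summable (\<lambda>k. x ^ (2 * k) / fact (2 * k))"
        using x by (auto simp: o_def inj_def)
    qed
    moreover have "(\<Sum>k. ?u k t) = cos (x * t) * ?w t" for t
      using sums_mult2[OF cs[of "x * t"], of "?w t"] by (simp add: sums_iff)
    ultimately show ?thesis by simp
  qed
  obtain I J where IJ: "\<And>n. ((\<lambda>t. \<Sum>k<n. ?u k t) has_integral I n) {0..1}"
      "((\<lambda>t. cos (x * t) * ?w t) has_integral J) {0..1}" "I \<longlonglongrightarrow> J"
    by (rule uniform_limit_integral[OF ul]) (use cw in \<open>auto intro!: continuous_intros\<close>)
  have mom: "(?u k has_integral ?c k * x ^ (2 * k) * (Beta (real k + 1/2) r / 2)) {0..1}" for k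
  proof -
    have "((\<lambda>t. t ^ (2 * k) * ?w t) has_integral Beta (real k + 1/2) r / 2) {0..1}"
      unfolding Poisson_moment[OF r, symmetric]
      by (intro integrable_integral integrable_continuous_real continuous_intros cw)
    from has_integral_mult_right[OF this, of "?c k * x ^ (2 * k)"]
    show ?thesis by (simp add: power_mult_distrib mult_ac)
  qed
  have "I n = (\<Sum>k<n. ?c k * x ^ (2 * k) * (Beta (real k + 1/2) r / 2))" for n
    using has_integral_sum[of "{..<n}" ?u, OF _ mom] IJ(1)[of n] has_integral_unique by blast
  hence "I = (\<lambda>n. \<Sum>k<n. ?c k * x ^ (2 * k) * (Beta (real k + 1/2) r / 2))" by (rule ext)
  hence J: "(\<lambda>k. ?c k * x ^ (2 * k) * (Beta (real k + 1/2) r / 2)) sums J"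
    using IJ(3) by (simp only: sums_def)
  define K where "K = (x / 2) powr (r - 1/2) / (sqrt pi * Gamma r)"
  have Gr: "Gamma r > 0" using r by (intro Gamma_real_pos) auto
  have t: "K * 2 * (?c k * x ^ (2 * k) * (Beta (real k + 1/2) r / 2)) =
        (- 1) ^ k / fact k * rGamma (r - 1/2 + real k + 1) * (x / 2) powr (r - 1/2 + 2 * real k)" for k
  proof -
    define P Q g where "P = (x / 2) powr (r - 1/2)" and "Q = (x / 2) ^ (2 * k)"
      and "g = rGamma (r - 1/2 + real k + 1)"
    have 1: "(x / 2) powr (r - 1/2 + 2 * real k) = P * Q"
      using x by (simp add: P_def Q_def powr_add powr_realpow[symmetric])
    have 2: "Beta (real k + 1/2) r = fact (2 * k) * sqrt pi / (4 ^ k * fact k) * Gamma r * g"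
      by (simp add: Beta_altdef Gamma_nat_plus_half g_def algebra_simps)
    have 3: "x ^ (2 * k) = 4 ^ k * Q" by (simp add: Q_def power_mult power_divide)
    have 4: "K = P / (sqrt pi * Gamma r)" by (simp add: K_def P_def)
    show ?thesis unfolding 1 2 3 4 g_def[symmetric] using Gr by (simp add: divide_simps)
  qed
  have "(\<lambda>k. (- 1) ^ k / fact k * rGamma (r - 1/2 + real k + 1) * (x / 2) powr (r - 1/2 + 2 * real k)) sums (K * 2 * J)"
    unfolding t[symmetric] by (intro sums_mult J)
  hence "(\<lambda>k. complex_of_real ((- 1) ^ k / fact k * rGamma (r - 1/2 + real k + 1) * (x / 2) powr (r - 1/2 + 2 * real k)))
       sums of_real (K * 2 * J)" by (rule sums_of_real)
  moreover have "complex_of_real ((- 1) ^ k / fact k * rGamma (r - 1/2 + real k + 1) * (x / 2) powr (r - 1/2 + 2 * real k)) =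
     (- 1) ^ k / fact k * rGamma (of_real (r - 1/2) + of_nat k + 1) * (of_real x / 2) powr (of_real (r - 1/2) + 2 * of_nat k)" for k
  proof -
    have "(complex_of_real x / 2) powr (of_real (r - 1/2) + 2 * of_nat k) = of_real (x / 2) powr of_real (r - 1/2 + 2 * real k)"
      by simp
    also have "\<dots> = of_real ((x / 2) powr (r - 1/2 + 2 * real k))"
      using x by (intro powr_of_real) auto
    finally have 1: "(complex_of_real x / 2) powr (of_real (r - 1/2) + 2 * of_nat k) = \<dots>" .
    have 2: "rGamma (complex_of_real (r - 1/2) + of_nat k + 1) = of_real (rGamma (r - 1/2 + real k + 1))"
      by (subst rGamma_complex_of_real[symmetric]) simp
    show ?thesis unfolding 1 2 by simp
  qed
  ultimately have "Bessel_J (of_real (r - 1/2)) (of_real x) = of_real (K * 2 * J)"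
    unfolding Bessel_J_def by (simp only: sums_iff)
  moreover have "J = integral {0..1} (\<lambda>t. cos (x * t) * ?w t)" using IJ(2) by (simp add: integral_unique)
  ultimately show ?thesis by (simp add: K_def mult.assoc)
qed

section \<open>Hankel functions as integrals along the sides of a half-strip\<close>

lemma powr_mult_Im_Ln:
  assumes "w \<noteq> 0" "z \<noteq> 0" "- pi < Im (Ln w) + Im (Ln z)" "Im (Ln w) + Im (Ln z) \<le> pi"
  shows "(w * z) powr a = w powr a * z powr a"
  using assms by (simp add: powr_def Ln_times_simple exp_add ring_distribs)

lemma powr_mult_of_real:
  fixes z :: complex
  assumes "r > 0" "z \<noteq> 0"
  shows "(of_real r * z) powr a = of_real r powr a * z powr a"
  using assms by (simp add: powr_def Ln_times_of_real Ln_of_real exp_add ring_distribs)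

text \<open>With K = \<open>hankel_const x\<close>, the Hankel functions of order
  \<open>s - 1/2\<close> are 2iK \<open>hankel_p s x\<close> (second kind) and -2iK
  \<open>hankel_m s x\<close> (first kind). The letters give the sign of \<i> in the base of the
  power, which is opposite to the sign in the exponential.\<close>

definition hankel_p :: "complex \<Rightarrow> real \<Rightarrow> complex" where
  "hankel_p s x = exp (- \<i> * of_real x) * \<i> powr (s - 1) * hankel_int s (- \<i> / of_real (2 * x))"

definition hankel_m :: "complex \<Rightarrow> real \<Rightarrow> complex" where
  "hankel_m s x = exp (\<i> * of_real x) * (- \<i>) powr (s - 1) * hankel_int s (\<i> / of_real (2 * x))"

text \<open>For \<open>e = \<i> * a\<close> with \<open>a\<close> = 1 or -1 this is the integral of
  \<open>exp (\<i> * x * z) * (1 - z\<^sup>2) powr (r - 1)\<close> up the side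
  \<open>Re z = a\<close>, without the constant \<open>exp (\<i> * a * x)\<close> and the factor
  \<i> of dz. Rescaling by \<open>x\<close> turns it into Hankel's integral.\<close>

lemma hankel_vertical:
  fixes x r :: real and e :: complex
  assumes x: "x > 0" and r: "r > 1" and e: "e = \<i> \<or> e = - \<i>"
  shows "has_bochner_integral lhalf (\<lambda>y. of_real (exp (- x * y)) * (of_real (y\<^sup>2) - 2 * e * of_real y) powr of_real (r - 1))
           (of_real ((2 / x) powr (r - 1) / x * Gamma r) * ((- e) powr of_real (r - 1) * hankel_int (of_real r) (e / of_real (2 * x))))"
proof -
  let ?c = "e / of_real (2 * x)"
  have Gr: "Gamma r > 0" using r by (intro Gamma_real_pos) auto
  have c: "Re ?c = 0" using e by auto
  have "has_bochner_integral lhalf (hankel_integrand (of_real r) ?c) (Gamma (of_real r) * hankel_int (of_real r) ?c)"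
    using integrable_hankel_integrand[OF c, of "of_real r"] r Gamma_neq_0[of "of_real r"]
    by (simp add: has_bochner_integral_iff hankel_int_def rGamma_inverse_Gamma)
  from has_bochner_integral_mult_right[OF lhalf_scale[OF x this], of "of_real ((2 / x) powr (r - 1)) * (- e) powr of_real (r - 1)"]
  have "has_bochner_integral lhalf (\<lambda>y. of_real ((2 / x) powr (r - 1)) * (- e) powr of_real (r - 1) *
          hankel_integrand (of_real r) ?c (x * y))
      (of_real ((2 / x) powr (r - 1) / x * Gamma r) * ((- e) powr of_real (r - 1) * hankel_int (of_real r) ?c))"
    using x by (simp add: scaleR_conv_of_real Gamma_complex_of_real field_simps)
  moreover have "of_real ((2 / x) powr (r - 1)) * (- e) powr of_real (r - 1) * hankel_integrand (of_real r) ?c (x * y) =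
      of_real (exp (- x * y)) * (of_real (y\<^sup>2) - 2 * e * of_real y) powr of_real (r - 1)" if y: "y > 0" for y
  proof -
    let ?a = "complex_of_real (r - 1)"
    let ?w = "1 + e * of_real (y / 2)"
    have Rw: "Re ?w > 0" using e by auto
    hence w0: "?w \<noteq> 0" by (metis less_irrefl zero_complex.simps(1))
    have e0: "- e \<noteq> 0" using e by auto
    \<comment> \<open>As \<open>e\<^sup>2 = - 1\<close>, the base
      \<open>y\<^sup>2 - 2 * e * y\<close> factors as
      \<open>2 * y * (- e) * (1 + e * y / 2)\<close>. The argument of \<open>- e\<close> is at most
      pi/2 in modulus and that of the last factor is below pi/2, so the principal powers
      multiply.\<close>
    have "\<bar>Im (Ln (- e))\<bar> \<le> pi / 2" using e by auto
    hence s: "(- e * ?w) powr ?a = (- e) powr ?a * ?w powr ?a"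
      using Re_Ln_pos_lt_imp[OF Rw] by (intro powr_mult_Im_Ln e0 w0) (simp_all add: abs_le_iff abs_less_iff)
    have "of_real (y\<^sup>2) - 2 * e * of_real y = of_real (2 * y) * (- e * ?w)"
      using e by (elim disjE) (simp_all add: field_simps power2_eq_square)
    hence "(of_real (y\<^sup>2) - 2 * e * of_real y) powr ?a = of_real (2 * y) powr ?a * ((- e) powr ?a * ?w powr ?a)"
      using y e0 w0 by (simp only: s[symmetric]) (subst powr_mult_of_real; simp)
    also have "of_real (2 * y) powr ?a = of_real ((2 * y) powr (r - 1))"
      using y by (intro powr_of_real) auto
    also have "2 * y = (2 / x) * (x * y)" using x by simp
    also have "((2 / x) * (x * y)) powr (r - 1) = (2 / x) powr (r - 1) * (x * y) powr (r - 1)"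
      by (rule powr_mult)
    also have "complex_of_real \<dots> = of_real ((2 / x) powr (r - 1)) * of_real (x * y) powr ?a"
      using x y by (simp add: powr_of_real[symmetric])
    finally show ?thesis using x
      by (simp add: hankel_integrand_def exp_of_real[symmetric] mult_ac)
  qed
  ultimately show ?thesis by (subst has_bochner_integral_cong) auto
qed

text \<open>Primitives of \<open>e\<^sup>i\<^sup>x\<^sup>z (1 - z\<^sup>2)\<^sup>r\<^sup>-\<^sup>1\<close> on the half-strip over \<open>[-1, 1]\<close> turn the Poisson integral into the
  difference of the integrals along its two vertical sides.\<close>

lemma Poisson_eq_hankel:
  fixes x r :: real
  assumes x: "x > 0" and r: "r > 1"
  shows "complex_of_real (2 * integral {0..1} (\<lambda>t. cos (x * t) * (1 - t\<^sup>2) powr (r - 1))) =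
    \<i> * of_real ((2 / x) powr (r - 1) / x * Gamma r) * (hankel_p (of_real r) x - hankel_m (of_real r) x)"
proof -
  define S where "S = {z. - 1 \<le> Re z \<and> Re z \<le> 1 \<and> 0 \<le> Im z}"
  define f where "f z = exp (\<i> * of_real x * z) * (1 - z\<^sup>2) powr of_real (r - 1)" for z
  have "S = {z. - 1 \<le> Re z} \<inter> {z. Re z \<le> 1} \<inter> {z. 0 \<le> Im z}" by (auto simp: S_def)
  hence convS: "convex S"
    by (simp add: convex_Int convex_halfspace_Re_ge convex_halfspace_Re_le convex_halfspace_Im_ge)
  have contf: "continuous_on S f" unfolding f_def
  proof (rule continuous_on_mult[OF _ continuous_powr_pos])
    fix z assume z: "z \<in> S" "1 - z\<^sup>2 \<in> \<real>\<^sub>\<le>\<^sub>0"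
    hence I: "Im z = 0" using one_minus_square_nonpos_iff[of z] by (force simp: S_def)
    have "(Re z)\<^sup>2 \<le> 1" using z(1) by (simp add: S_def abs_square_le_1 abs_le_iff)
    thus "1 - z\<^sup>2 = 0" using z(2) I by (auto simp: complex_nonpos_Reals_iff complex_eq_iff power2_eq_square)
  qed (use r in \<open>auto intro!: continuous_intros\<close>)
  have fd: "f field_differentiable at z" if "z \<in> interior S" for z
  proof -
    have "\<exists>d>0. ball z d \<subseteq> S" using that by (simp add: mem_interior)
    then obtain d where d: "d > 0" "ball z d \<subseteq> S" by blast
    have "z - \<i> * of_real (d / 2) \<in> ball z d" using d(1) by (simp add: dist_norm norm_mult)
    hence "z - \<i> * of_real (d / 2) \<in> S" using d(2) by blast
    hence "Im z > 0" using d(1) by (simp add: S_def)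
    moreover have "f holomorphic_on {z. Im z > 0}"
      unfolding f_def by (intro holomorphic_intros) (use one_minus_square_nonpos_iff in auto)
    ultimately show ?thesis
      using holomorphic_on_imp_differentiable_at[OF _ open_halfspace_Im_gt] by blast
  qed
  \<comment> \<open>Continuity up to the boundary and holomorphy inside suffice for a primitive on
    the closed half-strip, so Cauchy's theorem reduces to the fundamental theorem of calculus on
    each side.\<close>
  obtain g where g: "\<And>z. z \<in> S \<Longrightarrow> (g has_field_derivative f z) (at z within S)"
    by (rule holomorphic_convex_primitive[OF convS finite.emptyI contf]) (use fd in auto)
  have vert: "((\<lambda>T. g (of_real a + \<i> * of_real T)) \<longlongrightarrow> g (of_real a) + (LINT y|lhalf. \<i> * f (of_real a + \<i> * of_real y))) at_top"
    and fval: "(LINT y|lhalf. \<i> * f (of_real a + \<i> * of_real y)) = \<i> * of_real ((2 / x) powr (r - 1) / x * Gamma r) *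
         (exp (\<i> * of_real (a * x)) * (- \<i> * of_real a) powr of_real (r - 1) * hankel_int (of_real r) (\<i> * of_real a / of_real (2 * x)))"
    if a: "a = 1 \<or> a = -1" for a :: real
  proof -
    let ?F = "\<lambda>y. \<i> * f (of_real a + \<i> * of_real y)"
    let ?l = "\<lambda>y. complex_of_real a + \<i> * of_real y"
    have aa: "complex_of_real a * of_real a = 1" using a by auto
    have im: "?l ` {0..} \<subseteq> S" using a by (auto simp: S_def)
    have Feq: "?F y = \<i> * exp (\<i> * of_real (a * x)) * (of_real (exp (- x * y)) * (of_real (y\<^sup>2) - 2 * (\<i> * of_real a) * of_real y) powr of_real (r - 1))" for y
    proof -
      have 1: "1 - (?l y)\<^sup>2 = of_real (y\<^sup>2) - 2 * (\<i> * of_real a) * of_real y"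
        using aa by (simp add: power2_eq_square algebra_simps)
      have "\<i> * of_real x * ?l y = \<i> * of_real (a * x) + of_real (- x * y)"
        by (simp add: algebra_simps)
      hence 2: "exp (\<i> * of_real x * ?l y) = exp (\<i> * of_real (a * x)) * of_real (exp (- x * y))"
        by (simp only: exp_add exp_of_real)
      show ?thesis unfolding f_def 1 2 by (simp only: mult_ac)
    qed
    have hb: "has_bochner_integral lhalf ?F (\<i> * exp (\<i> * of_real (a * x)) *
       (of_real ((2 / x) powr (r - 1) / x * Gamma r) * ((- (\<i> * of_real a)) powr of_real (r - 1) * hankel_int (of_real r) (\<i> * of_real a / of_real (2 * x)))))"
      unfolding Feq by (intro has_bochner_integral_mult_right hankel_vertical x r) (use a in auto)
    show "((\<lambda>T. g (?l T)) \<longlongrightarrow> g (of_real a) + integral\<^sup>L lhalf ?F) at_top"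
    proof -
      have "((\<lambda>T. g (?l T)) \<longlongrightarrow> g (?l 0) + integral\<^sup>L lhalf ?F) at_top"
      proof (rule lhalf_FTC)
        fix y :: real assume y: "y \<ge> 0"
        have "(?l has_vector_derivative \<i>) (at y within {0..})"
          by (auto intro!: derivative_eq_intros)
        moreover have "(g has_field_derivative f (?l y)) (at (?l y) within ?l ` {0..})"
          using im y by (intro DERIV_subset[OF g]) auto
        ultimately show "((\<lambda>T. g (?l T)) has_vector_derivative ?F y) (at y within {0..})"
          using field_vector_diff_chain_within[of ?l \<i> y "{0..}" g "f (?l y)"] by (simp add: o_def)
      next
        show "continuous_on {0..} ?F"
          by (intro continuous_intros continuous_on_compose2[OF contf _ im])
      next
        show "integrable lhalf ?F" using hb by (simp add: has_bochner_integral_iff)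
      qed
      thus ?thesis by simp
    qed
    show "integral\<^sup>L lhalf ?F = \<i> * of_real ((2 / x) powr (r - 1) / x * Gamma r) *
         (exp (\<i> * of_real (a * x)) * (- \<i> * of_real a) powr of_real (r - 1) * hankel_int (of_real r) (\<i> * of_real a / of_real (2 * x)))"
      using hb by (simp add: has_bochner_integral_iff mult_ac)
  qed
  \<comment> \<open>The far horizontal side has length 2 and carries an exponentially small
    integrand. Hence \<open>g\<close> has the same limit up both vertical sides, which determines
    \<open>g 1 - g (-1)\<close>.\<close>
  have top: "((\<lambda>T. g (of_real 1 + \<i> * of_real T) - g (of_real (-1) + \<i> * of_real T)) \<longlongrightarrow> 0) at_top"
  proof (rule Lim_null_comparison)
    show "((\<lambda>T. 2 * (exp (- x * T) * (2 + T\<^sup>2) powr (r - 1))) \<longlongrightarrow> 0) at_top"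
      using x r by real_asymp
    show "\<forall>\<^sub>F T in at_top. norm (g (of_real 1 + \<i> * of_real T) - g (of_real (-1) + \<i> * of_real T)) \<le>
        2 * (exp (- x * T) * (2 + T\<^sup>2) powr (r - 1))"
      using eventually_ge_at_top[of 0]
    proof eventually_elim
      case (elim T)
      let ?K = "{z. - 1 \<le> Re z \<and> Re z \<le> 1 \<and> Im z = T}"
      have K: "?K = {z. - 1 \<le> Re z} \<inter> {z. Re z \<le> 1} \<inter> ({z. Im z \<ge> T} \<inter> {z. Im z \<le> T})" by auto
      have "convex ?K" unfolding K
        by (intro convex_Int convex_halfspace_Re_ge convex_halfspace_Re_le
            convex_halfspace_Im_ge convex_halfspace_Im_le)
      moreover have "norm (f z) \<le> exp (- x * T) * (2 + T\<^sup>2) powr (r - 1)" if z: "z \<in> ?K" for z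
      proof -
        have "(norm z)\<^sup>2 \<le> 1 + T\<^sup>2" using z abs_square_le_1[of "Re z"] by (simp add: cmod_power2 abs_le_iff)
        hence "norm (1 - z\<^sup>2) \<le> 2 + T\<^sup>2" using norm_triangle_ineq4[of 1 "z\<^sup>2"] by (simp add: norm_power)
        hence "norm (1 - z\<^sup>2) powr (r - 1) \<le> (2 + T\<^sup>2) powr (r - 1)" using r by (intro powr_mono2) auto
        thus ?thesis using z by (simp add: f_def norm_mult norm_powr_real_powr')
      qed
      moreover have "?K \<subseteq> S" using elim by (auto simp: S_def)
      ultimately have "norm (g (of_real 1 + \<i> * of_real T) - g (of_real (-1) + \<i> * of_real T)) \<le>
        exp (- x * T) * (2 + T\<^sup>2) powr (r - 1) * norm ((of_real 1 + \<i> * of_real T) - (of_real (-1) + \<i> * of_real T))"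
        by (intro field_differentiable_bound[of ?K g f]) (auto intro!: DERIV_subset[OF g])
      thus ?case by simp
    qed
  qed
  have "((\<lambda>T. g (of_real 1 + \<i> * of_real T) - g (of_real (-1) + \<i> * of_real T)) \<longlongrightarrow>
     (g (of_real 1) + (LINT y|lhalf. \<i> * f (of_real 1 + \<i> * of_real y))) -
     (g (of_real (-1)) + (LINT y|lhalf. \<i> * f (of_real (-1) + \<i> * of_real y)))) at_top"
    by (intro tendsto_diff vert) auto
  from tendsto_unique[OF _ this top]
  have "g 1 - g (-1) = (LINT y|lhalf. \<i> * f (of_real (-1) + \<i> * of_real y)) - (LINT y|lhalf. \<i> * f (of_real 1 + \<i> * of_real y))"
    by (simp add: algebra_simps)
  also have "\<dots> = \<i> * of_real ((2 / x) powr (r - 1) / x * Gamma r) * (hankel_p (of_real r) x - hankel_m (of_real r) x)"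
  proof -
    let ?K = "\<i> * complex_of_real ((2 / x) powr (r - 1) / x * Gamma r)"
    have 1: "(LINT y|lhalf. \<i> * f (of_real (-1) + \<i> * of_real y)) = ?K * hankel_p (of_real r) x"
      by (subst fval[of "-1"]) (simp_all add: hankel_p_def mult_ac)
    have 2: "(LINT y|lhalf. \<i> * f (of_real 1 + \<i> * of_real y)) = ?K * hankel_m (of_real r) x"
      by (subst fval[of 1]) (simp_all add: hankel_m_def mult_ac)
    show ?thesis unfolding 1 2 by (rule right_diff_distrib[symmetric])
  qed
  also have "g 1 - g (-1) = complex_of_real (2 * integral {0..1} (\<lambda>t. cos (x * t) * (1 - t\<^sup>2) powr (r - 1)))"
  proof -
    let ?h = "\<lambda>t. cos (x * t) * (1 - t\<^sup>2) powr (r - 1)"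
    \<comment> \<open>The base \<open>[-1, 1]\<close> is folded onto \<open>[0, 1]\<close>, which
      combines the exponentials into a cosine.\<close>
    have "((\<lambda>t. f (of_real t) + f (- of_real t)) has_integral ((g (of_real 1) - g (- of_real 1)) - (g (of_real 0) - g (- of_real 0)))) {0..1}"
    proof (rule fundamental_theorem_of_calculus)
      fix t :: real assume t: "t \<in> {0..1}"
      have 1: "((\<lambda>t. g (of_real t)) has_vector_derivative 1 * f (of_real t)) (at t within {0..1})"
        unfolding o_def[symmetric, of g of_real]
        by (rule field_vector_diff_chain_within)
          (use t in \<open>auto intro!: derivative_eq_intros DERIV_subset[OF g] simp: S_def\<close>)
      have 2: "((\<lambda>t. g (- of_real t)) has_vector_derivative (-1) * f (- of_real t)) (at t within {0..1})"
        unfolding o_def[symmetric, of g "\<lambda>t. - of_real t"]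
        by (rule field_vector_diff_chain_within)
          (use t in \<open>auto intro!: derivative_eq_intros DERIV_subset[OF g] simp: S_def\<close>)
      show "((\<lambda>t. g (of_real t) - g (- of_real t)) has_vector_derivative f (of_real t) + f (- of_real t)) (at t within {0..1})"
        using has_vector_derivative_diff[OF 1 2] by simp
    qed auto
    moreover have "f (of_real t) + f (- of_real t) = of_real (2 * ?h t)" if t: "t \<in> {0..1}" for t
    proof -
      have "(1 - (complex_of_real t)\<^sup>2) powr of_real (r - 1) = of_real (1 - t\<^sup>2) powr of_real (r - 1)" by simp
      also have "\<dots> = of_real ((1 - t\<^sup>2) powr (r - 1))"
        using t by (intro powr_of_real) (auto simp: abs_square_le_1)
      finally have A: "(1 - (complex_of_real t)\<^sup>2) powr of_real (r - 1) = \<dots>" .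
      have B: "exp (\<i> * of_real x * of_real t) + exp (\<i> * of_real x * - of_real t) = of_real (2 * cos (x * t))"
        by (simp add: cos_exp_eq cos_of_real[symmetric] mult.assoc)
      have "f (of_real t) + f (- of_real t) = (exp (\<i> * of_real x * of_real t) + exp (\<i> * of_real x * - of_real t)) * of_real ((1 - t\<^sup>2) powr (r - 1))"
        unfolding f_def power2_minus A by (simp only: ring_distribs)
      thus ?thesis unfolding B by simp
    qed
    ultimately have "((\<lambda>t. complex_of_real (2 * ?h t)) has_integral (g 1 - g (- 1))) {0..1}"
      by (subst has_integral_cong[symmetric]) auto
    moreover have "((\<lambda>t. complex_of_real (2 * ?h t)) has_integral of_real (integral {0..1} (\<lambda>t. 2 * ?h t))) {0..1}"
    proof (rule has_integral_of_real[OF integrable_integral])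
      show "(\<lambda>t. 2 * ?h t) integrable_on {0..1}"
        using r by (intro integrable_continuous_real continuous_intros continuous_on_powr') (auto simp: abs_square_le_1)
    qed
    ultimately show ?thesis using has_integral_unique by simp
  qed
  finally show ?thesis .
qed

section \<open>Continuation in the order and the Bessel function of the second kind\<close>

lemma rGamma_shift_bounded:
  "\<exists>M. \<forall>z k. norm (z :: complex) \<le> R \<longrightarrow> norm (rGamma (z + of_nat k + 1)) \<le> M"
proof -
  define N where "N = nat \<lceil>R\<rceil> + 1"
  have "bounded (rGamma ` cball (0::complex) (R + real N + 1))"
    by (intro compact_imp_bounded compact_continuous_image continuous_intros) auto
  then obtain M where "\<forall>w\<in>rGamma ` cball (0::complex) (R + real N + 1). norm w \<le> M"
    unfolding bounded_iff by blast
  hence M: "norm (rGamma z) \<le> M" if "norm z \<le> R + real N + 1" for z :: complex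
    using that by simp
  have "norm (rGamma (z + of_nat k + 1)) \<le> M" if z: "norm z \<le> R" for z :: complex and k
  proof (induction k)
    case 0
    have "norm (z + 1) \<le> norm z + 1" using norm_triangle_ineq[of z 1] by simp
    thus ?case using z by (intro M) auto
  next
    case (Suc k)
    show ?case
    proof (cases "Suc k \<le> N")
      case True
      have "norm (z + of_nat (Suc k) + 1) \<le> norm z + norm (of_nat (Suc k) :: complex) + 1"
        using norm_triangle_ineq[of "z + of_nat (Suc k)" 1] norm_triangle_ineq[of z "of_nat (Suc k)"]
        by (simp only: norm_one)
      also have "\<dots> \<le> R + real N + 1" unfolding norm_of_nat using z True by linarith
      finally show ?thesis by (rule M)
    next
      case False
      let ?w = "z + of_nat k + 1"
      have "real N \<ge> R + 1" unfolding N_def by linarith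
      hence "real k + 1 \<ge> R + 1" using False by linarith
      moreover have "norm (of_nat k + 1 :: complex) \<le> norm ?w + norm z"
        using norm_triangle_ineq4[of ?w z] by simp
      moreover have "norm (of_nat k + 1 :: complex) = real k + 1"
        by (metis norm_of_nat of_nat_Suc add.commute)
      ultimately have "norm ?w \<ge> 1" using z by linarith
      \<comment> \<open>Since \<open>rGamma w = w * rGamma (w + 1)\<close>, a shift by 1 cannot
        increase the norm once \<open>norm w \<ge> 1\<close>. The finitely many earlier shifts stay
        in one compact disc.\<close>
      have "norm (rGamma ?w) = norm ?w * norm (rGamma (?w + 1))"
        by (simp flip: rGamma_plus1[of ?w] norm_mult)
      with \<open>norm ?w \<ge> 1\<close> have "norm (rGamma (?w + 1)) \<le> norm (rGamma ?w)"
        using mult_right_mono[of 1 "norm ?w" "norm (rGamma (?w + 1))"] by simp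
      also note Suc
      finally show ?thesis by (simp add: algebra_simps)
    qed
  qed
  thus ?thesis by blast
qed

text \<open>On a unit disc of orders the \<open>k\<close>-th term is dominated by a constant times
  \<open>(x / 2) ^ (2 * k) / fact k\<close>. Holomorphy in the order is what lets identities proved
  for special orders be continued.\<close>

lemma holomorphic_Bessel_J:
  assumes x: "x > 0"
  shows "(\<lambda>\<nu>. Bessel_J \<nu> (of_real x)) holomorphic_on UNIV"
  unfolding Bessel_J_def
proof (rule holomorphic_uniform_sequence)
  let ?u = "\<lambda>k \<nu>. (- 1) ^ k / fact k * rGamma (\<nu> + of_nat k + 1) * (complex_of_real x / 2) powr (\<nu> + 2 * of_nat k)"
  show "(\<lambda>\<nu>. \<Sum>k<n. ?u k \<nu>) holomorphic_on UNIV" for n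
    using x by (auto intro!: holomorphic_intros)
  fix \<nu>0 :: complex
  define R where "R = norm \<nu>0 + 1"
  obtain M where M: "\<And>z k. norm z \<le> R \<Longrightarrow> norm (rGamma (z + of_nat k + 1 :: complex)) \<le> M"
    using rGamma_shift_bounded[of R] by blast
  define y where "y = x / 2"
  have y: "y > 0" using x by (simp add: y_def)
  have "uniform_limit (cball \<nu>0 1) (\<lambda>n \<nu>. \<Sum>k<n. ?u k \<nu>) (\<lambda>\<nu>. \<Sum>k. ?u k \<nu>) sequentially"
  proof (rule Weierstrass_m_test)
    fix k \<nu> assume "\<nu> \<in> cball \<nu>0 1"
    hence \<nu>: "norm \<nu> \<le> R" using norm_triangle_ineq2[of \<nu> \<nu>0] by (simp add: dist_norm R_def norm_minus_commute)
    have "norm ((complex_of_real x / 2) powr (\<nu> + 2 * of_nat k)) = y powr (Re \<nu> + 2 * real k)"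
      using norm_powr_of_real[OF y, of "\<nu> + 2 * of_nat k"] by (simp add: y_def)
    also have "\<dots> = y powr Re \<nu> * (y\<^sup>2) ^ k"
      using powr_realpow[OF y, of "2 * k"] by (simp add: powr_add power_mult)
    also have "y powr Re \<nu> \<le> y powr (- R) + y powr R"
      using \<nu> abs_Re_le_cmod[of \<nu>] y by (intro powr_real_le_sum) auto
    finally have 1: "norm ((complex_of_real x / 2) powr (\<nu> + 2 * of_nat k)) \<le> (y powr (- R) + y powr R) * (y\<^sup>2) ^ k"
      by (simp add: mult_right_mono)
    have "norm (?u k \<nu>) = 1 / fact k * norm (rGamma (\<nu> + of_nat k + 1)) * norm ((complex_of_real x / 2) powr (\<nu> + 2 * of_nat k))"
      by (simp add: norm_mult norm_divide norm_power)
    also have "\<dots> \<le> 1 / fact k * M * ((y powr (- R) + y powr R) * (y\<^sup>2) ^ k)"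
      using M[OF \<nu>, of k] 1 order_trans[OF norm_ge_zero M[OF \<nu>, of k]] by (intro mult_mono) auto
    finally show "norm (?u k \<nu>) \<le> M * (y powr (- R) + y powr R) * (inverse (fact k) * (y\<^sup>2) ^ k)"
      by (simp add: field_simps)
  next
    show "summable (\<lambda>k. M * (y powr (- R) + y powr R) * (inverse (fact k) * (y\<^sup>2) ^ k))"
      by (intro summable_mult summable_exp)
  qed
  thus "\<exists>d>0. cball \<nu>0 d \<subseteq> UNIV \<and> uniform_limit (cball \<nu>0 d) (\<lambda>n \<nu>. \<Sum>k<n. ?u k \<nu>) (\<lambda>\<nu>. \<Sum>k. ?u k \<nu>) sequentially"
    by (intro exI[of _ 1]) auto
qed auto

lemma holomorphic_hankel_pm:
  assumes x: "x > 0"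
  shows "(\<lambda>\<nu>. hankel_p (\<nu> + 1/2) x) holomorphic_on {\<nu>. Re \<nu> > - 1/2}"
    and "(\<lambda>\<nu>. hankel_m (\<nu> + 1/2) x) holomorphic_on {\<nu>. Re \<nu> > - 1/2}"
proof -
  have "(\<lambda>\<nu>. hankel_int (\<nu> + 1/2) c) holomorphic_on {\<nu>. Re \<nu> > - 1/2}" if "Re c = 0" for c
    by (rule holomorphic_on_compose_gen[of "\<lambda>\<nu>. \<nu> + 1/2" "{\<nu>. Re \<nu> > - 1/2}" _ "{s. Re s > 0}",
          unfolded o_def, OF _ holomorphic_hankel_int[OF that]]) (auto intro!: holomorphic_intros)
  thus "(\<lambda>\<nu>. hankel_p (\<nu> + 1/2) x) holomorphic_on {\<nu>. Re \<nu> > - 1/2}"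
    and "(\<lambda>\<nu>. hankel_m (\<nu> + 1/2) x) holomorphic_on {\<nu>. Re \<nu> > - 1/2}"
    unfolding hankel_p_def hankel_m_def by (auto intro!: holomorphic_intros)
qed

definition hankel_const :: "real \<Rightarrow> complex" where
  "hankel_const x = of_real (1 / sqrt (2 * pi * x))"

text \<open>Poisson's integral and the half-strip give this for real orders above 1/2; both sides
  continue to the half-plane where Hankel's integral with parameter \<open>\<nu> + 1/2\<close>
  converges.\<close>

lemma Bessel_J_eq_hankel:
  assumes x: "x > 0" and \<nu>: "Re \<nu> > - 1/2"
  shows "Bessel_J \<nu> (of_real x) = hankel_const x * \<i> * (hankel_p (\<nu> + 1/2) x - hankel_m (\<nu> + 1/2) x)"
proof -
  let ?S = "{\<nu>. Re \<nu> > - 1/2}"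
  let ?U = "complex_of_real ` {1/2<..}"
  let ?f = "\<lambda>\<nu>. Bessel_J \<nu> (of_real x) - hankel_const x * \<i> * (hankel_p (\<nu> + 1/2) x - hankel_m (\<nu> + 1/2) x)"
  have lim: "1 islimpt ?U"
    unfolding islimpt_approachable
  proof (intro allI impI)
    fix e :: real assume "e > 0"
    thus "\<exists>x'\<in>?U. x' \<noteq> 1 \<and> dist x' 1 < e"
      by (intro bexI[of _ "of_real (1 + e/2)"] imageI) (auto simp: dist_norm)
  qed
  have zero: "?f z = 0" if "z \<in> ?U" for z
  proof -
    obtain y where y: "y > 1/2" "z = complex_of_real y" using \<open>z \<in> ?U\<close> by blast
    define r where "r = y + 1/2"
    have r: "r > 1" and z: "z = of_real (r - 1/2)" using y by (auto simp: r_def)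
    have zr: "z + 1/2 = of_real r" by (simp add: z)
    have Gr: "Gamma r > 0" using r by (intro Gamma_real_pos) auto
    \<comment> \<open>The powers of \<open>x / 2\<close> and \<open>2 / x\<close> cancel up to a
      square root; what remains is the constant in \<open>hankel_const\<close>.\<close>
    have sc: "(x / 2) powr (r - 1/2) / (sqrt pi * Gamma r) * ((2 / x) powr (r - 1) / x * Gamma r) = 1 / sqrt (2 * pi * x)"
    proof -
      have "(x / 2) powr (r - 1/2) = (x / 2) powr (r - 1) * (x / 2) powr (1/2)"
        by (simp flip: powr_add)
      also have "(x / 2) powr (1/2) = sqrt (x / 2)" using x by (intro powr_half_sqrt) auto
      finally have 1: "(x / 2) powr (r - 1/2) = (x / 2) powr (r - 1) * sqrt (x / 2)" .
      have 2: "(x / 2) powr (r - 1) * (2 / x) powr (r - 1) = 1"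
        using x by (simp flip: powr_mult)
      have "(x / 2) powr (r - 1/2) / (sqrt pi * Gamma r) * ((2 / x) powr (r - 1) / x * Gamma r) =
         ((x / 2) powr (r - 1) * (2 / x) powr (r - 1)) * (sqrt (x / 2) / (sqrt pi * x))"
        unfolding 1 using Gr by (simp add: field_simps)
      also have "\<dots> = sqrt (x / 2) / (sqrt pi * x)" by (simp add: 2)
      also have "\<dots> = 1 / sqrt (2 * pi * x)"
      proof -
        have "sqrt (x / 2) * sqrt (2 * pi * x) = sqrt (pi * x\<^sup>2)"
          by (simp add: power2_eq_square flip: real_sqrt_mult)
        also have "\<dots> = sqrt pi * x" using x by (simp add: real_sqrt_mult)
        finally show ?thesis using x by (simp add: field_simps)
      qed
      finally show ?thesis .
    qed
    have "Bessel_J z (of_real x) = of_real ((x / 2) powr (r - 1/2) / (sqrt pi * Gamma r)) *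
       complex_of_real (2 * integral {0..1} (\<lambda>t. cos (x * t) * (1 - t\<^sup>2) powr (r - 1)))"
      unfolding z Bessel_J_Poisson[OF r x] by (rule of_real_mult)
    also have "\<dots> = of_real ((x / 2) powr (r - 1/2) / (sqrt pi * Gamma r)) *
       (\<i> * of_real ((2 / x) powr (r - 1) / x * Gamma r) * (hankel_p (of_real r) x - hankel_m (of_real r) x))"
      unfolding Poisson_eq_hankel[OF x r] ..
    also have "\<dots> = of_real ((x / 2) powr (r - 1/2) / (sqrt pi * Gamma r) * ((2 / x) powr (r - 1) / x * Gamma r)) *
       \<i> * (hankel_p (of_real r) x - hankel_m (of_real r) x)"
      by (simp only: of_real_mult mult_ac)
    finally show ?thesis unfolding sc zr hankel_const_def by simp
  qed
  have "?f \<nu> = 0"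
  proof (rule analytic_continuation[where f = ?f and S = ?S and U = ?U and \<xi> = 1])
    show "?f holomorphic_on ?S"
      by (intro holomorphic_intros holomorphic_hankel_pm x
          holomorphic_on_subset[OF holomorphic_Bessel_J[OF x]]) auto
    show "open ?S" "connected ?S"
      by (auto simp: open_halfspace_Re_gt convex_halfspace_Re_gt convex_connected)
  qed (use \<nu> lim zero in auto)
  thus ?thesis by simp
qed

text \<open>By \<open>hankel_int_reflect\<close> the integral is unchanged under \<nu> to -\<nu>.
  Only the powers of \<i> and -\<i> change, and as their logarithms are \<plusminus>\<i> pi/2 the
  change is the factor \<open>exp (\<i> * of_real pi * \<nu>)\<close>.\<close>

lemma hankel_reflect:
  assumes x: "x > 0" and \<nu>: "\<bar>Re \<nu>\<bar> < 1/2"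
  defines "A \<equiv> exp (\<i> * of_real pi * \<nu> / 2)"
  shows "hankel_p (- \<nu> + 1/2) x * A\<^sup>2 = hankel_p (\<nu> + 1/2) x"
    and "hankel_m (\<nu> + 1/2) x * A\<^sup>2 = hankel_m (- \<nu> + 1/2) x"
proof -
  have E: "hankel_int (- \<nu> + 1/2) c = hankel_int (\<nu> + 1/2) c" if "Re c = 0" for c
  proof -
    have "- 1/2 < Re \<nu>" "Re \<nu> < 1/2" using \<nu> by linarith+
    hence "hankel_int (1 - (\<nu> + 1/2)) c = hankel_int (\<nu> + 1/2) c"
      by (intro hankel_int_reflect that) simp_all
    moreover have "1 - (\<nu> + 1/2) = - \<nu> + 1/2" by (simp add: field_simps)
    ultimately show ?thesis by (simp only:)
  qed
  have A2: "A\<^sup>2 = exp (\<i> * of_real pi * \<nu>)"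
    unfolding A_def exp_double[symmetric] by simp
  have P: "u powr a * exp w = exp (a * Ln u + w)" if "u \<noteq> 0" for a u w :: complex
    using that by (simp add: powr_def exp_add)
  have i0: "\<i> \<noteq> 0" "- \<i> \<noteq> 0" by simp_all
  have e1: "(- \<nu> + 1/2 - 1) * Ln \<i> + \<i> * of_real pi * \<nu> = (\<nu> + 1/2 - 1) * Ln \<i>"
    by (simp add: field_simps)
  have 1: "\<i> powr (- \<nu> + 1/2 - 1) * A\<^sup>2 = \<i> powr (\<nu> + 1/2 - 1)"
    unfolding A2 P[OF i0(1)] e1 by (simp add: powr_def)
  have e2: "(\<nu> + 1/2 - 1) * Ln (- \<i>) + \<i> * of_real pi * \<nu> = (- \<nu> + 1/2 - 1) * Ln (- \<i>)"
    by (simp add: field_simps)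
  have 2: "(- \<i>) powr (\<nu> + 1/2 - 1) * A\<^sup>2 = (- \<i>) powr (- \<nu> + 1/2 - 1)"
    unfolding A2 P[OF i0(2)] e2 by (simp add: powr_def)
  have c: "Re (- \<i> / of_real (2 * x)) = 0" "Re (\<i> / of_real (2 * x)) = 0" by simp_all
  show "hankel_p (- \<nu> + 1/2) x * A\<^sup>2 = hankel_p (\<nu> + 1/2) x"
    unfolding hankel_p_def E[OF c(1)] 1[symmetric] by (simp only: mult_ac)
  show "hankel_m (\<nu> + 1/2) x * A\<^sup>2 = hankel_m (- \<nu> + 1/2) x"
    unfolding hankel_m_def E[OF c(2)] 2[symmetric] by (simp only: mult_ac)
qed

lemma Bessel_connection_algebra:
  fixes B c p m :: complex
  assumes "B \<noteq> 0"
  shows "c * \<i> * (p - m) * ((B + inverse B) / 2) - c * \<i> * (p / B - m * B) =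
    (B - inverse B) / (2 * \<i>) * (- (c * (p + m)))"
  using assms by (simp add: field_simps)

text \<open>For \<open>\<bar>Re \<nu>\<bar> < 1/2\<close> both orders \<nu> and -\<nu> have their
  Hankel form, and \<open>hankel_reflect\<close> eliminates the order -\<nu>. With the sine kept as
  a factor instead of a denominator, the identity continues across integer orders.\<close>

lemma Bessel_J_connection:
  assumes x: "x > 0" and \<nu>: "Re \<nu> > - 1/2"
  shows "Bessel_J \<nu> (of_real x) * cos (\<nu> * of_real pi) - Bessel_J (- \<nu>) (of_real x) =
    sin (\<nu> * of_real pi) * (- (hankel_const x * (hankel_p (\<nu> + 1/2) x + hankel_m (\<nu> + 1/2) x)))"
proof -
  let ?S = "{\<nu>. Re \<nu> > - 1/2}"
  let ?U = "{\<nu>. Re \<nu> > - 1/2} \<inter> {\<nu>. Re \<nu> < 1/2}"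
  let ?f = "\<lambda>\<nu>. Bessel_J \<nu> (of_real x) * cos (\<nu> * of_real pi) - Bessel_J (- \<nu>) (of_real x)"
  let ?g = "\<lambda>\<nu>. sin (\<nu> * of_real pi) * (- (hankel_const x * (hankel_p (\<nu> + 1/2) x + hankel_m (\<nu> + 1/2) x)))"
  have "?f \<nu> = ?g \<nu>" 
  proof (rule analytic_continuation_open[where f = ?f and g = ?g and s = ?U and s' = ?S])
    have "(\<lambda>\<nu>. Bessel_J (- \<nu>) (of_real x)) holomorphic_on ?S"
      by (rule holomorphic_on_compose_gen[of "\<lambda>\<nu>. - \<nu>" ?S "\<lambda>\<nu>. Bessel_J \<nu> (of_real x)" UNIV, unfolded o_def])
        (auto intro!: holomorphic_intros holomorphic_Bessel_J x)
    thus "?f holomorphic_on ?S"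
      by (intro holomorphic_intros holomorphic_on_subset[OF holomorphic_Bessel_J[OF x]]) auto
    show "?g holomorphic_on ?S"
      by (intro holomorphic_intros holomorphic_hankel_pm x)
    show "open ?U" by (intro open_Int open_halfspace_Re_gt open_halfspace_Re_lt)
    show "open ?S" "connected ?S"
      by (auto simp: open_halfspace_Re_gt open_halfspace_Re_lt convex_halfspace_Re_gt convex_connected)
    have "0 \<in> ?U" by simp
    thus "?U \<noteq> {}" by blast
    fix \<nu> assume u: "\<nu> \<in> ?U"
    define A where "A = exp (\<i> * of_real pi * \<nu> / 2)"
    have A0: "A \<noteq> 0" by (simp add: A_def)
    have A2: "A\<^sup>2 = exp (\<i> * of_real pi * \<nu>)"
      unfolding A_def exp_double[symmetric] by simp
    have cs: "cos (\<nu> * of_real pi) = (A\<^sup>2 + inverse (A\<^sup>2)) / 2" "sin (\<nu> * of_real pi) = (A\<^sup>2 - inverse (A\<^sup>2)) / (2 * \<i>)"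
      unfolding A2 by (simp_all add: cos_exp_eq sin_exp_eq exp_minus mult_ac)
    have "\<bar>Re \<nu>\<bar> < 1/2" using u by auto
    from hankel_reflect[OF x this, folded A_def]
    have r1: "hankel_p (- \<nu> + 1/2) x = hankel_p (\<nu> + 1/2) x / A\<^sup>2"
      and r2: "hankel_m (- \<nu> + 1/2) x = hankel_m (\<nu> + 1/2) x * A\<^sup>2"
      using A0 by (simp_all only: eq_divide_eq power_eq_0_iff) auto
    have J1: "Bessel_J \<nu> (of_real x) = hankel_const x * \<i> * (hankel_p (\<nu> + 1/2) x - hankel_m (\<nu> + 1/2) x)"
      using u by (intro Bessel_J_eq_hankel x) auto
    have J2: "Bessel_J (- \<nu>) (of_real x) = hankel_const x * \<i> * (hankel_p (\<nu> + 1/2) x / A\<^sup>2 - hankel_m (\<nu> + 1/2) x * A\<^sup>2)"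
      unfolding r1[symmetric] r2[symmetric] using u by (intro Bessel_J_eq_hankel x) auto
    show "?f \<nu> = ?g \<nu>" unfolding J1 J2 cs
      by (rule Bessel_connection_algebra) (use A0 in simp)
  qed (use \<nu> in auto)
  thus ?thesis .
qed

text \<open>The right side is holomorphic in the order and equals the quotient at non-integral
  orders, hence also the limit that defines \<open>Bessel_Y\<close> at integers.\<close>

theorem Bessel_Y_eq_hankel:
  assumes x: "x > 0" and \<nu>: "Re \<nu> > - 1/2"
  shows "Bessel_Y \<nu> (of_real x) = - (hankel_const x * (hankel_p (\<nu> + 1/2) x + hankel_m (\<nu> + 1/2) x))"
proof -
  let ?S = "{\<nu>. Re \<nu> > - 1/2}"
  let ?H = "\<lambda>\<nu>. - (hankel_const x * (hankel_p (\<nu> + 1/2) x + hankel_m (\<nu> + 1/2) x))"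
  have q: "Bessel_Y_quotient \<mu> (of_real x) = ?H \<mu>" if "Re \<mu> > - 1/2" "\<mu> \<notin> \<int>" for \<mu>
  proof -
    have "sin (\<mu> * of_real pi) \<noteq> 0"
      using that(2) by (auto simp: sin_eq_0)
    thus ?thesis unfolding Bessel_Y_quotient_def Bessel_J_connection[OF x that(1)] by simp
  qed
  show ?thesis
  proof (cases "\<nu> \<in> \<int>")
    case False
    thus ?thesis using q \<nu> by (simp add: Bessel_Y_def)
  next
    case True
    have "?H holomorphic_on ?S" by (intro holomorphic_intros holomorphic_hankel_pm x)
    hence "isCont ?H \<nu>"
      using \<nu> by (intro continuous_on_interior[OF holomorphic_on_imp_continuous_on])
        (auto simp: interior_open open_halfspace_Re_gt)
    hence "(?H \<longlongrightarrow> ?H \<nu>) (at \<nu>)" by (simp add: isCont_def)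
    moreover have "\<forall>\<^sub>F \<mu> in at \<nu>. ?H \<mu> = Bessel_Y_quotient \<mu> (of_real x)"
    proof -
      have "\<forall>\<^sub>F \<mu> in at \<nu>. \<mu> \<in> ?S \<inter> ball \<nu> 1 - {\<nu>}"
        using \<nu> by (intro eventually_at_in_open) (auto simp: open_halfspace_Re_gt)
      thus ?thesis
      proof eventually_elim
        case (elim \<mu>)
        have "\<mu> \<notin> \<int>"
        proof
          assume "\<mu> \<in> \<int>"
          then obtain m n where mn: "\<nu> = of_int m" "\<mu> = of_int n" using True by (auto elim!: Ints_cases)
          hence "norm (of_int (m - n) :: complex) < 1" using elim by (simp add: dist_norm)
          hence "\<bar>m - n\<bar> < 1" by (simp only: norm_of_int)
          thus False using mn elim by auto
        qed
        thus ?case using q elim by simp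
      qed
    qed
    ultimately have "((\<lambda>\<mu>. Bessel_Y_quotient \<mu> (of_real x)) \<longlongrightarrow> ?H \<nu>) (at \<nu>)"
      by (rule Lim_transform_eventually)
    thus ?thesis using True by (simp add: Bessel_Y_def tendsto_Lim)
  qed
qed

section \<open>Continuation of the zeta function\<close>

lemma norm_Suc_powr: "norm (complex_of_nat (Suc n) powr z) = real (Suc n) powr Re z"
  using norm_powr_of_real[of "real (Suc n)" z] by simp

lemma summable_Suc_powr: "a < -1 \<Longrightarrow> summable (\<lambda>n. real (Suc n) powr a)"
  using summable_real_powr_iff[of a] by (subst summable_Suc_iff) auto

lemma summable_norm_Suc_powr: "Re z > 1 \<Longrightarrow> summable (\<lambda>n. norm (complex_of_nat (Suc n) powr (- z)))"
  unfolding norm_Suc_powr by (rule summable_Suc_powr) simp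

lemma holomorphic_series:
  fixes f :: "nat \<Rightarrow> complex \<Rightarrow> complex"
  assumes "open S" "\<And>n. f n holomorphic_on S"
    and "\<And>z. z \<in> S \<Longrightarrow> \<exists>r>0. \<exists>M. cball z r \<subseteq> S \<and> summable M \<and> (\<forall>n. \<forall>w\<in>cball z r. norm (f n w) \<le> M n)"
  shows "(\<lambda>z. \<Sum>n. f n z) holomorphic_on S"
proof (rule holomorphic_uniform_sequence[OF assms(1), where f = "\<lambda>N z. \<Sum>n<N. f n z"])
  fix z assume "z \<in> S"
  from assms(3)[OF this] obtain r M where *: "r > 0" "cball z r \<subseteq> S" "summable M"
      "\<forall>n. \<forall>w\<in>cball z r. norm (f n w) \<le> M n"
    by (elim exE conjE)
  hence "uniform_limit (cball z r) (\<lambda>N z. \<Sum>n<N. f n z) (\<lambda>z. \<Sum>n. f n z) sequentially"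
    by (intro Weierstrass_m_test) auto
  with * show "\<exists>d>0. cball z d \<subseteq> S \<and> uniform_limit (cball z d) (\<lambda>N z. \<Sum>n<N. f n z) (\<lambda>z. \<Sum>n. f n z) sequentially"
    by (intro exI[of _ r] conjI)
qed (use assms(2) in \<open>auto intro!: holomorphic_intros\<close>)

lemma cball_Re_ge: "w \<in> cball z r \<Longrightarrow> Re w \<ge> Re z - r"
  using abs_Re_le_cmod[of "z - w"] by (simp add: dist_norm)

definition dirichlet_zeta :: "complex \<Rightarrow> complex" where
  "dirichlet_zeta z = (\<Sum>n. of_nat (Suc n) powr (- z))"

lemma holomorphic_dirichlet_zeta: "dirichlet_zeta holomorphic_on {z. Re z > 1}"
  unfolding dirichlet_zeta_def
proof (rule holomorphic_series)
  fix z assume z: "z \<in> {z. Re z > 1}"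
  define r where "r = (Re z - 1) / 2"
  have r: "r > 0" using z by (simp add: r_def)
  have *: "Re w \<ge> 1 + r" if "w \<in> cball z r" for w
  proof -
    have "Re z - r = 1 + r" unfolding r_def by (simp add: field_simps)
    thus ?thesis using cball_Re_ge[OF that] by simp
  qed
  show "\<exists>r>0. \<exists>M. cball z r \<subseteq> {z. Re z > 1} \<and> summable M \<and>
     (\<forall>n. \<forall>w\<in>cball z r. norm (of_nat (Suc n) powr - w) \<le> M n)"
  proof (intro exI conjI allI ballI)
    show "cball z r \<subseteq> {z. Re z > 1}" using * r by force
    show "summable (\<lambda>n. real (Suc n) powr (- (1 + r)))" using r by (intro summable_Suc_powr) simp
    fix n w assume "w \<in> cball z r"
    thus "norm (of_nat (Suc n) powr - w) \<le> real (Suc n) powr (- (1 + r))"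
      unfolding norm_Suc_powr using *[of w] by (intro powr_mono) auto
  qed fact
qed (auto simp: open_halfspace_Re_gt intro!: holomorphic_intros)

definition falling_coeff :: "complex \<Rightarrow> nat \<Rightarrow> complex" where
  "falling_coeff s i = (\<Prod>l<i. 1 - s - of_nat l)"

text \<open>As \<open>falling_coeff s i / fact i\<close> is the binomial coefficient of
  \<open>1 - s\<close> over \<open>i\<close>, this is the Taylor remainder of order \<open>K\<close>
  of \<open>x powr (1 - s)\<close> for the step from \<open>n + 1\<close> to
  \<open>n + 2\<close>.\<close>

definition taylor_rest :: "nat \<Rightarrow> nat \<Rightarrow> complex \<Rightarrow> complex" where
  "taylor_rest K n s = of_nat (Suc (Suc n)) powr (1 - s) -
     (\<Sum>i\<le>K. falling_coeff s i / fact i * of_nat (Suc n) powr (1 - s - of_nat i))"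

lemma holomorphic_falling_coeff [holomorphic_intros]:
  "f holomorphic_on A \<Longrightarrow> (\<lambda>s. falling_coeff (f s) i) holomorphic_on A"
  unfolding falling_coeff_def by (intro holomorphic_intros)

text \<open>The hypothesis makes the modulus of the derivative of order \<open>Suc K\<close>
  nonincreasing on the unit step, so its value at the left end controls the remainder.\<close>

lemma norm_taylor_rest_le:
  assumes "1 - Re s - real (Suc K) \<le> 0"
  shows "norm (taylor_rest K n s) \<le> norm (falling_coeff s (Suc K)) * real (Suc n) powr (1 - Re s - real (Suc K))"
proof -
  let ?S = "complex_of_real ` {real (Suc n)..real (Suc (Suc n))}"
  let ?f = "\<lambda>i x. falling_coeff s i * x powr (1 - s - of_nat i)"
  let ?B = "norm (falling_coeff s (Suc K)) * real (Suc n) powr (1 - Re s - real (Suc K))"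
  have T: "norm (?f 0 (of_real (real (Suc (Suc n)))) - (\<Sum>i\<le>K. ?f i (of_real (real (Suc n))) *
          (of_real (real (Suc (Suc n))) - of_real (real (Suc n))) ^ i / fact i))
     \<le> ?B * norm (complex_of_real (real (Suc (Suc n))) - of_real (real (Suc n))) ^ Suc K / fact K"
  proof (rule complex_Taylor)
    show "convex ?S" by (intro convex_linear_image convex_real_interval) (simp add: bounded_linear.linear bounded_linear_of_real)
    show "(?f i has_field_derivative ?f (Suc i) x) (at x within ?S)" if "x \<in> ?S" for i x
    proof -
      have "x \<notin> \<real>\<^sub>\<le>\<^sub>0" using that by auto
      moreover have "1 - s - of_nat i - 1 = 1 - s - of_nat (Suc i)" by simp
      ultimately show ?thesis
        by (auto intro!: derivative_eq_intros simp: falling_coeff_def)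
    qed
    show "norm (?f (Suc K) x) \<le> ?B" if x: "x \<in> ?S" for x
    proof -
      obtain t where "x = complex_of_real t" "t \<in> {real (Suc n)..real (Suc (Suc n))}"
        using x by blast
      hence t: "x = of_real t" "t \<ge> real (Suc n)" by auto
      have "t powr (1 - Re s - real (Suc K)) \<le> real (Suc n) powr (1 - Re s - real (Suc K))"
        using t assms by (intro powr_mono2') auto
      thus ?thesis using t norm_powr_of_real[of t "1 - s - of_nat (Suc K)"]
        by (simp add: norm_mult mult_left_mono)
    qed
  qed (rule imageI; simp)+
  have "norm (taylor_rest K n s) \<le> ?B / fact K"
    using T by (simp add: taylor_rest_def falling_coeff_def[of s 0] mult_ac)
  also have "\<dots> \<le> ?B / 1" by (intro divide_left_mono) (auto simp: fact_ge_1)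
  finally show ?thesis by simp
qed

text \<open>One remainder is of size n^(-Re s - K), and in this half-plane the exponent is below
  -1.\<close>

lemma holomorphic_taylor_rest_sum:
  "(\<lambda>s. \<Sum>n. taylor_rest K n s) holomorphic_on {s. Re s > 1 - real K}"
proof (rule holomorphic_series)
  fix z assume z: "z \<in> {s. Re s > 1 - real K}"
  define r where "r = (Re z - 1 + real K) / 2"
  have r: "r > 0" using z by (simp add: r_def)
  have *: "Re w \<ge> 1 - real K + r" if "w \<in> cball z r" for w
  proof -
    have "Re z - r = 1 - real K + r" unfolding r_def by (simp add: field_simps)
    thus ?thesis using cball_Re_ge[OF that] by simp
  qed
  have "bounded ((\<lambda>s. falling_coeff s (Suc K)) ` cball z r)"
    by (intro compact_imp_bounded compact_continuous_image holomorphic_on_imp_continuous_on holomorphic_intros) auto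
  then obtain M where M: "\<forall>x\<in>(\<lambda>s. falling_coeff s (Suc K)) ` cball z r. norm x \<le> M"
    unfolding bounded_iff by blast
  show "\<exists>r>0. \<exists>M. cball z r \<subseteq> {s. Re s > 1 - real K} \<and> summable M \<and>
     (\<forall>n. \<forall>w\<in>cball z r. norm (taylor_rest K n w) \<le> M n)"
  proof (intro exI conjI allI ballI)
    show "cball z r \<subseteq> {s. Re s > 1 - real K}" using * r by force
    show "summable (\<lambda>n. M * real (Suc n) powr (- (1 + r)))" using r by (intro summable_mult summable_Suc_powr) simp
    fix n w assume w: "w \<in> cball z r"
    have "norm (taylor_rest K n w) \<le> norm (falling_coeff w (Suc K)) * real (Suc n) powr (1 - Re w - real (Suc K))"
      using *[OF w] r by (intro norm_taylor_rest_le) auto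
    also have "\<dots> \<le> M * real (Suc n) powr (- (1 + r))"
      using M w *[OF w] order_trans[OF norm_ge_zero, of "falling_coeff w (Suc K)" M]
      by (intro mult_mono powr_mono) auto
    finally show "norm (taylor_rest K n w) \<le> M * real (Suc n) powr (- (1 + r))" .
  qed fact
next
  show "taylor_rest K n holomorphic_on {s. Re s > 1 - real K}" for n
    unfolding taylor_rest_def by (intro holomorphic_intros) auto
qed (auto simp: open_halfspace_Re_gt)

text \<open>Expanding the telescoping sum of \<open>(n + 1)\<^sup>1\<^sup>-\<^sup>s - n\<^sup>1\<^sup>-\<^sup>s\<close> expresses \<open>(s - 1) \<zeta>(s)\<close> through the values
  \<open>\<zeta>(s + 1), \<dots>, \<zeta>(s + K - 1)\<close>, which extends \<open>\<zeta>\<close> to the left one unit strip at a time.\<close>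

lemma dirichlet_zeta_recurrence:
  assumes s: "Re s > 1"
  shows "(s - 1) * dirichlet_zeta s = 1 + (\<Sum>n. taylor_rest (Suc K) n s) -
     (\<Sum>i<K. falling_coeff s (Suc i) / fact (Suc (Suc i)) * ((s + of_nat (Suc i) - 1) * dirichlet_zeta (s + of_nat (Suc i))))"
proof -
  let ?u = "\<lambda>n. complex_of_nat (Suc n) powr (1 - s)"
  let ?t = "\<lambda>i n. falling_coeff s i / fact i * complex_of_nat (Suc n) powr (1 - s - of_nat i)"
  have "(\<lambda>n. real (Suc n) powr (1 - Re s)) \<longlonglongrightarrow> 0"
    using s filterlim_compose[OF filterlim_real_sequentially filterlim_Suc]
    by (intro tendsto_neg_powr) auto
  hence "?u \<longlonglongrightarrow> 0" by (intro tendsto_norm_zero_cancel[of ?u]) (simp only: norm_Suc_powr, simp)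
  from telescope_sums[OF this] have tel: "(\<lambda>n. ?u (Suc n) - ?u n) sums (- 1)" by simp
  have zs: "(\<lambda>n. ?t (Suc i) n) sums (falling_coeff s (Suc i) / fact (Suc i) * dirichlet_zeta (s + of_nat i))" for i
  proof -
    have "summable (\<lambda>n. norm (complex_of_nat (Suc n) powr (- (s + of_nat i))))"
      using s by (intro summable_norm_Suc_powr) auto
    hence "(\<lambda>n. complex_of_nat (Suc n) powr (- (s + of_nat i))) sums dirichlet_zeta (s + of_nat i)"
      unfolding dirichlet_zeta_def by (rule summable_sums[OF summable_norm_cancel])
    moreover have "1 - s - of_nat (Suc i) = - (s + of_nat i)" by simp
    ultimately show ?thesis by (simp only: sums_mult)
  qed
  have "(\<lambda>n. \<Sum>i\<le>K. ?t (Suc i) n) sums (\<Sum>i\<le>K. falling_coeff s (Suc i) / fact (Suc i) * dirichlet_zeta (s + of_nat i))"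
    by (rule sums_sum) (rule zs)
  from sums_diff[OF tel this]
  have "(\<lambda>n. taylor_rest (Suc K) n s) sums (- 1 - (\<Sum>i\<le>K. falling_coeff s (Suc i) / fact (Suc i) * dirichlet_zeta (s + of_nat i)))"
  proof (rule sums_cong[THEN iffD1, rotated])
    fix n
    have "(\<Sum>i\<le>Suc K. ?t i n) = ?t 0 n + (\<Sum>i\<le>K. ?t (Suc i) n)"
      by (rule sum.atMost_Suc_shift)
    moreover have "?t 0 n = ?u n" by (simp add: falling_coeff_def)
    ultimately show "?u (Suc n) - ?u n - (\<Sum>i\<le>K. ?t (Suc i) n) = taylor_rest (Suc K) n s"
      unfolding taylor_rest_def by (simp only: diff_diff_eq)
  qed
  hence R: "(\<Sum>n. taylor_rest (Suc K) n s) = - 1 - (\<Sum>i\<le>K. falling_coeff s (Suc i) / fact (Suc i) * dirichlet_zeta (s + of_nat i))"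
    by (rule sums_unique[symmetric])
  have "(\<Sum>i\<le>K. falling_coeff s (Suc i) / fact (Suc i) * dirichlet_zeta (s + of_nat i)) =
      falling_coeff s 1 * dirichlet_zeta s + (\<Sum>i<K. falling_coeff s (Suc (Suc i)) / fact (Suc (Suc i)) * dirichlet_zeta (s + of_nat (Suc i)))"
    by (subst lessThan_Suc_atMost[symmetric], subst sum.lessThan_Suc_shift) simp
  also have "falling_coeff s 1 = 1 - s" by (simp add: falling_coeff_def)
  finally have S: "(\<Sum>i\<le>K. falling_coeff s (Suc i) / fact (Suc i) * dirichlet_zeta (s + of_nat i)) =
      (1 - s) * dirichlet_zeta s + (\<Sum>i<K. falling_coeff s (Suc (Suc i)) / fact (Suc (Suc i)) * dirichlet_zeta (s + of_nat (Suc i)))" .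
  \<comment> \<open>The last factor of the coefficient is \<open>w - 1\<close> up to sign for
    \<open>w = s + of_nat (Suc i)\<close>, so zeta enters the right side only as
    \<open>(w - 1) * dirichlet_zeta w\<close>, which stays regular at \<open>w = 1\<close>.\<close>
  have "falling_coeff s (Suc (Suc i)) = - (falling_coeff s (Suc i) * (s + of_nat (Suc i) - 1))" for i
    by (simp add: falling_coeff_def algebra_simps)
  hence "(\<Sum>i<K. falling_coeff s (Suc (Suc i)) / fact (Suc (Suc i)) * dirichlet_zeta (s + of_nat (Suc i))) =
     - (\<Sum>i<K. falling_coeff s (Suc i) / fact (Suc (Suc i)) * ((s + of_nat (Suc i) - 1) * dirichlet_zeta (s + of_nat (Suc i))))"
    unfolding sum_negf[symmetric] by (intro sum.cong refl) (simp del: fact_Suc of_nat_Suc)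
  thus ?thesis unfolding R S by (simp add: algebra_simps del: fact_Suc of_nat_Suc)
qed

text \<open>The product with \<open>s - 1\<close> has no pole, so the induction may evaluate it at
  shifted points that happen to be 1. For \<open>Re s > 1 - real (Suc j)\<close> all points
  \<open>s + of_nat (Suc i)\<close> lie in the half-plane already reached.\<close>

lemma zeta_continuation_half_plane:
  "\<exists>h. h holomorphic_on {s. Re s > 1 - real j} \<and> (\<forall>s. Re s > 1 \<longrightarrow> h s = (s - 1) * dirichlet_zeta s)"
proof (induction j)
  case 0
  show ?case
    by (rule exI[of _ "\<lambda>s. (s - 1) * dirichlet_zeta s"])
      (auto intro!: holomorphic_intros holomorphic_dirichlet_zeta)
next
  case (Suc j)
  then obtain h where h: "h holomorphic_on {s. Re s > 1 - real j}" "\<And>s. Re s > 1 \<Longrightarrow> h s = (s - 1) * dirichlet_zeta s"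
    by blast
  define g where "g s = 1 + (\<Sum>n. taylor_rest (Suc j) n s) -
     (\<Sum>i<j. falling_coeff s (Suc i) / fact (Suc (Suc i)) * h (s + of_nat (Suc i)))" for s
  have "(\<lambda>s. h (s + of_nat (Suc i))) holomorphic_on {s. Re s > 1 - real (Suc j)}" for i
    by (rule holomorphic_on_compose_gen[of "\<lambda>s. s + of_nat (Suc i)" _ h "{s. Re s > 1 - real j}", unfolded o_def])
      (auto intro!: holomorphic_intros h)
  hence "g holomorphic_on {s. Re s > 1 - real (Suc j)}"
    unfolding g_def by (intro holomorphic_intros holomorphic_taylor_rest_sum) auto
  moreover have "g s = (s - 1) * dirichlet_zeta s" if "Re s > 1" for s
  proof -
    have "h (s + of_nat (Suc i)) = (s + of_nat (Suc i) - 1) * dirichlet_zeta (s + of_nat (Suc i))" for i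
      using that by (intro h) simp
    thus ?thesis unfolding g_def dirichlet_zeta_recurrence[OF that, of j] by simp
  qed
  ultimately show ?case by blast
qed

lemma zeta_continuation_exists:
  "\<exists>f. f holomorphic_on (- {1}) \<and> (\<forall>z. Re z > 1 \<longrightarrow> f z = dirichlet_zeta z)"
proof -
  obtain h where h: "\<And>j. h j holomorphic_on {s. Re s > 1 - real j}"
      "\<And>j s. Re s > 1 \<Longrightarrow> h j s = (s - 1) * dirichlet_zeta s"
  proof -
    have "\<exists>h. \<forall>j. h j holomorphic_on {s. Re s > 1 - real j} \<and> (\<forall>s. Re s > 1 \<longrightarrow> h j s = (s - 1) * dirichlet_zeta s)"
      by (intro choice allI zeta_continuation_half_plane)
    thus ?thesis using that by blast
  qed
  let ?H = "\<lambda>j. {s. Re s > 1 - real j}"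
  have agree: "h i s = h j s" if "s \<in> ?H i" "i \<le> j" for i j s
  proof (rule analytic_continuation_open[where f = "h i" and g = "h j" and s = "{s. Re s > 1}" and s' = "?H i"])
    show "h j holomorphic_on ?H i" by (rule holomorphic_on_subset[OF h(1)[of j]]) (use that in auto)
    show "{s::complex. Re s > 1} \<noteq> {}" by (auto intro!: exI[of _ 2])
  qed (use that h in \<open>auto simp: open_halfspace_Re_gt convex_halfspace_Re_gt convex_connected\<close>)
  \<comment> \<open>One index whose half-plane contains \<open>s\<close>; by \<open>agree\<close>
    every other such index gives the same value.\<close>
  define N where "N s = nat \<lceil>2 - Re s\<rceil>" for s
  have N: "s \<in> ?H (N s)" for s using real_nat_ceiling_ge[of "2 - Re s"] by (simp add: N_def)
  define f where "f s = h (N s) s / (s - 1)" for s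
  have f_eq: "f s = h j s / (s - 1)" if sj: "s \<in> ?H j" for s j
  proof (cases "j \<le> N s")
    case True
    show ?thesis unfolding f_def agree[OF sj True] ..
  next
    case False
    hence "N s \<le> j" by simp
    show ?thesis unfolding f_def agree[OF N \<open>N s \<le> j\<close>] ..
  qed
  have "f holomorphic_on (\<Union>j\<in>UNIV. ?H j - {1})"
  proof (rule holomorphic_on_UN_open)
    fix j :: nat
    have "(\<lambda>s. h j s / (s - 1)) holomorphic_on ?H j - {1}"
      by (intro holomorphic_intros holomorphic_on_subset[OF h(1)]) auto
    thus "f holomorphic_on ?H j - {1}" by (rule holomorphic_transform) (use f_eq in auto)
    show "open (?H j - {1})" by (intro open_Diff open_halfspace_Re_gt) auto
  qed
  moreover have "(\<Union>j\<in>UNIV. ?H j - {1}) = - {1}" using N by blast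
  moreover have "f z = dirichlet_zeta z" if "Re z > 1" for z
    using that h(2)[OF that] unfolding f_def by auto
  ultimately show ?thesis by auto
qed

text \<open>Discharges the description operator in \<open>zeta\<close>: the punctured plane is
  connected, so the identity theorem applies.\<close>

lemma zeta_unique:
  assumes "f holomorphic_on (- {1})" "\<And>z. Re z > 1 \<Longrightarrow> f z = dirichlet_zeta z" "s \<noteq> 1"
  shows "zeta s = f s"
  unfolding zeta_def
proof (rule the_equality)
  show "\<exists>g. g holomorphic_on (- {1}) \<and> (\<forall>z. Re z > 1 \<longrightarrow> g z = (\<Sum>n. of_nat (Suc n) powr (- z))) \<and> f s = g s"
    using assms by (auto simp: dirichlet_zeta_def)
next
  fix w assume "\<exists>g. g holomorphic_on (- {1}) \<and> (\<forall>z. Re z > 1 \<longrightarrow> g z = (\<Sum>n. of_nat (Suc n) powr (- z))) \<and> w = g s"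
  then obtain g where g: "g holomorphic_on (- {1})" "\<And>z. Re z > 1 \<Longrightarrow> g z = dirichlet_zeta z" "w = g s"
    by (auto simp: dirichlet_zeta_def)
  have "g s = f s"
  proof (rule analytic_continuation_open[where f = g and g = f and s = "{s. Re s > 1}" and s' = "- {1}"])
    show "{s::complex. Re s > 1} \<noteq> {}" by (auto intro!: exI[of _ 2])
    show "connected (- {1 :: complex})" by (rule connected_punctured_universe) simp
  qed (use assms g in \<open>auto simp: open_halfspace_Re_gt\<close>)
  thus "w = f s" using g by simp
qed

lemma holomorphic_zeta: "zeta holomorphic_on (- {1})"
  and zeta_eq_dirichlet: "Re s > 1 \<Longrightarrow> zeta s = dirichlet_zeta s"
proof -
  obtain f where f: "f holomorphic_on (- {1})" "\<And>z. Re z > 1 \<Longrightarrow> f z = dirichlet_zeta z"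
    using zeta_continuation_exists by blast
  show "zeta holomorphic_on (- {1})"
    by (rule holomorphic_transform[OF f(1)]) (use zeta_unique[OF f] in auto)
  show "zeta s = dirichlet_zeta s" if s: "Re s > 1"
  proof -
    have "s \<noteq> 1" using s by force
    thus ?thesis using zeta_unique[OF f] f(2)[OF s] by simp
  qed
qed

section \<open>Mellin transforms and the zeta function in the critical strip\<close>

lemma lhalf_FTC_open:
  fixes F f :: "real \<Rightarrow> complex"
  assumes F: "\<And>t. t > 0 \<Longrightarrow> (F has_vector_derivative f t) (at t)"
    and f: "continuous_on {0<..} f" "integrable lhalf f"
    and lim: "(F \<longlongrightarrow> A) (at_right 0)" "(F \<longlongrightarrow> B) at_top"
  shows "integral\<^sup>L lhalf f = B - A"
proof -
  have e: "einterval 0 \<infinity> = {0<..}" by (auto simp: einterval_def zero_ereal_def)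
  have "(LBINT x=0..\<infinity>. f x) = B - A"
  proof (rule interval_integral_FTC_integrable)
    show "set_integrable lborel (einterval 0 \<infinity>) f"
      using f(2) unfolding e integrable_lhalf_iff .
    show "((F \<circ> real_of_ereal) \<longlongrightarrow> A) (at_right 0)"
      using lim(1) by (simp add: zero_ereal_def ereal_tendsto_simps)
    show "((F \<circ> real_of_ereal) \<longlongrightarrow> B) (at_left \<infinity>)"
      using lim(2) by (simp add: ereal_tendsto_simps)
    show "isCont f x" if "0 < ereal x" "ereal x < \<infinity>" for x
      using f(1) that by (simp add: continuous_on_eq_continuous_at)
  qed (use F in auto)
  also have "(LBINT x=0..\<infinity>. f x) = integral\<^sup>L lhalf f"
    by (simp add: interval_lebesgue_integral_def e set_lebesgue_integral_def integral_restrict_space)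
  finally show ?thesis .
qed

text \<open>Written as a Gamma integral over \<open>y\<close> with parameter
  \<open>c + of_real t\<close>, the power \<open>(c + of_real t) powr (- b)\<close> lets Fubini's
  theorem reduce the claim to two further Gamma integrals. Complex \<open>c\<close> is wanted for
  \<open>v \<plusminus> \<i> k\<close> in the Lipschitz formula.\<close>

lemma has_bochner_integral_Beta_prime:
  assumes a: "0 < Re a" "Re a < Re b" and c: "Re c > 0"
  shows "has_bochner_integral lhalf (\<lambda>t. of_real t powr (a - 1) * (c + of_real t) powr (- b))
     (Gamma a * Gamma (b - a) / Gamma b * c powr (a - b))"
proof -
  interpret L: sigma_finite_measure lhalf by (rule sigma_finite_lhalf)
  interpret P: pair_sigma_finite lhalf lhalf ..
  let ?p = "\<lambda>t. complex_of_real t powr (a - 1)"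
  let ?q = "\<lambda>y. complex_of_real y powr (b - 1) * exp (- (c * of_real y))"
  let ?F = "\<lambda>y t. ?p t * ?q y * exp (- (of_real t * of_real y))"
  have b: "Re b > 0" using a by linarith
  have m: "?p \<in> borel_measurable lhalf" "?q \<in> borel_measurable lhalf" "(\<lambda>x. x) \<in> borel_measurable lhalf"
    by (rule measurable_lhalf_continuous; auto intro!: continuous_intros)+
  have inner_t: "has_bochner_integral lhalf (?F y) (Gamma a * (of_real y powr ((b - a) - 1) * exp (- (c * of_real y))))" if y: "y > 0" for y
  proof -
    have "has_bochner_integral lhalf (\<lambda>t. of_real t powr (a - 1) * exp (- (of_real y * of_real t))) (Gamma a * of_real y powr (- a))"
      by (rule has_bochner_integral_Gamma_scaled_real) (use a y in auto)
    from has_bochner_integral_mult_right[OF this, of "?q y"]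
    have "has_bochner_integral lhalf (?F y) (?q y * (Gamma a * of_real y powr (- a)))"
      by (simp add: mult_ac)
    moreover have "complex_of_real y powr ((b - a) - 1) = of_real y powr (b - 1) * of_real y powr (- a)"
      by (simp add: algebra_simps flip: powr_add)
    ultimately show ?thesis by (simp only: mult_ac)
  qed
  have inner_y: "has_bochner_integral lhalf (\<lambda>y. ?F y t) (Gamma b * (?p t * (c + of_real t) powr (- b)))" if t: "t > 0" for t
  proof -
    have "has_bochner_integral lhalf (\<lambda>y. of_real y powr (b - 1) * exp (- ((c + of_real t) * of_real y))) (Gamma b * (c + of_real t) powr (- b))"
      by (rule has_bochner_integral_Gamma_scaled) (use b c t in auto)
    from has_bochner_integral_mult_right[OF this, of "?p t"]
    show ?thesis by (simp add: mult_ac ring_distribs exp_add exp_diff exp_minus divide_inverse)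
  qed
  have int: "integrable (lhalf \<Otimes>\<^sub>M lhalf) (case_prod ?F)"
  proof (rule P.Fubini_integrable)
    have m1: "(\<lambda>x. ?p (snd x)) \<in> borel_measurable (lhalf \<Otimes>\<^sub>M lhalf)"
         "(\<lambda>x. ?q (fst x)) \<in> borel_measurable (lhalf \<Otimes>\<^sub>M lhalf)"
         "fst \<in> borel_measurable (lhalf \<Otimes>\<^sub>M lhalf)" "snd \<in> borel_measurable (lhalf \<Otimes>\<^sub>M lhalf)"
      using measurable_compose[OF measurable_snd m(1)] measurable_compose[OF measurable_fst m(2)]
        measurable_compose[OF measurable_fst m(3)] measurable_compose[OF measurable_snd m(3)] by auto
    have "(\<lambda>x. ?p (snd x) * ?q (fst x) * exp (- (of_real (snd x) * of_real (fst x))))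
        \<in> borel_measurable (lhalf \<Otimes>\<^sub>M lhalf)"
      using m1 by (intro borel_measurable_times m1 borel_measurable_exp borel_measurable_uminus) auto
    thus "case_prod ?F \<in> borel_measurable (lhalf \<Otimes>\<^sub>M lhalf)" by (simp add: case_prod_beta')
    show "AE y in lhalf. integrable lhalf (\<lambda>t. case_prod ?F (y, t))"
      using inner_t by (auto intro!: AE_I2 simp: has_bochner_integral_iff)
    \<comment> \<open>In absolute value every parameter is replaced by its real part; the remaining
      integral over \<open>y\<close> converges at 0 because \<open>Re a < Re b\<close>.\<close>
    have nF: "has_bochner_integral lhalf (\<lambda>t. norm (?F y t))
        (Gamma (Re a) * (y powr ((Re b - Re a) - 1) * exp (- (Re c * y))))" if y: "y > 0" for y
    proof -
      have "has_bochner_integral lhalf (\<lambda>t. t powr (Re a - 1) * exp (- (y * t))) (Gamma (Re a) * y powr (- Re a))"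
        by (rule has_bochner_integral_Gamma_real) (use a y in auto)
      from has_bochner_integral_mult_right[OF this, of "y powr (Re b - 1) * exp (- (Re c * y))"]
      have "has_bochner_integral lhalf (\<lambda>t. y powr (Re b - 1) * exp (- (Re c * y)) * (t powr (Re a - 1) * exp (- (y * t))))
        (y powr (Re b - 1) * exp (- (Re c * y)) * (Gamma (Re a) * y powr (- Re a)))" .
      moreover have "y powr ((Re b - Re a) - 1) = y powr (Re b - 1) * y powr (- Re a)"
        by (simp add: algebra_simps flip: powr_add)
      moreover have "norm (?F y t) = y powr (Re b - 1) * exp (- (Re c * y)) * (t powr (Re a - 1) * exp (- (y * t)))" if "t > 0" for t
        using that y by (simp add: norm_mult norm_powr_of_real mult_ac)
      ultimately show ?thesis by (subst has_bochner_integral_cong) (auto simp: mult_ac)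
    qed
    have "integrable lhalf (\<lambda>y. Gamma (Re a) * (y powr ((Re b - Re a) - 1) * exp (- (Re c * y))))"
      using has_bochner_integral_Gamma_real[of "Re b - Re a" "Re c"] a c
      by (intro integrable_mult_right) (auto simp: has_bochner_integral_iff)
    thus "integrable lhalf (\<lambda>y. \<integral>t. norm (case_prod ?F (y, t)) \<partial>lhalf)"
      by (rule Bochner_Integration.integrable_cong[THEN iffD1, OF refl, rotated])
        (use nF in \<open>simp add: has_bochner_integral_iff\<close>)
  qed
  have "(\<integral>t. (\<integral>y. ?F y t \<partial>lhalf) \<partial>lhalf) = (\<integral>y. (\<integral>t. ?F y t \<partial>lhalf) \<partial>lhalf)"
    by (rule P.Fubini_integral[OF int])
  also have "\<dots> = (\<integral>y. Gamma a * (of_real y powr ((b - a) - 1) * exp (- (c * of_real y))) \<partial>lhalf)"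
    using inner_t by (intro Bochner_Integration.integral_cong) (auto simp: has_bochner_integral_iff)
  also have "\<dots> = Gamma a * (Gamma (b - a) * c powr (- (b - a)))"
    using has_bochner_integral_Gamma_scaled[of "b - a" c] a c by (simp add: has_bochner_integral_iff)
  finally have 1: "(\<integral>t. (\<integral>y. ?F y t \<partial>lhalf) \<partial>lhalf) = \<dots>" .
  have 2: "(\<integral>y. ?F y t \<partial>lhalf) = Gamma b * (?p t * (c + of_real t) powr (- b))" if "t \<in> space lhalf" for t
    using inner_y[of t] that by (simp add: has_bochner_integral_iff)
  have "integrable lhalf (\<lambda>t. \<integral>y. ?F y t \<partial>lhalf)"
    by (rule P.integrable_snd[OF int])
  hence "integrable lhalf (\<lambda>t. Gamma b * (?p t * (c + of_real t) powr (- b)))"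
    by (rule Bochner_Integration.integrable_cong[THEN iffD1, OF refl 2, rotated])
  moreover have "(\<integral>t. Gamma b * (?p t * (c + of_real t) powr (- b)) \<partial>lhalf) = Gamma a * (Gamma (b - a) * c powr (- (b - a)))"
    unfolding 1[symmetric] using 2 by (intro Bochner_Integration.integral_cong) auto
  ultimately have "has_bochner_integral lhalf (\<lambda>t. Gamma b * (?p t * (c + of_real t) powr (- b))) (Gamma a * (Gamma (b - a) * c powr (- (b - a))))"
    by (simp only: has_bochner_integral_iff)
  from has_bochner_integral_mult_right[OF this, of "inverse (Gamma b)"]
  show ?thesis using Gamma_neq_0[OF b] by (simp add: field_simps)
qed

section \<open>The Bose kernel \<open>1 / (exp u - 1)\<close> and its Mellin transform\<close>

lemma exp_minus_sums:
  fixes u :: real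
  assumes "u > 0"
  shows "(\<lambda>n. exp (- (real (Suc n) * u))) sums (1 / (exp u - 1))"
proof -
  have "(\<lambda>n. exp (- u) ^ n) sums (1 / (1 - exp (- u)))" using assms by (intro geometric_sums) auto
  from sums_mult[OF this, of "exp (- u)"]
  have "(\<lambda>n. exp (- u) * exp (- u) ^ n) sums (exp (- u) * (1 / (1 - exp (- u))))" .
  moreover have "exp (- u) * exp (- u) ^ n = exp (- (real (Suc n) * u))" for n
    by (simp add: exp_of_nat_mult[symmetric] exp_add[symmetric] algebra_simps)
  moreover have "exp (- u) * (1 / (1 - exp (- u))) = 1 / (exp u - 1)"
    using assms by (simp add: exp_minus field_simps)
  ultimately show ?thesis by simp
qed

text \<open>Geometric expansion of the kernel, integrated term by term. The shift \<epsilon> is an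
  Abel regularisation: with it the sum converges for all \<open>Re z > 0\<close>, without it only
  for \<open>Re z > 1\<close>.\<close>

lemma Mellin_Bose:
  assumes z: "Re z > 0" and e: "\<epsilon> \<ge> 0" "\<epsilon> > 0 \<or> Re z > 1"
  shows "has_bochner_integral lhalf (\<lambda>t. of_real t powr (z - 1) * of_real (1 / (exp (t + \<epsilon>) - 1)))
    (Gamma z * (\<Sum>n. of_nat (Suc n) powr (- z) * of_real (exp (- (real (Suc n) * \<epsilon>)))))"
proof -
  let ?f = "\<lambda>n t. complex_of_real t powr (z - 1) * of_real (exp (- (real (Suc n) * (t + \<epsilon>))))"
  have f_eq: "?f n t = of_real (exp (- (real (Suc n) * \<epsilon>))) * (complex_of_real t powr (z - 1) * exp (- (of_real (real (Suc n)) * of_real t)))" for n t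
    by (simp add: algebra_simps exp_of_real[symmetric] exp_add exp_diff exp_minus divide_inverse del: of_nat_Suc)
  have hb: "has_bochner_integral lhalf (?f n) (of_real (exp (- (real (Suc n) * \<epsilon>))) * (Gamma z * of_real (real (Suc n)) powr (- z)))" for n
    unfolding f_eq by (intro has_bochner_integral_mult_right has_bochner_integral_Gamma_scaled_real z) simp
  have nf: "has_bochner_integral lhalf (\<lambda>t. norm (?f n t)) (exp (- (real (Suc n) * \<epsilon>)) * (Gamma (Re z) * real (Suc n) powr (- Re z)))" for n
  proof -
    have "has_bochner_integral lhalf (\<lambda>t. exp (- (real (Suc n) * \<epsilon>)) * (t powr (Re z - 1) * exp (- (real (Suc n) * t))))
       (exp (- (real (Suc n) * \<epsilon>)) * (Gamma (Re z) * real (Suc n) powr (- Re z)))"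
      by (intro has_bochner_integral_mult_right has_bochner_integral_Gamma_real z) simp
    moreover have "norm (?f n t) = exp (- (real (Suc n) * \<epsilon>)) * (t powr (Re z - 1) * exp (- (real (Suc n) * t)))" if "t > 0" for t
      using that unfolding f_eq by (simp add: norm_mult norm_powr_of_real)
    ultimately show ?thesis by (subst has_bochner_integral_cong) auto
  qed
  have G: "Gamma (Re z) > 0" using z by (rule Gamma_real_pos)
  have "summable (\<lambda>n. exp (- (real (Suc n) * \<epsilon>)) * real (Suc n) powr (- Re z))"
  proof (cases "\<epsilon> > 0")
    case True
    show ?thesis
    proof (rule summable_comparison_test')
      show "summable (\<lambda>n. exp (- (real (Suc n) * \<epsilon>)))" using exp_minus_sums[OF True] by (rule sums_summable)
      have "real (Suc n) powr (- Re z) \<le> 1" for n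
        using z powr_mono[of "- Re z" 0 "real (Suc n)"] by simp
      thus "norm (exp (- (real (Suc n) * \<epsilon>)) * real (Suc n) powr (- Re z)) \<le> exp (- (real (Suc n) * \<epsilon>))" for n
        by (simp add: mult_left_le del: of_nat_Suc)
    qed
  next
    case False
    hence "\<epsilon> = 0" "Re z > 1" using e by auto
    thus ?thesis using summable_Suc_powr[of "- Re z"] by simp
  qed
  from summable_mult[OF this, of "Gamma (Re z)"]
  have sum: "summable (\<lambda>n. integral\<^sup>L lhalf (\<lambda>t. norm (?f n t)))"
    using nf by (simp add: has_bochner_integral_iff mult_ac del: of_nat_Suc)
  have es: "(\<lambda>n. exp (- (real (Suc n) * (t + \<epsilon>)))) sums (1 / (exp (t + \<epsilon>) - 1))" if "t > 0" for t
    using that e by (intro exp_minus_sums) auto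
  have AE: "AE t in lhalf. summable (\<lambda>n. norm (?f n t))"
  proof (rule AE_I2)
    fix t assume "t \<in> space lhalf"
    hence "summable (\<lambda>n. norm (complex_of_real t powr (z - 1)) * exp (- (real (Suc n) * (t + \<epsilon>))))"
      using es[of t] by (intro summable_mult) (auto simp: sums_iff)
    thus "summable (\<lambda>n. norm (?f n t))" by (simp add: norm_mult del: of_nat_Suc)
  qed
  have int: "integrable lhalf (?f n)" for n using hb by (simp add: has_bochner_integral_iff)
  have lim: "(\<Sum>n. ?f n t) = of_real t powr (z - 1) * of_real (1 / (exp (t + \<epsilon>) - 1))" if "t \<in> space lhalf" for t
    using sums_mult[OF sums_of_real[OF es], of t "complex_of_real t powr (z - 1)"] that by (auto simp: sums_iff)
  have "integrable lhalf (\<lambda>t. of_real t powr (z - 1) * of_real (1 / (exp (t + \<epsilon>) - 1)))"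
    using integrable_suminf[OF int AE sum]
    by (rule Bochner_Integration.integrable_cong[THEN iffD1, OF refl lim, rotated])
  moreover have "integral\<^sup>L lhalf (\<lambda>t. of_real t powr (z - 1) * of_real (1 / (exp (t + \<epsilon>) - 1))) = (\<Sum>n. integral\<^sup>L lhalf (?f n))"
    unfolding integral_suminf[OF int AE sum, symmetric] using lim by (intro Bochner_Integration.integral_cong) auto
  moreover have "(\<Sum>n. integral\<^sup>L lhalf (?f n)) = Gamma z * (\<Sum>n. of_nat (Suc n) powr (- z) * of_real (exp (- (real (Suc n) * \<epsilon>))))"
  proof -
    have 1: "integral\<^sup>L lhalf (?f n) = Gamma z * (of_nat (Suc n) powr (- z) * of_real (exp (- (real (Suc n) * \<epsilon>))))" for n
      using hb[of n] by (simp add: has_bochner_integral_iff mult_ac del: of_nat_Suc)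
    have "summable (\<lambda>n. integral\<^sup>L lhalf (?f n))" by (rule summable_integral[OF int AE sum])
    hence "summable (\<lambda>n. complex_of_nat (Suc n) powr (- z) * of_real (exp (- (real (Suc n) * \<epsilon>))))"
      unfolding 1 using Gamma_neq_0[OF z] by (subst (asm) summable_cmult_iff) auto
    thus ?thesis unfolding 1 by (rule suminf_mult)
  qed
  ultimately show ?thesis by (simp only: has_bochner_integral_iff)
qed

text \<open>The kernel with its pole at 0 removed. It is bounded near 0 but decays only like -1/u,
  so its Mellin transform converges in the strip \<open>0 < Re z < 1\<close>.\<close>

definition bose :: "real \<Rightarrow> real" where "bose u = 1 / (exp u - 1) - 1 / u"

lemma bose_bounds:
  assumes u: "u > 0"
  shows "bose u \<le> 0" "- 1 \<le> bose u" "- 1 / u \<le> bose u"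
proof -
  have 1: "exp u - 1 \<ge> u" "exp u - 1 > 0" using exp_ge_add_one_self[of u] u by linarith+
  show "bose u \<le> 0" using 1 u by (simp add: bose_def frac_le)
  show "- 1 / u \<le> bose u" using 1 by (simp add: bose_def)
  have "exp (- u) \<ge> 1 - u" using exp_ge_add_one_self[of "- u"] by simp
  hence "exp u * exp (- u) \<ge> exp u * (1 - u)" by (intro mult_left_mono) auto
  hence "exp u * (1 - u) \<le> 1" by (simp flip: exp_add)
  hence "exp u - 1 \<le> u * (exp u - 1) + u" by (simp add: algebra_simps)
  hence "1 / u \<le> 1 + 1 / (exp u - 1)" using 1 u by (simp add: field_simps)
  thus "- 1 \<le> bose u" by (simp add: bose_def)
qed

lemma abs_bose_le: "u > 0 \<Longrightarrow> \<bar>bose u\<bar> \<le> 2 / (1 + u)"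
proof -
  assume u: "u > 0"
  have "\<bar>bose u\<bar> \<le> 1" "u * \<bar>bose u\<bar> \<le> 1" using bose_bounds[OF u] u by (auto simp: abs_if field_simps)
  hence "\<bar>bose u\<bar> * (1 + u) \<le> 2" by (simp add: algebra_simps)
  thus ?thesis using u by (simp add: field_simps)
qed

lemma continuous_bose: "continuous_on {0<..} bose"
  unfolding bose_def by (auto intro!: continuous_intros)

lemma integrable_powr_frac:
  fixes a :: real
  assumes "0 < a" "a < 1"
  shows "integrable lhalf (\<lambda>t. t powr (a - 1) * (2 / (1 + t)))"
proof -
  have "integrable lhalf (\<lambda>t. norm (complex_of_real t powr (of_real a - 1) * (1 + of_real t) powr (- 1)) * 2)"
    using has_bochner_integral_Beta_prime[of "of_real a" 1 1] assms
    by (intro integrable_mult_left integrable_norm) (auto simp: has_bochner_integral_iff)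
  thus ?thesis
  proof (rule Bochner_Integration.integrable_cong[THEN iffD1, OF refl, rotated])
    fix t assume "t \<in> space lhalf"
    hence t: "t > 0" by simp
    have "(1 + complex_of_real t) powr (- 1) = of_real (1 / (1 + t))"
      using t by (simp add: powr_minus complex_eq_iff divide_inverse powr_to_1)
    moreover have "norm (complex_of_real (1 + t)) = 1 + t" using t by (simp only: norm_of_real)
    hence "norm (1 + complex_of_real t) = 1 + t" by simp
    ultimately show "norm (complex_of_real t powr (of_real a - 1) * (1 + of_real t) powr (- 1)) * 2 = t powr (a - 1) * (2 / (1 + t))"
      using t by (simp add: norm_mult norm_powr_of_real norm_divide)
  qed
qed


text \<open>The same pole is removed by \<open>exp (- t) / t\<close>, which decays. The Mellin
  transform now converges for all \<open>Re z > 0\<close> and so connects the half-plane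
  \<open>Re z > 1\<close> with the strip; the product form shows the bound
  \<open>exp (- t)\<close>.\<close>

definition bose_cut :: "real \<Rightarrow> real" where "bose_cut t = exp (- t) * (1 + bose t)"

lemma bose_cut_bounds: "t > 0 \<Longrightarrow> \<bar>bose_cut t\<bar> \<le> exp (- t)"
  using bose_bounds[of t] by (simp add: bose_cut_def abs_mult)

lemma bose_cut_eq:
  assumes "t > 0"
  shows "bose_cut t = 1 / (exp t - 1) - exp (- t) / t" "bose t = bose_cut t + (exp (- t) - 1) / t"
  using assms by (simp_all add: bose_cut_def bose_def exp_minus field_simps)

lemma measurable_powr_times:
  assumes "continuous_on {0<..} f"
  shows "(\<lambda>t. complex_of_real t powr z * of_real (f t)) \<in> borel_measurable lhalf"
  by (rule measurable_lhalf_continuous) (use assms in \<open>auto intro!: continuous_intros\<close>)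

lemma continuous_bose_cut: "continuous_on {0<..} bose_cut"
  unfolding bose_cut_def by (intro continuous_intros continuous_bose)

lemma integrable_powr_exp: "a > 0 \<Longrightarrow> integrable lhalf (\<lambda>t. t powr (a - 1) * exp (- t))"
  using has_bochner_integral_Gamma_real[of a 1] by (simp add: has_bochner_integral_iff)

lemma integrable_bose_cut:
  assumes "Re z > 0"
  shows "integrable lhalf (\<lambda>t. of_real t powr (z - 1) * complex_of_real (bose_cut t))"
  by (rule Bochner_Integration.integrable_bound[OF integrable_powr_exp[OF assms]])
    (auto intro!: AE_I2 measurable_powr_times continuous_bose_cut mult_left_mono bose_cut_bounds
       simp: norm_mult norm_powr_of_real)

lemma integrable_bose:
  assumes "0 < Re z" "Re z < 1"
  shows "integrable lhalf (\<lambda>t. of_real t powr (z - 1) * complex_of_real (bose t))"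
proof (rule Bochner_Integration.integrable_bound[OF integrable_powr_frac[OF assms]])
  show "AE t in lhalf. norm (of_real t powr (z - 1) * complex_of_real (bose t)) \<le> norm (t powr (Re z - 1) * (2 / (1 + t)))"
  proof (rule AE_I2)
    fix t assume "t \<in> space lhalf"
    hence t: "t > 0" by simp
    have "t powr (Re z - 1) * \<bar>bose t\<bar> \<le> t powr (Re z - 1) * (2 / (1 + t))"
      by (intro mult_left_mono abs_bose_le t) auto
    thus "norm (of_real t powr (z - 1) * complex_of_real (bose t)) \<le> norm (t powr (Re z - 1) * (2 / (1 + t)))"
      using t by (simp add: norm_mult norm_powr_of_real)
  qed
qed (intro measurable_powr_times continuous_bose)

lemma holomorphic_bose_cut_Mellin:
  "(\<lambda>z. LINT t|lhalf. of_real t powr (z - 1) * complex_of_real (bose_cut t)) holomorphic_on {z. Re z > 0}"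
proof (rule holomorphic_on_integral)
  fix z assume z: "z \<in> {z. Re z > 0}"
  define r where "r = Re z / 2"
  define R where "R = Re z + r"
  have r: "r > 0" "R > 0" using z by (simp_all add: r_def R_def)
  have *: "r \<le> Re w \<and> Re w \<le> R" if "w \<in> cball z r" for w
    using that abs_Re_le_cmod[of "z - w"] by (auto simp: dist_norm r_def R_def)
  show "\<exists>r>0. \<exists>g. cball z r \<subseteq> {z. Re z > 0} \<and> integrable lhalf g \<and>
      (\<forall>w\<in>cball z r. \<forall>t\<in>space lhalf. norm (of_real t powr (w - 1) * complex_of_real (bose_cut t)) \<le> g t)"
  proof (intro exI conjI ballI)
    show "cball z r \<subseteq> {z. Re z > 0}" using * r by force
    show "integrable lhalf (\<lambda>t. t powr (r - 1) * exp (- t) + t powr (R - 1) * exp (- t))"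
      by (intro Bochner_Integration.integrable_add integrable_powr_exp r)
    fix w t assume w: "w \<in> cball z r" and "t \<in> space lhalf"
    hence t: "t > 0" by simp
    have "t powr (Re w - 1) * \<bar>bose_cut t\<bar> \<le> (t powr (r - 1) + t powr (R - 1)) * exp (- t)"
      using *[OF w] by (intro mult_mono powr_real_le_sum bose_cut_bounds t) auto
    thus "norm (of_real t powr (w - 1) * complex_of_real (bose_cut t)) \<le> t powr (r - 1) * exp (- t) + t powr (R - 1) * exp (- t)"
      using t by (simp add: norm_mult norm_powr_of_real ring_distribs)
  qed (rule r)
qed (auto simp: open_halfspace_Re_gt intro!: measurable_powr_times continuous_bose_cut holomorphic_intros)

lemma powr_minus_2_eq:
  fixes w z :: complex
  assumes "w \<noteq> 0"
  shows "w powr (z - 2) = w powr (z - 1) / w"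
  using powr_diff[of w "z - 1" 1] assms by simp

text \<open>For \<open>Re z > 1\<close> the two parts of \<open>bose_cut\<close> are integrable
  separately; the identity continues to the half-plane punctured at 1, where \<open>zeta\<close> and
  \<open>Gamma (z - 1)\<close> are both singular.\<close>

lemma bose_cut_Mellin:
  assumes z: "Re z > 0" "z \<noteq> 1"
  shows "(LINT t|lhalf. of_real t powr (z - 1) * complex_of_real (bose_cut t)) = Gamma z * zeta z - Gamma (z - 1)"
proof -
  let ?S = "{z. Re z > 0} - {1::complex}"
  let ?M = "\<lambda>z. LINT t|lhalf. of_real t powr (z - 1) * complex_of_real (bose_cut t)"
  show ?thesis
  proof (rule analytic_continuation_open[where f = ?M and g = "\<lambda>z. Gamma z * zeta z - Gamma (z - 1)"
        and s = "{z. Re z > 1}" and s' = ?S])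
    show "open {z::complex. Re z > 1}" by (rule open_halfspace_Re_gt)
    show "open ?S" by (intro open_Diff open_halfspace_Re_gt) auto
    show "connected ?S"
      by (intro connected_open_delete open_halfspace_Re_gt convex_connected convex_halfspace_Re_gt) simp
    show "{z::complex. Re z > 1} \<noteq> {}" by (auto intro!: exI[of _ 2])
    show "{z::complex. Re z > 1} \<subseteq> ?S" by auto
    show "?M holomorphic_on ?S" by (rule holomorphic_on_subset[OF holomorphic_bose_cut_Mellin]) auto
    have a: "z \<notin> \<int>\<^sub>\<le>\<^sub>0" if "z \<in> ?S" for z using that by (auto elim!: nonpos_Ints_cases)
    have b: "z - 1 \<notin> \<int>\<^sub>\<le>\<^sub>0" if z: "z \<in> ?S" for z
    proof
      assume "z - 1 \<in> \<int>\<^sub>\<le>\<^sub>0"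
      then obtain n where n: "z - 1 = of_int n" "n \<le> 0" by (auto elim!: nonpos_Ints_cases)
      hence "z = of_int (n + 1)" by (simp add: algebra_simps)
      hence "real_of_int (n + 1) > 0" using z by simp
      hence "n = 0" using n(2) by linarith
      thus False using n z by simp
    qed
    show "(\<lambda>z. Gamma z * zeta z - Gamma (z - 1)) holomorphic_on ?S"
      by (intro holomorphic_intros holomorphic_on_subset[OF holomorphic_zeta]) (use a b in auto)
    fix z :: complex assume "z \<in> {z. Re z > 1}"
    hence z: "Re z > 1" by simp
    have B: "has_bochner_integral lhalf (\<lambda>t. of_real t powr (z - 1) * of_real (1 / (exp t - 1))) (Gamma z * zeta z)"
      using Mellin_Bose[of z 0] z by (simp add: zeta_eq_dirichlet dirichlet_zeta_def)
    have C: "has_bochner_integral lhalf (\<lambda>t. of_real t powr ((z - 1) - 1) * exp (- of_real t)) (Gamma (z - 1))"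
      using z by (intro has_bochner_integral_Gamma) simp
    have "of_real t powr (z - 1) * of_real (1 / (exp t - 1)) - of_real t powr ((z - 1) - 1) * exp (- of_real t) =
        of_real t powr (z - 1) * complex_of_real (bose_cut t)" if "t > 0" for t
      unfolding bose_cut_eq(1)[OF that] using that
      by (simp add: powr_minus_2_eq algebra_simps exp_of_real[symmetric])
    hence "?M z = integral\<^sup>L lhalf (\<lambda>t. of_real t powr (z - 1) * of_real (1 / (exp t - 1)) - of_real t powr ((z - 1) - 1) * exp (- of_real t))"
      by (intro Bochner_Integration.integral_cong) auto
    also have "\<dots> = Gamma z * zeta z - Gamma (z - 1)"
      using B C by (subst Bochner_Integration.integral_diff) (auto simp: has_bochner_integral_iff)
    finally show "?M z = Gamma z * zeta z - Gamma (z - 1)" .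
  qed (use z in auto)
qed

text \<open>In the strip \<open>z - 1\<close> has negative real part, and subtracting 1 from the
  exponential makes the integral for \<open>Gamma (z - 1)\<close> converge. Partial integration
  gives \<open>Gamma z / (z - 1)\<close>.\<close>

lemma Gamma_shifted_integral:
  assumes z: "0 < Re z" "Re z < 1"
  shows "has_bochner_integral lhalf (\<lambda>t. of_real t powr (z - 1) * complex_of_real ((exp (- t) - 1) / t)) (Gamma (z - 1))"
proof -
  let ?g = "\<lambda>t. of_real t powr (z - 1) * complex_of_real ((exp (- t) - 1) / t)"
  let ?h = "\<lambda>t. of_real t powr (z - 1) * exp (- of_real t) :: complex"
  have z1: "z \<noteq> 1" using z by auto
  \<comment> \<open>The integrand is the difference of \<open>bose\<close> and
    \<open>bose_cut\<close>, whose transforms both converge here.\<close>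
  have "integrable lhalf (\<lambda>t. of_real t powr (z - 1) * complex_of_real (bose t) - of_real t powr (z - 1) * complex_of_real (bose_cut t))"
    using z by (intro Bochner_Integration.integrable_diff integrable_bose integrable_bose_cut)
  hence ig: "integrable lhalf ?g"
    by (rule Bochner_Integration.integrable_cong[THEN iffD1, OF refl, rotated])
      (simp add: bose_cut_eq(2) ring_distribs)
  have hh: "has_bochner_integral lhalf ?h (Gamma z)" using z by (intro has_bochner_integral_Gamma)
  \<comment> \<open>The boundary term of the partial integration; it vanishes at 0 because
    \<open>Re z > 0\<close> and at infinity because \<open>Re z < 1\<close>.\<close>
  let ?F = "\<lambda>t. of_real t powr (z - 1) * complex_of_real (exp (- t) - 1) / (z - 1)"
  let ?f = "\<lambda>t. ?g t - ?h t / (z - 1)"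
  have nF: "norm (?F t) = t powr (Re z - 1) * (1 - exp (- t)) / norm (z - 1)" if "t > 0" for t
  proof -
    have "norm (complex_of_real (exp (- t) - 1)) = 1 - exp (- t)"
      unfolding norm_of_real using that by simp
    thus ?thesis unfolding norm_divide norm_mult norm_powr_of_real[OF that] by simp
  qed
  have "integral\<^sup>L lhalf ?f = 0 - 0"
  proof (rule lhalf_FTC_open[where F = ?F])
    fix t :: real assume t: "t > 0"
    define w E Q m where "w = complex_of_real t" and "E = exp (- w)" and "Q = w powr (z - 1)" and "m = z - 1"
    have w: "w \<notin> \<real>\<^sub>\<le>\<^sub>0" "w \<noteq> 0" and m: "m \<noteq> 0" using t z1 by (auto simp: w_def m_def)
    have alg: "(m * (Q / w) * (E - 1) + (- E) * Q) / m = Q * ((E - 1) / w) - Q * E / m"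
      using w(2) m by (simp add: field_simps)
    have "((\<lambda>w. w powr (z - 1) * (exp (- w) - 1) / (z - 1)) has_field_derivative
        ((z - 1) * w powr (z - 1 - 1) * (E - 1) + (- E) * Q) / (z - 1)) (at w)"
      using w z1 by (auto intro!: derivative_eq_intros simp: E_def Q_def)
    moreover have "w powr (z - 1 - 1) = Q / w" using powr_minus_2_eq[OF w(2), of z] by (simp add: Q_def)
    ultimately have "((\<lambda>w. w powr (z - 1) * (exp (- w) - 1) / (z - 1)) has_field_derivative
        (m * (Q / w) * (E - 1) + (- E) * Q) / m) (at w)" by (simp only: m_def)
    hence "((\<lambda>w. w powr (z - 1) * (exp (- w) - 1) / (z - 1)) has_field_derivative ?f t) (at (of_real t))"
      unfolding alg by (simp add: w_def E_def Q_def m_def exp_of_real[symmetric])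
    from has_vector_derivative_real_field[OF this]
    show "(?F has_vector_derivative ?f t) (at t)" by (simp add: exp_of_real[symmetric])
  next
    show "continuous_on {0<..} ?f" using z1 by (auto intro!: continuous_intros)
    show "integrable lhalf ?f" using hh ig
      by (intro Bochner_Integration.integrable_diff integrable_divide) (auto simp: has_bochner_integral_iff)
    show "(?F \<longlongrightarrow> 0) (at_right 0)"
    proof (rule Lim_null_comparison)
      have "((\<lambda>t. t powr a) \<longlongrightarrow> 0) (at_right 0)" if "a > 0" for a :: real
        using that by real_asymp
      from tendsto_mult_left_zero[OF this[OF z(1)]]
      show "((\<lambda>t. t powr Re z * (1 / norm (z - 1))) \<longlongrightarrow> 0) (at_right 0)" .
      show "\<forall>\<^sub>F t in at_right 0. norm (?F t) \<le> t powr Re z * (1 / norm (z - 1))"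
        using eventually_at_right_less[of 0]
      proof eventually_elim
        case (elim t)
        have "1 - exp (- t) \<le> t" using exp_ge_add_one_self[of "- t"] by simp
        hence "t powr (Re z - 1) * (1 - exp (- t)) \<le> t powr (Re z - 1) * t powr 1"
          using elim by (intro mult_left_mono) auto
        also have "\<dots> = t powr Re z" using powr_add[of t "Re z - 1" 1] by simp
        finally show ?case unfolding nF[OF elim] by (simp add: divide_right_mono)
      qed
    qed
    show "(?F \<longlongrightarrow> 0) at_top"
    proof (rule Lim_null_comparison)
      have "((\<lambda>t. t powr a) \<longlongrightarrow> 0) at_top" if "a < 0" for a :: real
        using that by real_asymp
      moreover have "Re z - 1 < 0" using z(2) by simp
      ultimately have "((\<lambda>t. t powr (Re z - 1)) \<longlongrightarrow> 0) at_top" by blast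
      from tendsto_mult_left_zero[OF this]
      show "((\<lambda>t. t powr (Re z - 1) * (1 / norm (z - 1))) \<longlongrightarrow> 0) at_top" .
      show "\<forall>\<^sub>F t in at_top. norm (?F t) \<le> t powr (Re z - 1) * (1 / norm (z - 1))"
        using eventually_gt_at_top[of 0]
      proof eventually_elim
        case (elim t)
        have "t powr (Re z - 1) * (1 - exp (- t)) \<le> t powr (Re z - 1) * 1"
          using elim by (intro mult_left_mono) auto
        thus ?case unfolding nF[OF elim] by (simp add: divide_right_mono)
      qed
    qed
  qed
  hence "integral\<^sup>L lhalf ?g - integral\<^sup>L lhalf (\<lambda>t. ?h t / (z - 1)) = 0"
    using hh ig by (subst Bochner_Integration.integral_diff[symmetric]) (auto simp: has_bochner_integral_iff)
  hence "integral\<^sup>L lhalf ?g = Gamma z / (z - 1)"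
    using hh by (simp add: has_bochner_integral_iff)
  also have "\<dots> = Gamma (z - 1)"
  proof -
    have "z - 1 \<notin> \<int>\<^sub>\<le>\<^sub>0"
    proof
      assume "z - 1 \<in> \<int>\<^sub>\<le>\<^sub>0"
      then obtain n where n: "z - 1 = of_int n" by (auto elim!: nonpos_Ints_cases)
      hence "z = of_int (n + 1)" by (simp add: algebra_simps)
      hence "0 < real_of_int (n + 1)" "real_of_int (n + 1) < 1" using z by simp_all
      hence "0 < n + 1" "n + 1 < 1" by (simp_all only: of_int_0_less_iff of_int_less_1_iff)
      thus False by simp
    qed
    from Gamma_plus1[OF this] show ?thesis using z1 by simp
  qed
  finally show ?thesis using ig by (simp add: has_bochner_integral_iff)
qed

text \<open>Passing from \<open>bose_cut\<close> back to \<open>bose\<close> adds the integral of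
  \<open>(exp (- t) - 1) / t\<close>, and the two values \<open>Gamma (z - 1)\<close>
  cancel.\<close>

theorem zeta_Mellin_strip:
  assumes z: "0 < Re z" "Re z < 1"
  shows "(LINT t|lhalf. of_real t powr (z - 1) * complex_of_real (bose t)) = Gamma z * zeta z"
proof -
  have z1: "z \<noteq> 1" using z by auto
  have "(LINT t|lhalf. of_real t powr (z - 1) * complex_of_real (bose t)) =
     (LINT t|lhalf. of_real t powr (z - 1) * complex_of_real (bose_cut t) + of_real t powr (z - 1) * complex_of_real ((exp (- t) - 1) / t))"
    by (intro Bochner_Integration.integral_cong) (auto simp: bose_cut_eq(2) ring_distribs)
  also have "\<dots> = (Gamma z * zeta z - Gamma (z - 1)) + Gamma (z - 1)"
    using integrable_bose_cut[OF z(1)] bose_cut_Mellin[OF z(1) z1] Gamma_shifted_integral[OF z]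
    by (subst Bochner_Integration.integral_add) (auto simp: has_bochner_integral_iff)
  finally show ?thesis by simp
qed

text \<open>The transform of the shifted function \<open>bose (t + \<epsilon>)\<close> is, up to
  \<open>Gamma z\<close>, the regularised Dirichlet series minus its divergent part. Dominated
  convergence carries it to the transform of \<open>bose\<close>.\<close>

theorem zeta_Abel_limit:
  assumes z: "0 < Re z" "Re z < 1"
  shows "((\<lambda>\<epsilon>. (\<Sum>n. of_nat (Suc n) powr (- z) * of_real (exp (- (real (Suc n) * \<epsilon>)))) -
     Gamma (1 - z) * of_real \<epsilon> powr (z - 1)) \<longlongrightarrow> zeta z) (at_right 0)"
  unfolding tendsto_at_iff_sequentially o_def
proof (intro allI impI)
  fix X :: "nat \<Rightarrow> real" assume X: "\<forall>i. X i \<in> {0<..} - {0}" "X \<longlonglongrightarrow> 0"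
  hence Xp: "X i > 0" for i by auto
  let ?f = "\<lambda>e t. of_real t powr (z - 1) * complex_of_real (bose (t + e))"
  let ?S = "\<lambda>e. \<Sum>n. of_nat (Suc n) powr (- z) * complex_of_real (exp (- (real (Suc n) * e)))"
  have G0: "Gamma z \<noteq> 0" using z by (intro Gamma_neq_0)
  have val: "integral\<^sup>L lhalf (?f e) = Gamma z * (?S e - Gamma (1 - z) * of_real e powr (z - 1))" if e: "e > 0" for e
  proof -
    have A: "has_bochner_integral lhalf (\<lambda>t. of_real t powr (z - 1) * of_real (1 / (exp (t + e) - 1))) (Gamma z * ?S e)"
      using z e by (intro Mellin_Bose) auto
    \<comment> \<open>The shifted pole \<open>1 / (t + e)\<close> is a Beta integral with
      \<open>b = 1\<close>; it produces the divergent part.\<close>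
    have B: "has_bochner_integral lhalf (\<lambda>t. of_real t powr (z - 1) * (of_real e + of_real t) powr (- 1)) (Gamma z * Gamma (1 - z) / Gamma 1 * of_real e powr (z - 1))"
      using z e by (intro has_bochner_integral_Beta_prime) auto
    have "of_real t powr (z - 1) * of_real (1 / (exp (t + e) - 1)) - of_real t powr (z - 1) * (of_real e + of_real t) powr (- 1) = ?f e t"
      if "t > 0" for t
    proof -
      have "(complex_of_real e + of_real t) powr (- 1) = of_real (1 / (t + e))"
        using that e by (simp add: powr_minus add.commute divide_inverse flip: of_real_add)
      thus ?thesis by (simp add: bose_def algebra_simps)
    qed
    hence "integral\<^sup>L lhalf (?f e) = (LINT t|lhalf. of_real t powr (z - 1) * of_real (1 / (exp (t + e) - 1)) - of_real t powr (z - 1) * (of_real e + of_real t) powr (- 1))"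
      by (intro Bochner_Integration.integral_cong) auto
    also have "\<dots> = Gamma z * ?S e - Gamma z * Gamma (1 - z) / Gamma 1 * of_real e powr (z - 1)"
      using A B by (subst Bochner_Integration.integral_diff) (auto simp: has_bochner_integral_iff)
    finally show ?thesis by (simp add: algebra_simps)
  qed
  have "(\<lambda>i. integral\<^sup>L lhalf (?f (X i))) \<longlonglongrightarrow> integral\<^sup>L lhalf (\<lambda>t. of_real t powr (z - 1) * complex_of_real (bose t))"
  proof (rule integral_dominated_convergence)
    show "integrable lhalf (\<lambda>t. t powr (Re z - 1) * (2 / (1 + t)))" by (rule integrable_powr_frac[OF z])
    show "?f (X i) \<in> borel_measurable lhalf" for i
      by (intro measurable_powr_times continuous_on_compose2[OF continuous_bose] continuous_intros)
        (use Xp[of i] in auto)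
    show "(\<lambda>t. of_real t powr (z - 1) * complex_of_real (bose t)) \<in> borel_measurable lhalf"
      by (intro measurable_powr_times continuous_bose)
    show "AE t in lhalf. (\<lambda>i. ?f (X i) t) \<longlonglongrightarrow> of_real t powr (z - 1) * complex_of_real (bose t)"
    proof (rule AE_I2)
      fix t assume "t \<in> space lhalf"
      hence t: "t > 0" by simp
      have c: "isCont bose t" using continuous_bose t by (simp add: continuous_on_eq_continuous_at)
      have "(\<lambda>i. t + X i) \<longlonglongrightarrow> t + 0" by (intro tendsto_intros X)
      hence "(\<lambda>i. bose (t + X i)) \<longlonglongrightarrow> bose t" using isCont_tendsto_compose[OF c] by simp
      thus "(\<lambda>i. ?f (X i) t) \<longlonglongrightarrow> of_real t powr (z - 1) * complex_of_real (bose t)"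
        by (intro tendsto_intros)
    qed
    show "AE t in lhalf. norm (?f (X i) t) \<le> t powr (Re z - 1) * (2 / (1 + t))" for i
    proof (rule AE_I2)
      fix t assume "t \<in> space lhalf"
      hence t: "t > 0" by simp
      have "\<bar>bose (t + X i)\<bar> \<le> 2 / (1 + (t + X i))" using t Xp[of i] by (intro abs_bose_le) simp
      also have "\<dots> \<le> 2 / (1 + t)" using t Xp[of i] by (intro divide_left_mono mult_pos_pos) auto
      finally have "t powr (Re z - 1) * \<bar>bose (t + X i)\<bar> \<le> t powr (Re z - 1) * (2 / (1 + t))"
        by (intro mult_left_mono) auto
      thus "norm (?f (X i) t) \<le> t powr (Re z - 1) * (2 / (1 + t))"
        using t by (simp add: norm_mult norm_powr_of_real)
    qed
  qed
  hence "(\<lambda>i. Gamma z * (?S (X i) - Gamma (1 - z) * of_real (X i) powr (z - 1)) / Gamma z) \<longlonglongrightarrow> Gamma z * zeta z / Gamma z"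
    unfolding val[OF Xp] zeta_Mellin_strip[OF z] by (intro tendsto_divide tendsto_const G0)
  thus "(\<lambda>i. ?S (X i) - Gamma (1 - z) * of_real (X i) powr (z - 1)) \<longlonglongrightarrow> zeta z"
    using G0 by simp
qed

section \<open>The Lipschitz summation formula\<close>

text \<open>Termwise integration under a majorant of product form, \<open>B\<close> in the index and
  \<open>G\<close> in the variable.\<close>

lemma has_bochner_integral_sums:
  fixes f :: "nat \<Rightarrow> 'a \<Rightarrow> complex"
  assumes hb: "\<And>n. has_bochner_integral M (f n) (I n)"
    and sums: "\<And>t. t \<in> space M \<Longrightarrow> (\<lambda>n. f n t) sums g t"
    and bound: "\<And>n t. t \<in> space M \<Longrightarrow> norm (f n t) \<le> B n * G t"
    and G: "integrable M G" and B: "summable B"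
  shows "has_bochner_integral M g (\<Sum>n. I n)" and "summable I"
proof -
  have int: "integrable M (f n)" for n using hb by (simp add: has_bochner_integral_iff)
  have AE: "AE t in M. summable (\<lambda>n. norm (f n t))"
  proof (rule AE_I2)
    fix t assume t: "t \<in> space M"
    show "summable (\<lambda>n. norm (f n t))"
      by (rule summable_comparison_test'[OF summable_mult2[OF B, of "G t"]]) (use bound[OF t] in simp)
  qed
  have sm: "summable (\<lambda>n. integral\<^sup>L M (\<lambda>t. norm (f n t)))"
  proof (rule summable_comparison_test'[OF summable_mult2[OF B, of "integral\<^sup>L M G"]])
    fix n
    have "norm (integral\<^sup>L M (\<lambda>t. norm (f n t))) = integral\<^sup>L M (\<lambda>t. norm (f n t))" by simp
    also have "\<dots> \<le> integral\<^sup>L M (\<lambda>t. B n * G t)"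
      using int bound G by (intro integral_mono) auto
    finally show "norm (integral\<^sup>L M (\<lambda>t. norm (f n t))) \<le> B n * integral\<^sup>L M G" by simp
  qed
  note * = int AE sm
  have I: "integral\<^sup>L M (f n) = I n" for n using hb by (simp add: has_bochner_integral_iff)
  have g: "(\<Sum>n. f n t) = g t" if "t \<in> space M" for t using sums[OF that] by (simp add: sums_iff)
  show "summable I" using summable_integral[OF *] by (simp only: I)
  have "integrable M g"
    using integrable_suminf[OF *] by (rule Bochner_Integration.integrable_cong[THEN iffD1, OF refl g, rotated])
  moreover have "integral\<^sup>L M g = (\<Sum>n. I n)"
    using integral_suminf[OF *] g by (simp add: I cong: Bochner_Integration.integral_cong)
  ultimately show "has_bochner_integral M g (\<Sum>n. I n)" by (simp add: has_bochner_integral_iff)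
qed

lemma exp_two_pi_Suc: "exp (- (2 * pi * real (Suc n) * x)) = exp (- (2 * pi * x)) * exp (- (2 * pi * x)) ^ n"
proof -
  have "exp (- (2 * pi * real (Suc n) * x)) = exp (real (Suc n) * - (2 * pi * x))" by (simp add: algebra_simps)
  also have "\<dots> = exp (- (2 * pi * x)) ^ Suc n" by (rule exp_of_nat_mult)
  finally show ?thesis by simp
qed

lemma summable_powr_exp:
  assumes "a \<le> 1" "v > 0"
  shows "summable (\<lambda>n. real (Suc n) powr a * exp (- (2 * pi * real (Suc n) * v)))"
proof (rule summable_comparison_test')
  define q where "q = exp (- (2 * pi * v))"
  have q: "0 < q" "q < 1" using assms by (simp_all add: q_def)
  show "summable (\<lambda>n. real (Suc n) * exp (- (2 * pi * real (Suc n) * v)))"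
    unfolding exp_two_pi_Suc q_def[symmetric]
    using q geometric_deriv_sums[of q] summable_mult[of "\<lambda>n. real (Suc n) * q ^ n" q]
    by (simp add: sums_iff mult_ac del: of_nat_Suc)
  show "norm (real (Suc n) powr a * exp (- (2 * pi * real (Suc n) * v))) \<le> real (Suc n) * exp (- (2 * pi * real (Suc n) * v))" for n
    using powr_mono[of a 1 "real (Suc n)"] assms by (simp add: mult_right_mono del: of_nat_Suc)
qed

section \<open>Exponent 2: the partial fractions of the squared cosecant\<close>

lemma one_minus_notin_Ints: "z \<notin> \<int> \<Longrightarrow> 1 - z \<notin> (\<int> :: complex set)"
  using Ints_diff[of 1 "1 - z"] by auto

text \<open>The product \<open>Gamma z * Gamma (1 - z) * sin (of_real pi * z)\<close> is constant
  off the integers. Its logarithmic derivative gives the reflection formula \<open>psi\<close> for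
  \<open>Digamma\<close>, and differentiating \<open>psi\<close> once more gives the claim.\<close>

lemma Polygamma_reflection:
  fixes z :: complex
  assumes z: "z \<notin> \<int>"
  shows "(Polygamma 1 z + Polygamma 1 (1 - z)) * (sin (of_real pi * z))\<^sup>2 = (of_real pi)\<^sup>2"
proof -
  have o: "open (- \<int> :: complex set)" by (intro open_Compl closed_Ints)
  have np: "z \<notin> \<int>\<^sub>\<le>\<^sub>0" "1 - z \<notin> \<int>\<^sub>\<le>\<^sub>0" if "z \<notin> \<int>" for z :: complex
    using that one_minus_notin_Ints[OF that] by (auto dest: nonpos_Ints_Int)
  have psi: "(Digamma z - Digamma (1 - z)) * sin (of_real pi * z) + of_real pi * cos (of_real pi * z) = 0"
    if z: "z \<notin> \<int>" for z :: complex
  proof -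
    let ?D = "Gamma z * Gamma (1 - z) * ((Digamma z - Digamma (1 - z)) * sin (of_real pi * z) + of_real pi * cos (of_real pi * z))"
    have D: "((\<lambda>z. Gamma z * Gamma (1 - z) * sin (of_real pi * z)) has_field_derivative ?D) (at z)"
      using np[OF z] by (auto intro!: derivative_eq_intros simp: algebra_simps)
    have "((\<lambda>z. Gamma z * Gamma (1 - z) * sin (of_real pi * z)) has_field_derivative 0) (at z)"
    proof (rule has_field_derivative_transform_within_open[OF DERIV_const o])
      fix w :: complex assume "w \<in> - \<int>"
      hence "sin (of_real pi * w) \<noteq> 0" by (auto simp: sin_eq_0)
      thus "of_real pi = Gamma w * Gamma (1 - w) * sin (of_real pi * w)"
        by (simp add: Gamma_reflection_complex)
    qed (use z in auto)
    from DERIV_unique[OF D this] show ?thesis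
      using np[OF z] by (simp add: Gamma_eq_zero_iff)
  qed
  let ?s = "sin (of_real pi * z)" and ?c = "cos (of_real pi * z)"
  let ?D = "(Polygamma 1 z + Polygamma 1 (1 - z)) * ?s + (Digamma z - Digamma (1 - z)) * (of_real pi * ?c) - of_real pi * of_real pi * ?s"
  have D: "((\<lambda>z. (Digamma z - Digamma (1 - z)) * sin (of_real pi * z) + of_real pi * cos (of_real pi * z)) has_field_derivative ?D) (at z)"
    using np[OF z] by (auto intro!: derivative_eq_intros simp: algebra_simps)
  have "((\<lambda>z. (Digamma z - Digamma (1 - z)) * sin (of_real pi * z) + of_real pi * cos (of_real pi * z)) has_field_derivative 0) (at z)"
    by (rule has_field_derivative_transform_within_open[OF DERIV_const[of 0] o]) (use z psi in auto)
  \<comment> \<open>The extra sine factor allows \<open>psi\<close> to replace the difference of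
    \<open>Digamma\<close> values by a cosine.\<close>
  from DERIV_unique[OF D this] have "?D * ?s = 0" by simp
  hence "(Polygamma 1 z + Polygamma 1 (1 - z)) * ?s\<^sup>2 = - ((Digamma z - Digamma (1 - z)) * ?s) * (of_real pi * ?c) + of_real pi * of_real pi * ?s\<^sup>2"
    by (simp add: algebra_simps power2_eq_square)
  also have "- ((Digamma z - Digamma (1 - z)) * ?s) = of_real pi * ?c"
    using psi[OF z] by (simp add: add_eq_0_iff)
  also have "of_real pi * ?c * (of_real pi * ?c) + of_real pi * of_real pi * ?s\<^sup>2 = (of_real pi)\<^sup>2 * (?s\<^sup>2 + ?c\<^sup>2)"
    by (simp only: power2_eq_square ring_distribs mult_ac add_ac)
  finally show ?thesis by (simp only: sin_cos_squared_add mult_1_right)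
qed

lemma sin_i_times_of_real: "sin (\<i> * of_real y) = \<i> * complex_of_real (sinh y)"
proof -
  have "\<i> * (\<i> * of_real y) = complex_of_real (- y)" by simp
  hence "sin (\<i> * of_real y) = (exp (complex_of_real (- y)) - exp (of_real y)) / (2 * \<i>)"
    unfolding sin_exp_eq by (simp only: of_real_minus minus_minus)
  also have "\<dots> = (of_real (exp (- y)) - of_real (exp y)) / (2 * \<i>)" by (simp only: exp_of_real)
  also have "\<dots> = \<i> * complex_of_real (sinh y)" by (simp add: sinh_field_def field_simps)
  finally show ?thesis .
qed

text \<open>The reflection formula at \<open>z = \<i> * x\<close>. The series at
  \<open>1 - z\<close> runs over the positive integers and that at \<open>z\<close> over the
  negative ones; the latter also contains the index 0, which moves to the right side as
  \<open>1 / x\<^sup>2\<close>.\<close>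

lemma sum_inverse_squares:
  fixes x :: real
  assumes x: "x > 0"
  shows "(\<lambda>k. 1 / (of_real x + \<i> * of_nat (Suc k))\<^sup>2 + 1 / (of_real x - \<i> * of_nat (Suc k))\<^sup>2) sums
    (of_real ((2 * pi)\<^sup>2 * (\<Sum>n. real (Suc n) * exp (- (2 * pi * real (Suc n) * x)))) - 1 / (complex_of_real x)\<^sup>2)"
proof -
  define z where "z = \<i> * complex_of_real x"
  have z: "z \<notin> \<int>" using x by (auto simp: z_def elim!: Ints_cases simp: complex_eq_iff)
  have z0: "z \<noteq> 0" "1 - z \<noteq> 0" using x by (auto simp: z_def complex_eq_iff)
  have P: "Polygamma 1 w = (\<Sum>k. inverse ((w + of_nat k)\<^sup>2))" for w :: complex
    by (simp add: Polygamma_def numeral_2_eq_2)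
  have s: "(\<lambda>k. inverse ((w + of_nat k)\<^sup>2)) sums Polygamma 1 w" if "w \<noteq> 0" for w :: complex
    unfolding P using Polygamma_converges'[OF that, of 2] by (intro summable_sums) simp
  have "(\<lambda>k. inverse ((z + of_nat (Suc k))\<^sup>2)) sums (Polygamma 1 z - inverse (z\<^sup>2))"
    using s[OF z0(1)] sums_Suc_iff[of "\<lambda>k. inverse ((z + of_nat k)\<^sup>2)"] by simp
  from sums_add[OF s[OF z0(2)] this]
  have "(\<lambda>k. - (inverse ((1 - z + of_nat k)\<^sup>2) + inverse ((z + of_nat (Suc k))\<^sup>2))) sums - (Polygamma 1 (1 - z) + (Polygamma 1 z - inverse (z\<^sup>2)))"
    by (rule sums_minus)
  moreover have "- (inverse ((1 - z + of_nat k)\<^sup>2) + inverse ((z + of_nat (Suc k))\<^sup>2)) =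
      1 / (of_real x + \<i> * of_nat (Suc k))\<^sup>2 + 1 / (of_real x - \<i> * of_nat (Suc k))\<^sup>2" for k
  proof -
    have a: "1 - z + of_nat k = - \<i> * (of_real x + \<i> * of_nat (Suc k))"
      and b: "z + of_nat (Suc k) = \<i> * (of_real x - \<i> * of_nat (Suc k))"
      by (simp_all add: z_def algebra_simps)
    show ?thesis unfolding a b power_mult_distrib by (simp add: divide_inverse)
  qed
  moreover have "- (Polygamma 1 (1 - z) + (Polygamma 1 z - inverse (z\<^sup>2))) =
    of_real ((2 * pi)\<^sup>2 * (\<Sum>n. real (Suc n) * exp (- (2 * pi * real (Suc n) * x)))) - 1 / (complex_of_real x)\<^sup>2"
  proof -
    define q where "q = exp (- (2 * pi * x))"
    have q: "0 < q" "q < 1" using x by (simp_all add: q_def)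
    have "(\<lambda>n. q * (real (Suc n) * q ^ n)) sums (q * (1 / (1 - q)\<^sup>2))"
      using q geometric_deriv_sums[of q] by (intro sums_mult) simp
    moreover have "q * (real (Suc n) * q ^ n) = real (Suc n) * exp (- (2 * pi * real (Suc n) * x))" for n
      unfolding exp_two_pi_Suc q_def by simp
    ultimately have "(\<lambda>n. real (Suc n) * exp (- (2 * pi * real (Suc n) * x))) sums (q * (1 / (1 - q)\<^sup>2))"
      by (simp only:)
    hence S: "(\<Sum>n. real (Suc n) * exp (- (2 * pi * real (Suc n) * x))) = q / (1 - q)\<^sup>2"
      using sums_unique[symmetric] by fastforce
    define e where "e = exp (pi * x)"
    have e: "e > 0" "q = 1 / e\<^sup>2" by (simp_all add: e_def q_def exp_minus divide_inverse flip: exp_double)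
    have "of_real pi * z = \<i> * of_real (pi * x)" by (simp add: z_def)
    hence "sin (of_real pi * z) = \<i> * of_real (sinh (pi * x))"
      by (simp only: sin_i_times_of_real)
    hence s2: "(sin (of_real pi * z))\<^sup>2 = - of_real ((sinh (pi * x))\<^sup>2)" by (simp add: power_mult_distrib)
    have sh: "sinh (pi * x) = (e - 1 / e) / 2" by (simp add: sinh_field_def e_def exp_minus field_simps)
    have "e > 1" using x by (simp add: e_def)
    hence e1: "e\<^sup>2 \<noteq> 1" by (simp add: power2_eq_1_iff)
    have sh0: "sinh (pi * x) \<noteq> 0" using x by simp
    have "Polygamma 1 z + Polygamma 1 (1 - z) = - of_real (pi\<^sup>2 / (sinh (pi * x))\<^sup>2)"
    proof -
      have gen: "A = - (P / W)" if "A * - W = P" "W \<noteq> 0" for A P W :: complex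
        using that by auto
      show ?thesis unfolding of_real_divide
      proof (rule gen)
        show "(Polygamma 1 z + Polygamma 1 (1 - z)) * - of_real ((sinh (pi * x))\<^sup>2) = of_real (pi\<^sup>2)"
          using Polygamma_reflection[OF z] unfolding s2 by simp
      qed (use sh0 in simp)
    qed
    \<comment> \<open>With \<open>q = exp (- (2 * pi * x))\<close> the squared hyperbolic cosecant
      is \<open>4 * q / (1 - q)\<^sup>2\<close>, the derivative of a geometric series.\<close>
    also have "pi\<^sup>2 / (sinh (pi * x))\<^sup>2 = (2 * pi)\<^sup>2 * (q / (1 - q)\<^sup>2)"
      unfolding sh e(2) using e(1) e1 by (simp add: divide_simps) (simp add: power2_eq_square algebra_simps)
    finally have h1: "Polygamma 1 z + Polygamma 1 (1 - z) = - of_real ((2 * pi)\<^sup>2 * (q / (1 - q)\<^sup>2))" .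
    have h2: "inverse (z\<^sup>2) = - (1 / (complex_of_real x)\<^sup>2)"
      by (simp add: z_def power_mult_distrib field_simps)
    have h3: "- (B + (A - I)) = - (A + B) + I" for A B I :: complex by simp
    show ?thesis unfolding S h3 h1 h2 by simp
  qed
  ultimately show ?thesis by (simp only:)
qed


text \<open>Fractional integration of the case \<open>w = 2\<close>: since \<open>\<integral> t\<^sup>a\<^sup>-\<^sup>1 (c + t)\<^sup>-\<^sup>2 dt\<close> is a multiple of \<open>c\<^sup>a\<^sup>-\<^sup>2\<close>,
  integrating against \<open>t\<^sup>1\<^sup>-\<^sup>w\<close> turns the exponent 2 into \<open>w\<close>.\<close>

theorem Lipschitz_formula:
  fixes v :: real
  assumes w: "1 < Re w" "Re w < 2" and v: "v > 0"
  shows "(\<lambda>k. (of_real v + \<i> * of_nat (Suc k)) powr (- w) + (of_real v - \<i> * of_nat (Suc k)) powr (- w)) sums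
    (of_real (2 * pi) powr w / Gamma w * (\<Sum>n. of_nat (Suc n) powr (w - 1) * of_real (exp (- (2 * pi * real (Suc n) * v)))) -
     of_real v powr (- w))"
    and "summable (\<lambda>n. complex_of_nat (Suc n) powr (w - 1) * of_real (exp (- (2 * pi * real (Suc n) * v))))"
proof -
  define a where "a = 2 - w"
  have a: "0 < Re a" "Re a < 1" using w by (simp_all add: a_def)
  \<comment> \<open>Any exponent strictly between \<open>Re a\<close> and 1 would do: above
    \<open>Re a\<close> makes the integral in \<open>t\<close> converge, below 1 makes the sum over
    \<open>k\<close> converge.\<close>
  define \<theta> where "\<theta> = (Re a + 1) / 2"
  have \<theta>: "Re a < \<theta>" "\<theta> < 1" "\<theta> > 0" using a by (simp_all add: \<theta>_def)
  define c where "c k = of_real v + \<i> * of_nat (Suc k)" for k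
  define c' where "c' k = of_real v - \<i> * of_nat (Suc k)" for k
  let ?p = "\<lambda>t. complex_of_real t powr (a - 1)"
  let ?L = "\<lambda>k t. ?p t * (c k + of_real t) powr (- 2) + ?p t * (c' k + of_real t) powr (- 2)"
  let ?R = "\<lambda>n t. of_real ((2 * pi)\<^sup>2 * real (Suc n) * exp (- (2 * pi * real (Suc n) * v))) *
      (?p t * exp (- (of_real (2 * pi * real (Suc n)) * of_real t)))"
  have pow2: "u powr (- 2) = 1 / u\<^sup>2" if "u \<noteq> 0" for u :: complex
    using that by (simp add: powr_minus inverse_eq_divide)
  have nz: "c k + of_real t \<noteq> 0" "c' k + of_real t \<noteq> 0" if "t \<ge> 0" for k t
    using v that by (auto simp: c_def c'_def complex_eq_iff)
  have Gw: "Gamma w \<noteq> 0" "Gamma a \<noteq> 0" using w a by (auto intro!: Gamma_neq_0)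
  have aw: "2 - a = w" "a - 2 = - w" by (simp_all add: a_def)
  have hbL: "has_bochner_integral lhalf (?L k) (Gamma a * Gamma w * (c k powr (- w) + c' k powr (- w)))" for k
  proof -
    have "has_bochner_integral lhalf (\<lambda>t. ?p t * (u + of_real t) powr (- 2)) (Gamma a * Gamma w * u powr (- w))" if "Re u > 0" for u
      using has_bochner_integral_Beta_prime[of a 2 u] a that by (simp add: aw Gamma_numeral)
    from has_bochner_integral_add[OF this[of "c k"] this[of "c' k"]] v
    show ?thesis by (simp add: c_def c'_def ring_distribs)
  qed
  have sumL: "(\<lambda>k. ?L k t) sums (?p t * (of_real ((2 * pi)\<^sup>2 * (\<Sum>n. real (Suc n) * exp (- (2 * pi * real (Suc n) * (v + t))))) - 1 / (of_real (v + t))\<^sup>2))"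
    if t: "t \<in> space lhalf" for t
  proof -
    have "v + t > 0" using t v by simp
    from sums_mult[OF sum_inverse_squares[OF this], of "?p t"]
    show ?thesis using nz[of t] t by (simp add: pow2 c_def c'_def ring_distribs add_ac add_diff_eq diff_add_eq)
  qed
  have bndL: "norm (?L k t) \<le> (2 * real (Suc k) powr (\<theta> - 2)) * (t powr (Re a - 1) * (v + t) powr (- \<theta>))"
    if "t \<in> space lhalf" for k t
  proof -
    have t: "t > 0" using that by simp
    let ?y = "v + t" and ?d = "real (Suc k)"
    have y: "?y > 0" using t v by simp
    \<comment> \<open>Interpolation between the two summands of the denominator splits the bound
      into a factor in \<open>k\<close> and a factor in \<open>t\<close>.\<close>
    have "?y powr \<theta> * ?d powr (2 - \<theta>) \<le> max ?y ?d powr \<theta> * max ?y ?d powr (2 - \<theta>)"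
      using y \<theta> by (intro mult_mono powr_mono2) auto
    also have "\<dots> = (max ?y ?d)\<^sup>2" using y powr_realpow[of "max ?y ?d" 2] by (simp flip: powr_add)
    also have "\<dots> \<le> ?y\<^sup>2 + ?d\<^sup>2" by (auto simp: max_def)
    finally have le: "?y powr \<theta> * ?d powr (2 - \<theta>) \<le> ?y\<^sup>2 + ?d\<^sup>2" .
    have "1 / (?y\<^sup>2 + ?d\<^sup>2) \<le> 1 / (?y powr \<theta> * ?d powr (2 - \<theta>))"
      using y by (intro divide_left_mono le mult_pos_pos) (auto intro: add_nonneg_pos)
    also have "\<dots> = ?y powr (- \<theta>) * ?d powr (\<theta> - 2)"
    proof -
      have *: "?d powr (\<theta> - 2) = inverse (?d powr (2 - \<theta>))" using powr_minus[of ?d "2 - \<theta>"] by (simp only: minus_diff_eq)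
      show ?thesis unfolding powr_minus * by (simp add: inverse_eq_divide)
    qed
    finally have B: "1 / (?y\<^sup>2 + ?d\<^sup>2) \<le> ?y powr (- \<theta>) * ?d powr (\<theta> - 2)" .
    have n: "norm ((u + of_real t) powr (- 2)) = 1 / (?y\<^sup>2 + ?d\<^sup>2)" if "u = c k \<or> u = c' k" for u
    proof -
      have "u + of_real t \<noteq> 0" using nz[of t k] t that by auto
      moreover have "(norm (u + of_real t))\<^sup>2 = ?y\<^sup>2 + ?d\<^sup>2"
      proof -
        have "Re u = v" "Im u = ?d \<or> Im u = - ?d" using that by (auto simp: c_def c'_def)
        moreover from this(2) have "(Im u)\<^sup>2 = ?d\<^sup>2" by (elim disjE) (simp_all only: power2_minus)
        ultimately show ?thesis unfolding cmod_power2 by (simp add: add.commute)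
      qed
      ultimately show ?thesis by (simp add: pow2 norm_divide norm_power)
    qed
    have "norm (?L k t) \<le> norm (?p t) * norm ((c k + of_real t) powr (- 2)) + norm (?p t) * norm ((c' k + of_real t) powr (- 2))"
      using norm_triangle_ineq by (simp only: norm_mult[symmetric])
    also have "\<dots> = 2 * (t powr (Re a - 1) * (1 / (?y\<^sup>2 + ?d\<^sup>2)))"
      unfolding n[of "c k", OF disjI1[OF refl]] n[of "c' k", OF disjI2[OF refl]] using t by (simp add: norm_powr_of_real)
    also have "\<dots> \<le> 2 * (t powr (Re a - 1) * (?y powr (- \<theta>) * ?d powr (\<theta> - 2)))"
      using B by (intro mult_left_mono) auto
    finally show ?thesis by (simp only: mult_ac)
  qed
  have intL: "integrable lhalf (\<lambda>t. t powr (Re a - 1) * (v + t) powr (- \<theta>))"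
  proof -
    have "integrable lhalf (\<lambda>t. norm (complex_of_real t powr (of_real (Re a) - 1) * (of_real v + of_real t) powr (- of_real \<theta>)))"
      using has_bochner_integral_Beta_prime[of "of_real (Re a)" "of_real \<theta>" "of_real v"] a \<theta> v
      by (intro integrable_norm) (auto simp: has_bochner_integral_iff)
    thus ?thesis
    proof (rule Bochner_Integration.integrable_cong[THEN iffD1, OF refl, rotated])
      fix t assume "t \<in> space lhalf"
      hence "t > 0" "v + t > 0" using v by auto
      thus "norm (complex_of_real t powr (of_real (Re a) - 1) * (of_real v + of_real t) powr (- of_real \<theta>)) = t powr (Re a - 1) * (v + t) powr (- \<theta>)"
        using norm_powr_of_real[of "v + t" "- of_real \<theta>"] by (simp add: norm_mult norm_powr_of_real)
    qed
  qed
  have smL: "summable (\<lambda>k. 2 * real (Suc k) powr (\<theta> - 2))"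
    using \<theta> by (intro summable_mult summable_Suc_powr) simp
  note L = has_bochner_integral_sums[OF hbL sumL bndL intL smL]

  define C where "C n = of_nat (Suc n) powr (w - 1) * complex_of_real (exp (- (2 * pi * real (Suc n) * v)))" for n
  have hbR: "has_bochner_integral lhalf (?R n) (Gamma a * of_real (2 * pi) powr w * C n)" for n
  proof -
    let ?m = "real (Suc n)"
    have hb: "has_bochner_integral lhalf (?R n) (of_real ((2 * pi)\<^sup>2 * ?m * exp (- (2 * pi * ?m * v))) * (Gamma a * of_real (2 * pi * ?m) powr (- a)))"
      using a by (intro has_bochner_integral_mult_right has_bochner_integral_Gamma_scaled_real) auto
    have X: "of_real ((2 * pi)\<^sup>2 * ?m) * complex_of_real (2 * pi * ?m) powr (- a) = of_real (2 * pi) powr w * of_nat (Suc n) powr (w - 1)"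
    proof -
      have "complex_of_real (2 * pi * ?m) powr (- a) = of_real (2 * pi) powr (- a) * of_nat (Suc n) powr (- a)"
        using powr_mult_of_real[of "2 * pi" "of_nat (Suc n)" "- a"] by (simp del: of_nat_Suc)
      moreover have "of_real (2 * pi) powr w = complex_of_real (2 * pi) ^ 2 * of_real (2 * pi) powr (- a)"
        using powr_add[of "complex_of_real (2 * pi)" 2 "- a"] by (simp add: a_def)
      moreover have "complex_of_nat (Suc n) powr (w - 1) = of_nat (Suc n) * of_nat (Suc n) powr (- a)"
        using powr_add[of "complex_of_nat (Suc n)" 1 "- a"] by (simp add: a_def algebra_simps del: of_nat_Suc)
      ultimately show ?thesis by (simp add: mult_ac del: of_nat_Suc)
    qed
    have "of_real ((2 * pi)\<^sup>2 * ?m * exp (- (2 * pi * ?m * v))) * (Gamma a * complex_of_real (2 * pi * ?m) powr (- a)) =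
        Gamma a * (of_real ((2 * pi)\<^sup>2 * ?m) * complex_of_real (2 * pi * ?m) powr (- a)) * of_real (exp (- (2 * pi * ?m * v)))"
      by (simp only: of_real_mult mult_ac)
    also have "\<dots> = Gamma a * of_real (2 * pi) powr w * C n"
      unfolding X C_def by (simp only: mult_ac)
    finally show ?thesis using hb by (simp only:)
  qed
  have sumR: "(\<lambda>n. ?R n t) sums (?p t * of_real ((2 * pi)\<^sup>2 * (\<Sum>n. real (Suc n) * exp (- (2 * pi * real (Suc n) * (v + t))))))"
    if t: "t \<in> space lhalf" for t
  proof -
    have "summable (\<lambda>n. real (Suc n) * exp (- (2 * pi * real (Suc n) * (v + t))))"
      using summable_powr_exp[of 1 "v + t"] t v by simp
    hence "(\<lambda>n. ?p t * of_real ((2 * pi)\<^sup>2 * (real (Suc n) * exp (- (2 * pi * real (Suc n) * (v + t)))))) sums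
      (?p t * of_real ((2 * pi)\<^sup>2 * (\<Sum>n. real (Suc n) * exp (- (2 * pi * real (Suc n) * (v + t))))))"
      by (intro sums_mult sums_of_real summable_sums)
    moreover have "?p t * of_real ((2 * pi)\<^sup>2 * (real (Suc n) * exp (- (2 * pi * real (Suc n) * (v + t))))) = ?R n t" for n
      by (simp add: ring_distribs exp_add exp_diff exp_minus exp_of_real[symmetric] divide_inverse mult_ac del: of_nat_Suc)
    ultimately show ?thesis by (simp only:)
  qed
  have bndR: "norm (?R n t) \<le> ((2 * pi)\<^sup>2 * (real (Suc n) * exp (- (2 * pi * real (Suc n) * v)))) * (t powr (Re a - 1) * exp (- (2 * pi * t)))"
    if "t \<in> space lhalf" for n t
  proof -
    have t: "t > 0" using that by simp
    have "2 * pi * t \<le> 2 * pi * real (Suc n) * t" using t by simp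
    hence "norm (?p t * exp (- (of_real (2 * pi * real (Suc n)) * of_real t))) \<le> t powr (Re a - 1) * exp (- (2 * pi * t))"
      using t by (simp add: norm_mult norm_powr_of_real del: of_nat_Suc)
    moreover have "0 \<le> (2 * pi)\<^sup>2 * real (Suc n) * exp (- (2 * pi * real (Suc n) * v))" (is "0 \<le> ?K") by simp
    moreover from this have "norm (?R n t) = ?K * norm (?p t * exp (- (of_real (2 * pi * real (Suc n)) * of_real t)))"
      by (simp only: norm_mult norm_of_real abs_of_nonneg)
    ultimately have "norm (?R n t) \<le> ?K * (t powr (Re a - 1) * exp (- (2 * pi * t)))"
      by (simp only: mult_left_mono)
    thus ?thesis by (simp only: mult_ac)
  qed
  have intR: "integrable lhalf (\<lambda>t. t powr (Re a - 1) * exp (- (2 * pi * t)))"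
    using has_bochner_integral_Gamma_real[of "Re a" "2 * pi"] a by (simp add: has_bochner_integral_iff)
  have smR: "summable (\<lambda>n. (2 * pi)\<^sup>2 * (real (Suc n) * exp (- (2 * pi * real (Suc n) * v))))"
    using summable_powr_exp[of 1 v] v by (intro summable_mult) simp
  note R = has_bochner_integral_sums[OF hbR sumR bndR intR smR]

  have "summable C" using R(2) Gw by (simp add: summable_cmult_iff)
  thus "summable (\<lambda>n. complex_of_nat (Suc n) powr (w - 1) * of_real (exp (- (2 * pi * real (Suc n) * v))))"
    unfolding C_def .
  \<comment> \<open>The term \<open>1 / (v + t)\<^sup>2\<close> of the exponent 2 formula, which
    becomes the subtracted \<open>v powr (- w)\<close>.\<close>
  have V: "has_bochner_integral lhalf (\<lambda>t. ?p t * (of_real v + of_real t) powr (- 2)) (Gamma a * Gamma w * of_real v powr (- w))"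
    using has_bochner_integral_Beta_prime[of a 2 "of_real v"] a v by (simp add: aw Gamma_numeral)
  have "has_bochner_integral lhalf (\<lambda>t. ?p t * of_real ((2 * pi)\<^sup>2 * (\<Sum>n. real (Suc n) * exp (- (2 * pi * real (Suc n) * (v + t))))) - ?p t * (of_real v + of_real t) powr (- 2))
     ((\<Sum>n. Gamma a * of_real (2 * pi) powr w * C n) - Gamma a * Gamma w * of_real v powr (- w))"
    by (rule has_bochner_integral_diff[OF R(1) V])
  moreover have "?p t * of_real ((2 * pi)\<^sup>2 * (\<Sum>n. real (Suc n) * exp (- (2 * pi * real (Suc n) * (v + t))))) - ?p t * (of_real v + of_real t) powr (- 2) =
     ?p t * (of_real ((2 * pi)\<^sup>2 * (\<Sum>n. real (Suc n) * exp (- (2 * pi * real (Suc n) * (v + t))))) - 1 / (of_real (v + t))\<^sup>2)"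
    if "t \<in> space lhalf" for t
  proof -
    have "complex_of_real v + of_real t \<noteq> 0" using that v by (auto simp: complex_eq_iff)
    from pow2[OF this] show ?thesis by (simp add: right_diff_distrib)
  qed
  ultimately have "has_bochner_integral lhalf (\<lambda>t. ?p t * (of_real ((2 * pi)\<^sup>2 * (\<Sum>n. real (Suc n) * exp (- (2 * pi * real (Suc n) * (v + t))))) - 1 / (of_real (v + t))\<^sup>2))
     ((\<Sum>n. Gamma a * of_real (2 * pi) powr w * C n) - Gamma a * Gamma w * of_real v powr (- w))"
    by (subst has_bochner_integral_cong[OF refl _ refl, symmetric]) auto
  \<comment> \<open>Both sides of the exponent 2 formula have been integrated against
    \<open>t powr (a - 1)\<close>; equating the results and cancelling
    \<open>Gamma a * Gamma w\<close> gives the claim.\<close>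
  from has_bochner_integral_eq[OF L(1) this]
  have eq: "(\<Sum>k. Gamma a * Gamma w * (c k powr (- w) + c' k powr (- w))) = Gamma a * of_real (2 * pi) powr w * (\<Sum>n. C n) - Gamma a * Gamma w * of_real v powr (- w)"
    using suminf_mult[OF \<open>summable C\<close>] by simp
  have sm: "summable (\<lambda>k. c k powr (- w) + c' k powr (- w))"
    using L(2) Gw by (simp add: summable_cmult_iff)
  have "Gamma a * Gamma w * (\<Sum>k. c k powr (- w) + c' k powr (- w)) = Gamma a * of_real (2 * pi) powr w * (\<Sum>n. C n) - Gamma a * Gamma w * of_real v powr (- w)"
    using eq unfolding suminf_mult[OF sm] .
  also have "\<dots> = Gamma a * Gamma w * (of_real (2 * pi) powr w / Gamma w * (\<Sum>n. C n) - of_real v powr (- w))"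
    using Gw by (simp add: right_diff_distrib)
  finally have "Gamma a * Gamma w * (\<Sum>k. c k powr (- w) + c' k powr (- w)) = Gamma a * Gamma w * (of_real (2 * pi) powr w / Gamma w * (\<Sum>n. C n) - of_real v powr (- w))" .
  hence "(\<Sum>k. c k powr (- w) + c' k powr (- w)) = of_real (2 * pi) powr w / Gamma w * (\<Sum>n. C n) - of_real v powr (- w)"
    using Gw by (simp only: mult_cancel_left) simp
  with sm show "(\<lambda>k. (of_real v + \<i> * of_nat (Suc k)) powr (- w) + (of_real v - \<i> * of_nat (Suc k)) powr (- w)) sums
    (of_real (2 * pi) powr w / Gamma w * (\<Sum>n. of_nat (Suc n) powr (w - 1) * of_real (exp (- (2 * pi * real (Suc n) * v)))) -
     of_real v powr (- w))"
    unfolding C_def c_def c'_def by (simp only: sums_iff)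
qed

section \<open>The twice integrated Lipschitz formula\<close>

lemma series_has_field_derivative:
  fixes f :: "nat \<Rightarrow> complex \<Rightarrow> complex"
  assumes S: "open S" "convex S"
    and f: "\<And>n u. u \<in> S \<Longrightarrow> (f n has_field_derivative f' n u) (at u)"
    and M: "\<And>n u. u \<in> S \<Longrightarrow> norm (f' n u) \<le> M n" "summable M"
    and u: "u \<in> S" and sm: "summable (\<lambda>n. f n u)"
  shows "((\<lambda>u. \<Sum>n. f n u) has_field_derivative (\<Sum>n. f' n u)) (at u)"
proof (rule has_field_derivative_series'(2)[OF S(2)])
  show "(f n has_field_derivative f' n x) (at x within S)" if "x \<in> S" for n x
    using f[OF that] by (rule has_field_derivative_at_within)
  show "uniformly_convergent_on S (\<lambda>n x. \<Sum>i<n. f' i x)"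
    by (rule Weierstrass_m_test'[OF M])
  show "u \<in> interior S" using u S by (simp add: interior_open)
qed (fact u sm)+

text \<open>\<open>tay s c\<close> is the remainder of \<open>u \<mapsto> (u + c)\<^sup>s\<^sup>-\<^sup>1\<close> after its first order Taylor polynomial at 0, and \<open>tay1\<close>,
  \<open>tay2\<close> are its derivatives. The strip below keeps \<open>u + c\<close> off the branch cut for \<open>c = \<plusminus> i d\<close>, \<open>d \<ge> 1\<close>.\<close>

definition tay :: "complex \<Rightarrow> complex \<Rightarrow> complex \<Rightarrow> complex" where
  "tay s c u = (u + c) powr (s - 1) - c powr (s - 1) - (s - 1) * u * c powr (s - 2)"

definition tay1 :: "complex \<Rightarrow> complex \<Rightarrow> complex \<Rightarrow> complex" where
  "tay1 s c u = (s - 1) * ((u + c) powr (s - 2) - c powr (s - 2))"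

definition tay2 :: "complex \<Rightarrow> complex \<Rightarrow> complex \<Rightarrow> complex" where
  "tay2 s c u = (s - 1) * (s - 2) * (u + c) powr (s - 3)"

definition half_strip :: "complex set" where
  "half_strip = {u. 0 \<le> Re u \<and> - 1/2 \<le> Im u \<and> Im u \<le> 1/2}"

text \<open>In the strip \<open>norm (u + c) \<ge> d / 2\<close>, and the halving costs
  \<open>2 powr (3 - Re s)\<close>; the exponential bounds the effect of the argument for complex
  exponents.\<close>

definition tay_const :: "complex \<Rightarrow> real" where
  "tay_const s = norm ((s - 1) * (s - 2)) * (2 powr (3 - Re s) * exp (pi * \<bar>Im s\<bar>))"

lemma convex_half_strip: "convex half_strip"
proof -
  have eq: "half_strip = {u. Re u \<ge> 0} \<inter> ({u. Im u \<ge> - 1/2} \<inter> {u. Im u \<le> 1/2})"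
    by (auto simp: half_strip_def)
  show ?thesis unfolding eq
    by (intro convex_Int convex_halfspace_Re_ge convex_halfspace_Im_ge convex_halfspace_Im_le)
qed

lemma half_strip_shift:
  assumes u: "u \<in> half_strip" and c: "Re c = 0" "\<bar>Im c\<bar> = d" "d \<ge> 1"
  shows "u + c \<notin> \<real>\<^sub>\<le>\<^sub>0" "u + c \<noteq> 0" "norm (u + c) \<ge> d / 2"
proof -
  have "\<bar>Im (u + c)\<bar> \<ge> d / 2" using u c by (auto simp: half_strip_def abs_if split: if_splits)
  thus "norm (u + c) \<ge> d / 2" using abs_Im_le_cmod[of "u + c"] by linarith
  have "Im (u + c) \<noteq> 0" using \<open>\<bar>Im (u + c)\<bar> \<ge> d / 2\<close> c(3) by auto
  thus "u + c \<notin> \<real>\<^sub>\<le>\<^sub>0" "u + c \<noteq> 0" by (auto simp: complex_nonpos_Reals_iff complex_eq_iff)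
qed

lemma tay_derivs:
  assumes u: "u \<in> half_strip" and c: "Re c = 0" "\<bar>Im c\<bar> = d" "d \<ge> 1"
  shows "(tay s c has_field_derivative tay1 s c u) (at u)" "(tay1 s c has_field_derivative tay2 s c u) (at u)"
proof -
  note h = half_strip_shift[OF u c]
  have e: "s - 1 - 1 = s - 2" "s - 2 - 1 = s - 3" by simp_all
  have "((\<lambda>u. (u + c) powr (s - 1) - c powr (s - 1) - (s - 1) * u * c powr (s - 2)) has_field_derivative
      (s - 1) * (u + c) powr (s - 1 - 1) * (1 + 0) - 0 - (s - 1) * 1 * c powr (s - 2)) (at u)"
    using h(1) by (intro derivative_eq_intros refl) auto
  thus "(tay s c has_field_derivative tay1 s c u) (at u)"
    unfolding tay_def[abs_def] tay1_def e by (simp add: algebra_simps)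
  have "((\<lambda>u. (s - 1) * ((u + c) powr (s - 2) - c powr (s - 2))) has_field_derivative
      (s - 1) * ((s - 2) * (u + c) powr (s - 2 - 1) * (1 + 0) - 0)) (at u)"
    using h(1) by (intro derivative_eq_intros refl) auto
  thus "(tay1 s c has_field_derivative tay2 s c u) (at u)"
    unfolding tay1_def[abs_def] tay2_def e by (simp add: algebra_simps)
qed

lemma norm_tay2_le:
  assumes u: "u \<in> half_strip" and c: "Re c = 0" "\<bar>Im c\<bar> = d" "d \<ge> 1" and s: "Re s < 3"
  shows "norm (tay2 s c u) \<le> tay_const s * d powr (Re s - 3)"
proof -
  note h = half_strip_shift[OF u c]
  have "norm ((u + c) powr (s - 3)) \<le> norm (u + c) powr Re (s - 3) * exp (pi * \<bar>Im (s - 3)\<bar>)"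
    by (rule norm_powr_le_exp[OF h(2)])
  also have "norm (u + c) powr Re (s - 3) \<le> (d / 2) powr Re (s - 3)"
    using h(3) c s by (intro powr_mono2') auto
  also have "(d / 2) powr Re (s - 3) = 2 powr (3 - Re s) * d powr (Re s - 3)"
  proof -
    have "2 powr (Re s - 3) = inverse (2 powr (3 - Re s))" using powr_minus[of 2 "3 - Re s"] by simp
    thus ?thesis by (simp add: powr_divide field_simps)
  qed
  finally have "norm ((u + c) powr (s - 3)) \<le> 2 powr (3 - Re s) * d powr (Re s - 3) * exp (pi * \<bar>Im s\<bar>)" by simp
  from mult_left_mono[OF this, of "norm ((s - 1) * (s - 2))"]
  show ?thesis unfolding tay2_def tay_const_def norm_mult[of "(s - 1) * (s - 2)"] by (simp only: norm_ge_zero mult_ac)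
qed

text \<open>At 0 \<open>tay1\<close> vanishes and \<open>tay\<close> vanishes to second order; on
  the convex strip each integration of the bound for \<open>tay2\<close> contributes one factor
  \<open>norm u\<close>.\<close>

lemma norm_tay_le:
  assumes u: "u \<in> half_strip" and c: "Re c = 0" "\<bar>Im c\<bar> = d" "d \<ge> 1" and s: "Re s < 3"
  shows "norm (tay1 s c u) \<le> tay_const s * d powr (Re s - 3) * norm u"
    and "norm (tay s c u) \<le> tay_const s * d powr (Re s - 3) * (norm u)\<^sup>2"
proof -
  let ?B = "tay_const s * d powr (Re s - 3)"
  have z: "0 \<in> half_strip" by (simp add: half_strip_def)
  have t0: "tay s c 0 = 0" "tay1 s c 0 = 0" by (simp_all add: tay_def tay1_def)
  have "norm (tay1 s c u - tay1 s c 0) \<le> ?B * norm (u - 0)"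
    using norm_tay2_le[OF _ c s] z u
    by (intro field_differentiable_bound[OF convex_half_strip, of _ "tay2 s c"])
      (auto intro!: has_field_derivative_at_within tay_derivs[OF _ c])
  thus "norm (tay1 s c u) \<le> ?B * norm u" by (simp add: t0)
  define f :: "nat \<Rightarrow> complex \<Rightarrow> complex"
    where "f i = (if i = 0 then tay s c else if i = 1 then tay1 s c else tay2 s c)" for i
  have "norm (f 0 u - (\<Sum>i\<le>1. f i 0 * (u - 0) ^ i / fact i)) \<le> ?B * norm (u - 0) ^ Suc 1 / fact 1"
  proof (rule complex_Taylor[OF convex_half_strip])
    show "(f i has_field_derivative f (Suc i) x) (at x within half_strip)" if "x \<in> half_strip" "i \<le> 1" for i x
    proof -
      have "i = 0 \<or> i = 1" using that(2) by auto
      thus ?thesis using tay_derivs[OF that(1) c] by (auto simp: f_def intro: has_field_derivative_at_within)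
    qed
    show "norm (f (Suc 1) x) \<le> ?B" if "x \<in> half_strip" for x
      using norm_tay2_le[OF that c s] by (simp add: f_def)
  qed (use z u in auto)
  thus "norm (tay s c u) \<le> ?B * (norm u)\<^sup>2" by (simp add: t0 f_def power2_eq_square)
qed

text \<open>The function \<open>F d\<close> of the overview.\<close>

definition pair_term :: "complex \<Rightarrow> real \<Rightarrow> complex \<Rightarrow> complex" where
  "pair_term s d u = tay s (\<i> * of_real d) u + tay s (- \<i> * of_real d) u"

lemma norm_pair_term_le:
  assumes "d \<ge> 1" "Re s < 3" "u \<in> half_strip"
  shows "norm (pair_term s d u) \<le> 2 * tay_const s * d powr (Re s - 3) * (norm u)\<^sup>2"
proof -
  have "norm (pair_term s d u) \<le> norm (tay s (\<i> * of_real d) u) + norm (tay s (- \<i> * of_real d) u)"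
    unfolding pair_term_def by (rule norm_triangle_ineq)
  thus ?thesis using norm_tay_le(2)[of u "\<i> * of_real d" d s] norm_tay_le(2)[of u "- \<i> * of_real d" d s] assms by simp
qed

lemma real_in_half_strip: "v \<ge> 0 \<Longrightarrow> complex_of_real v \<in> half_strip"
  by (simp add: half_strip_def)

text \<open>A parameter \<open>T\<close> for \<open>tay\<close>, \<open>tay1\<close> or
  \<open>tay2\<close> covers the sum of all \<open>F d\<close> and its two derivatives at once. In
  the lemmas \<open>T\<close> is coupled with the power \<open>j\<close> of \<open>norm u\<close> in
  its bound.\<close>

definition pair_sum :: "(complex \<Rightarrow> complex \<Rightarrow> complex \<Rightarrow> complex) \<Rightarrow> complex \<Rightarrow> complex \<Rightarrow> complex" where
  "pair_sum T s u = (\<Sum>k. T s (\<i> * of_real (real (Suc k))) u + T s (- \<i> * of_real (real (Suc k))) u)"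

lemma norm_pair_le:
  assumes "Re s < 3" "u \<in> half_strip" and T: "(T, j) \<in> {(tay, 2), (tay1, 1), (tay2, 0)}"
  shows "norm (T s (\<i> * of_real (real (Suc k))) u + T s (- \<i> * of_real (real (Suc k))) u) \<le>
     2 * tay_const s * (norm u) ^ j * real (Suc k) powr (Re s - 3)"
proof -
  have "norm (T s c u) \<le> tay_const s * real (Suc k) powr (Re s - 3) * norm u ^ j"
    if "Re c = 0" "\<bar>Im c\<bar> = real (Suc k)" for c
    using norm_tay2_le[OF assms(2) that _ assms(1)] norm_tay_le[OF assms(2) that _ assms(1)] T by auto
  from this[of "\<i> * of_real (real (Suc k))"] this[of "- \<i> * of_real (real (Suc k))"]
  have "norm (T s (\<i> * of_real (real (Suc k))) u) \<le> tay_const s * real (Suc k) powr (Re s - 3) * norm u ^ j"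
    "norm (T s (- \<i> * of_real (real (Suc k))) u) \<le> tay_const s * real (Suc k) powr (Re s - 3) * norm u ^ j"
    by simp_all
  hence "norm (T s (\<i> * of_real (real (Suc k))) u) + norm (T s (- \<i> * of_real (real (Suc k))) u) \<le>
     2 * (tay_const s * real (Suc k) powr (Re s - 3) * norm u ^ j)" by linarith
  also have "\<dots> = 2 * tay_const s * (norm u) ^ j * real (Suc k) powr (Re s - 3)" by (simp only: mult_ac)
  finally have "norm (T s (\<i> * of_real (real (Suc k))) u) + norm (T s (- \<i> * of_real (real (Suc k))) u) \<le>
     2 * tay_const s * (norm u) ^ j * real (Suc k) powr (Re s - 3)" .
  thus ?thesis by (rule order_trans[OF norm_triangle_ineq])
qed

lemma summable_pair:
  assumes "Re s < 2" "u \<in> half_strip" and T: "(T, j) \<in> {(tay, 2), (tay1, 1), (tay2, 0)}"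
  shows "summable (\<lambda>k. T s (\<i> * of_real (real (Suc k))) u + T s (- \<i> * of_real (real (Suc k))) u)"
    and "norm (pair_sum T s u) \<le> (\<Sum>k. 2 * tay_const s * real (Suc k) powr (Re s - 3)) * norm u ^ j"
proof -
  have sm: "summable (\<lambda>k. 2 * tay_const s * real (Suc k) powr (Re s - 3))"
    using assms by (intro summable_mult summable_Suc_powr) simp
  have b: "norm (T s (\<i> * of_real (real (Suc k))) u + T s (- \<i> * of_real (real (Suc k))) u) \<le>
     2 * tay_const s * real (Suc k) powr (Re s - 3) * norm u ^ j" for k
    using norm_pair_le[OF _ assms(2) T, of s k] assms(1) by (simp add: mult_ac)
  show "summable (\<lambda>k. T s (\<i> * of_real (real (Suc k))) u + T s (- \<i> * of_real (real (Suc k))) u)"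
    by (rule summable_comparison_test'[OF summable_mult2[OF sm, of "norm u ^ j"]]) (use b in auto)
  have "norm (pair_sum T s u) \<le> (\<Sum>k. 2 * tay_const s * real (Suc k) powr (Re s - 3) * norm u ^ j)"
    unfolding pair_sum_def by (rule norm_suminf_le[OF b summable_mult2[OF sm]])
  also have "\<dots> = (\<Sum>k. 2 * tay_const s * real (Suc k) powr (Re s - 3)) * norm u ^ j"
    by (rule suminf_mult2[OF sm, symmetric])
  finally show "norm (pair_sum T s u) \<le> \<dots>" .
qed

lemma pair_sum_derivs:
  assumes s: "Re s < 2" and v: "v > 0"
  shows "(pair_sum tay s has_field_derivative pair_sum tay1 s (of_real v)) (at (of_real v))"
    and "(pair_sum tay1 s has_field_derivative pair_sum tay2 s (of_real v)) (at (of_real v))"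
proof -
  \<comment> \<open>This disc stays inside the half-strip and keeps
    \<open>norm u \<le> 2 * v\<close>, which gives majorants uniform in \<open>u\<close> for
    termwise differentiation.\<close>
  define S where "S = ball (complex_of_real v) (min v (1/2))"
  have S: "open S" "convex S" "of_real v \<in> S" using v by (auto simp: S_def)
  have sub: "S \<subseteq> half_strip" and nS: "norm u \<le> 2 * v" if "u \<in> S" for u
  proof -
    show "S \<subseteq> half_strip"
    proof
      fix u assume "u \<in> S"
      hence "norm (of_real v - u) < v" "norm (of_real v - u) < 1/2" by (auto simp: S_def dist_norm)
      thus "u \<in> half_strip" using abs_Re_le_cmod[of "of_real v - u"] abs_Im_le_cmod[of "of_real v - u"]
        by (auto simp: half_strip_def)
    qed
    have "norm (of_real v - u) < v" using that by (auto simp: S_def dist_norm)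
    thus "norm u \<le> 2 * v" using norm_triangle_ineq4[of "of_real v" "of_real v - u"] v by simp
  qed
  have dv: "((\<lambda>u. T s (\<i> * of_real (real (Suc k))) u + T s (- \<i> * of_real (real (Suc k))) u) has_field_derivative
       T' s (\<i> * of_real (real (Suc k))) u + T' s (- \<i> * of_real (real (Suc k))) u) (at u)"
    if "u \<in> S" "(T, T') \<in> {(tay, tay1), (tay1, tay2)}" for u k T T'
  proof -
    have "(T s c has_field_derivative T' s c u) (at u)" if "Re c = 0" "\<bar>Im c\<bar> = real (Suc k)" for c
      using tay_derivs[OF subsetD[OF sub] that] \<open>u \<in> S\<close> \<open>(T, T') \<in> _\<close> by auto
    thus ?thesis by (intro DERIV_add) simp_all
  qed
  have sm: "summable (\<lambda>k. 2 * tay_const s * (2 * v) ^ j * real (Suc k) powr (Re s - 3))" for j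
    using s by (intro summable_mult summable_Suc_powr) simp
  have tc: "tay_const s \<ge> 0" by (simp add: tay_const_def)
  have b: "norm (T s (\<i> * of_real (real (Suc k))) u + T s (- \<i> * of_real (real (Suc k))) u) \<le>
     2 * tay_const s * (2 * v) ^ j * real (Suc k) powr (Re s - 3)"
    if "u \<in> S" "(T, j) \<in> {(tay1, 1), (tay2, 0)}" for u T j k
  proof -
    have "norm (T s (\<i> * of_real (real (Suc k))) u + T s (- \<i> * of_real (real (Suc k))) u) \<le>
       2 * tay_const s * (norm u) ^ j * real (Suc k) powr (Re s - 3)"
      using that sub s by (intro norm_pair_le) auto
    also have "\<dots> \<le> 2 * tay_const s * (2 * v) ^ j * real (Suc k) powr (Re s - 3)"
      using nS[OF that(1)] tc by (intro mult_right_mono mult_left_mono power_mono) auto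
    finally show ?thesis .
  qed
  have vs: "complex_of_real v \<in> half_strip" using v by (intro real_in_half_strip) simp
  show "(pair_sum tay s has_field_derivative pair_sum tay1 s (of_real v)) (at (of_real v))"
    unfolding pair_sum_def[abs_def]
    by (rule series_has_field_derivative[OF S(1,2) dv b sm S(3) summable_pair(1)[OF s vs]]) auto
  show "(pair_sum tay1 s has_field_derivative pair_sum tay2 s (of_real v)) (at (of_real v))"
    unfolding pair_sum_def[abs_def]
    by (rule series_has_field_derivative[OF S(1,2) dv b sm S(3) summable_pair(1)[OF s vs]]) auto
qed

text \<open>The polylogarithm of order \<open>- a\<close> at
  \<open>exp (- 2 * pi * u)\<close>.\<close>

definition exp_series :: "complex \<Rightarrow> complex \<Rightarrow> complex" where
  "exp_series a u = (\<Sum>n. of_nat (Suc n) powr a * exp (- (of_real (2 * pi * real (Suc n)) * u)))"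

lemma norm_exp_series_term:
  "norm (complex_of_nat (Suc n) powr a * exp (- (of_real (2 * pi * real (Suc n)) * u))) =
    real (Suc n) powr Re a * exp (- (2 * pi * real (Suc n) * Re u))"
  unfolding norm_mult norm_Suc_powr by simp

lemma exp_series_deriv:
  assumes a: "Re a \<le> 0" and v: "v > 0"
  shows "(exp_series a has_field_derivative - (of_real (2 * pi) * exp_series (a + 1) (of_real v))) (at (of_real v))"
proof -
  let ?S = "{u. Re u > v / 2}"
  let ?f = "\<lambda>n u. of_nat (Suc n) powr a * exp (- (of_real (2 * pi * real (Suc n)) * u))"
  let ?f' = "\<lambda>n u. - of_real (2 * pi) * (of_nat (Suc n) powr (a + 1) * exp (- (of_real (2 * pi * real (Suc n)) * u)))"
  let ?M = "\<lambda>n. 2 * pi * (real (Suc n) powr (Re a + 1) * exp (- (2 * pi * real (Suc n) * (v / 2))))"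
  have sm: "summable ?M" using a v by (intro summable_mult summable_powr_exp) auto
  have "((\<lambda>u. \<Sum>n. ?f n u) has_field_derivative (\<Sum>n. ?f' n (of_real v))) (at (of_real v))"
  proof (rule series_has_field_derivative[where S = ?S and M = ?M])
    show "(?f n has_field_derivative ?f' n u) (at u)" for n u
    proof -
      have "complex_of_nat (Suc n) powr (a + 1) = of_nat (Suc n) powr a * of_nat (Suc n)"
        using powr_add[of "complex_of_nat (Suc n)" a 1] by (simp del: of_nat_Suc)
      moreover have "((\<lambda>u. A * exp (- (K * u))) has_field_derivative A * (exp (- (K * u)) * - K)) (at u)" for A K :: complex
        by (auto intro!: derivative_eq_intros)
      from this[of "of_nat (Suc n) powr a" "of_real (2 * pi * real (Suc n))"]
      have "(?f n has_field_derivative of_nat (Suc n) powr a * (exp (- (of_real (2 * pi * real (Suc n)) * u)) * - of_real (2 * pi * real (Suc n)))) (at u)" .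
      ultimately show ?thesis by (simp add: mult_ac del: of_nat_Suc)
    qed
    show "norm (?f' n u) \<le> ?M n" if "u \<in> ?S" for n u
    proof -
      have "exp (- (2 * pi * real (Suc n) * Re u)) \<le> exp (- (2 * pi * real (Suc n) * (v / 2)))"
        using that by (simp del: of_nat_Suc)
      hence "norm (of_nat (Suc n) powr (a + 1) * exp (- (of_real (2 * pi * real (Suc n)) * u))) \<le>
        real (Suc n) powr (Re a + 1) * exp (- (2 * pi * real (Suc n) * (v / 2)))"
        unfolding norm_exp_series_term by (simp add: mult_left_mono del: of_nat_Suc)
      from mult_left_mono[OF this, of "2 * pi"] show ?thesis
        by (simp only: norm_mult[of "- of_real (2 * pi)"] norm_minus_cancel norm_of_real) simp
    qed
    show "summable (\<lambda>n. ?f n (of_real v))"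
    proof (rule summable_norm_cancel)
      show "summable (\<lambda>n. norm (?f n (of_real v)))"
        unfolding norm_exp_series_term using summable_powr_exp[of "Re a" v] a v by simp
    qed
    show "open ?S" "convex ?S" by (rule open_halfspace_Re_gt convex_halfspace_Re_gt)+
  qed (rule sm, use v in simp)
  moreover have "(\<Sum>n. ?f' n (of_real v)) = - of_real (2 * pi) * exp_series (a + 1) (of_real v)"
    unfolding exp_series_def
  proof (rule suminf_mult[OF summable_norm_cancel])
    show "summable (\<lambda>n. norm (of_nat (Suc n) powr (a + 1) * exp (- (of_real (2 * pi * real (Suc n)) * complex_of_real v))))"
      unfolding norm_exp_series_term using summable_powr_exp[of "Re a + 1" v] a v by simp
  qed
  ultimately show ?thesis unfolding exp_series_def[abs_def] by simp
qed

lemma exp_series_tendsto_zeta: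
  assumes s: "Re s > 1"
  shows "((\<lambda>v. exp_series (- s) (of_real v)) \<longlongrightarrow> zeta s) (at_right 0)"
proof -
  let ?f = "\<lambda>n v. of_nat (Suc n) powr (- s) * exp (- (of_real (2 * pi * real (Suc n)) * complex_of_real v))"
  have "uniform_limit {0..} (\<lambda>N v. \<Sum>n<N. ?f n v) (\<lambda>v. \<Sum>n. ?f n v) sequentially"
  proof (rule Weierstrass_m_test)
    show "summable (\<lambda>n. real (Suc n) powr (- Re s))" using s by (intro summable_Suc_powr) simp
    show "norm (?f n v) \<le> real (Suc n) powr (- Re s)" if "v \<in> {0..}" for n v
      unfolding norm_exp_series_term using that by (simp add: mult_left_le del: of_nat_Suc)
  qed
  moreover have "\<forall>\<^sub>F N in sequentially. continuous_on {0..} (\<lambda>v. \<Sum>n<N. ?f n v)"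
    by (intro always_eventually allI continuous_intros)
  ultimately have "continuous_on {0..} (\<lambda>v. \<Sum>n. ?f n v)"
    by (intro uniform_limit_theorem) auto
  from this[unfolded continuous_on_def, rule_format, of 0]
  have "((\<lambda>v. \<Sum>n. ?f n v) \<longlongrightarrow> (\<Sum>n. ?f n 0)) (at 0 within {0..})" by simp
  hence "((\<lambda>v. \<Sum>n. ?f n v) \<longlongrightarrow> (\<Sum>n. ?f n 0)) (at_right 0)" by (rule tendsto_within_subset) auto
  thus ?thesis using s by (simp add: exp_series_def zeta_eq_dirichlet dirichlet_zeta_def)
qed

lemma const_eq_0_at_right:
  fixes f :: "real \<Rightarrow> complex"
  assumes "\<And>t. t > 0 \<Longrightarrow> f t = c" "(f \<longlongrightarrow> 0) (at_right 0)"
  shows "c = 0"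
proof -
  have "\<forall>\<^sub>F t in at_right 0. f t = c"
    using eventually_at_right_less[of 0] by eventually_elim (rule assms(1))
  hence "((\<lambda>_. c) \<longlongrightarrow> 0) (at_right (0::real))"
    by (rule Lim_transform_eventually[OF assms(2)])
  show ?thesis by (rule tendsto_unique[OF trivial_limit_at_right_real tendsto_const \<open>((\<lambda>_. c) \<longlongrightarrow> 0) (at_right 0)\<close>])
qed

lemma has_vector_derivative_of_real_within:
  assumes "(f has_field_derivative f') (at (complex_of_real t))"
  shows "((\<lambda>t. f (of_real t)) has_vector_derivative f') (at t within S)"
  using has_vector_derivative_real_field[OF assms] by (rule has_vector_derivative_at_within)

lemma zero_of_second_derivative:
  fixes f g :: "complex \<Rightarrow> complex"
  assumes f: "\<And>v. v > 0 \<Longrightarrow> (f has_field_derivative g (of_real v)) (at (of_real v))"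
    and g: "\<And>v. v > 0 \<Longrightarrow> (g has_field_derivative 0) (at (of_real v))"
    and lim: "((\<lambda>v. f (of_real v)) \<longlongrightarrow> 0) (at_right 0)" "((\<lambda>v. g (of_real v)) \<longlongrightarrow> 0) (at_right 0)"
    and v: "v > 0"
  shows "f (of_real v) = 0"
proof -
  have cv: "convex ({0<..} :: real set)" by simp
  have "((\<lambda>t. g (of_real t)) has_vector_derivative 0) (at t within {0<..})" if "t \<in> {0<..}" for t
    by (rule has_vector_derivative_of_real_within[OF g]) (use that in simp)
  from has_vector_derivative_zero_constant[OF cv this]
  obtain c where c: "\<And>t. t \<in> {0<..} \<Longrightarrow> g (of_real t) = c" by metis
  have "c = 0" by (rule const_eq_0_at_right[OF c lim(2)]) simp
  have "((\<lambda>t. f (of_real t)) has_vector_derivative 0) (at t within {0<..})" if "t \<in> {0<..}" for t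
  proof -
    have "((\<lambda>t. f (of_real t)) has_vector_derivative g (of_real t)) (at t within {0<..})"
      by (rule has_vector_derivative_of_real_within[OF f]) (use that in simp)
    thus ?thesis unfolding c[OF that] \<open>c = 0\<close> .
  qed
  from has_vector_derivative_zero_constant[OF cv this]
  obtain e where e: "\<And>t. t \<in> {0<..} \<Longrightarrow> f (of_real t) = e" by metis
  have "e = 0" by (rule const_eq_0_at_right[OF e lim(1)]) simp
  thus ?thesis using e[of v] v by simp
qed

lemma tendsto_powr_at_right_0:
  fixes a :: real
  assumes "a > 0" shows "((\<lambda>t. t powr a) \<longlongrightarrow> 0) (at_right 0)"
  using assms by real_asymp

lemma notin_Ints_strip:
  assumes s: "1 < Re s" "Re s < 2"
  shows "s \<notin> \<int>"
proof
  assume "s \<in> \<int>"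
  then obtain n where "s = of_int n" by (auto elim!: Ints_cases)
  hence "1 < real_of_int n" "real_of_int n < 2" using s by simp_all
  hence "1 < n" "n < 2" by simp_all
  thus False by simp
qed

lemma sin_pi_neq_0:
  fixes s :: complex
  assumes "s \<notin> \<int>"
  shows "sin (of_real pi * s) \<noteq> 0"
  using assms by (auto simp: sin_eq_0)

text \<open>The Lipschitz formula with \<open>w = 3 - s\<close>. The factor
  \<open>(s - 1) * (s - 2)\<close> from differentiating twice is absorbed by
  \<open>Gamma (3 - s) = (2 - s) * (1 - s) * Gamma (1 - s)\<close>.\<close>

lemma pair_sum_tay2:
  assumes s: "1 < Re s" "Re s < 2" and v: "v > 0"
  shows "pair_sum tay2 s (of_real v) = of_real (2 * pi) powr (3 - s) / Gamma (1 - s) * exp_series (2 - s) (of_real v) -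
     (s - 1) * (s - 2) * of_real v powr (s - 3)"
proof -
  have e: "exp_series (2 - s) (of_real v) = (\<Sum>n. of_nat (Suc n) powr (3 - s - 1) * of_real (exp (- (2 * pi * real (Suc n) * v))))"
    by (simp add: exp_series_def exp_of_real[symmetric] del: of_nat_Suc)
  have G: "Gamma (3 - s) = (2 - s) * (1 - s) * Gamma (1 - s)"
  proof -
    have "1 - s \<notin> \<int>\<^sub>\<le>\<^sub>0"
      using one_minus_notin_Ints[OF notin_Ints_strip[OF s]] by (auto dest: nonpos_Ints_Int)
    moreover have "2 - s \<notin> \<int>\<^sub>\<le>\<^sub>0" using Gamma_neq_0[of "2 - s"] s by (auto simp: Gamma_eq_zero_iff)
    ultimately show ?thesis using Gamma_plus1[of "1 - s"] Gamma_plus1[of "2 - s"] by (simp add: mult.assoc)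
  qed
  have s0: "2 - s \<noteq> 0" "1 - s \<noteq> 0" using s by auto
  have "(\<lambda>k. (s - 1) * (s - 2) * ((of_real v + \<i> * of_nat (Suc k)) powr (- (3 - s)) + (of_real v - \<i> * of_nat (Suc k)) powr (- (3 - s)))) sums
    ((s - 1) * (s - 2) * (of_real (2 * pi) powr (3 - s) / Gamma (3 - s) * exp_series (2 - s) (of_real v) - of_real v powr (- (3 - s))))"
    unfolding e using s by (intro sums_mult Lipschitz_formula(1) v) auto
  moreover have "(s - 1) * (s - 2) * (of_real (2 * pi) powr (3 - s) / Gamma (3 - s) * exp_series (2 - s) (of_real v) - of_real v powr (- (3 - s))) =
     of_real (2 * pi) powr (3 - s) / Gamma (1 - s) * exp_series (2 - s) (of_real v) - (s - 1) * (s - 2) * of_real v powr (s - 3)"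
  proof -
    have m: "(s - 1) * (s - 2) = (2 - s) * (1 - s)" by (simp add: algebra_simps)
    have gen: "m * (A / (m * g) * E - V) = A / g * E - m * V" if "m \<noteq> 0" for m A g E V :: complex
      using that by (simp add: right_diff_distrib)
    have e: "- (3 - s) = s - 3" by simp
    show ?thesis unfolding G m e by (rule gen) (use s0 in simp)
  qed
  moreover have "(s - 1) * (s - 2) * ((of_real v + \<i> * of_nat (Suc k)) powr (- (3 - s)) + (of_real v - \<i> * of_nat (Suc k)) powr (- (3 - s))) =
     tay2 s (\<i> * of_real (real (Suc k))) (of_real v) + tay2 s (- \<i> * of_real (real (Suc k))) (of_real v)" for k
  proof -
    have e: "- (3 - s) = s - 3" by simp
    have x: "complex_of_real v - \<i> * of_nat (Suc k) = of_real v + - \<i> * of_real (real (Suc k))"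
      "complex_of_real v + \<i> * of_nat (Suc k) = of_real v + \<i> * of_real (real (Suc k))" by simp_all
    show ?thesis unfolding tay2_def e x by (rule distrib_left)
  qed
  ultimately show ?thesis unfolding pair_sum_def by (simp only: sums_iff)
qed

text \<open>The second derivatives agree, so the constants of integration are fixed at 0 from the
  right, where \<open>pair_sum tay\<close> and \<open>pair_sum tay1\<close> vanish. The value is
  settled by the convergent series for \<zeta>(s). In the slope, the exponential series and
  \<open>v powr (s - 2)\<close> both diverge; their divergent parts cancel and \<zeta>(s - 1)
  remains as the Abel limit.\<close>

theorem pair_sum_eq:
  assumes s: "1 < Re s" "Re s < 2" and v: "v > 0"
  defines "P \<equiv> of_real (2 * pi) powr (1 - s) / Gamma (1 - s)"
  shows "pair_sum tay s (of_real v) = P * exp_series (- s) (of_real v) - of_real v powr (s - 1) - P * zeta s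
     + of_real (2 * pi) * P * zeta (s - 1) * of_real v"
proof -
  define p2 where "p2 = complex_of_real (2 * pi)"
  have p2: "p2 \<noteq> 0" by (simp add: p2_def)
  define R where "R u = P * exp_series (- s) u - u powr (s - 1) - P * zeta s + p2 * P * zeta (s - 1) * u" for u
  define R1 where "R1 u = - p2 * P * exp_series (- s + 1) u - (s - 1) * u powr (s - 2) + p2 * P * zeta (s - 1)" for u
  have G0: "Gamma (1 - s) \<noteq> 0"
  proof -
    have "Gamma s * Gamma (1 - s) = of_real pi / sin (of_real pi * s)" by (rule Gamma_reflection_complex)
    moreover have "sin (of_real pi * s) \<noteq> 0" by (rule sin_pi_neq_0[OF notin_Ints_strip[OF s]])
    ultimately show ?thesis by auto
  qed
  have npos: "complex_of_real t \<notin> \<real>\<^sub>\<le>\<^sub>0" if "t > 0" for t using that by simp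
  have dR: "(R has_field_derivative R1 (of_real t)) (at (of_real t))" if t: "t > 0" for t
  proof -
    have h1: "(exp_series (- s) has_field_derivative - (p2 * exp_series (- s + 1) (of_real t))) (at (of_real t))"
      unfolding p2_def by (rule exp_series_deriv[OF _ t]) (use s in simp)
    have "((\<lambda>u. u powr (s - 1)) has_field_derivative (s - 1) * of_real t powr (s - 1 - 1)) (at (of_real t))"
      using npos[OF t] by (intro has_field_derivative_powr)
    moreover have "s - 1 - 1 = s - 2" by simp
    ultimately have h2: "((\<lambda>u. u powr (s - 1)) has_field_derivative (s - 1) * of_real t powr (s - 2)) (at (of_real t))"
      by (simp only:)
    have "(R has_field_derivative (P * - (p2 * exp_series (- s + 1) (of_real t)) - (s - 1) * of_real t powr (s - 2) - 0 + p2 * P * zeta (s - 1) * 1)) (at (of_real t))"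
      unfolding R_def[abs_def] by (intro DERIV_add DERIV_diff DERIV_cmult DERIV_const DERIV_ident h1 h2)
    thus ?thesis unfolding R1_def by (simp add: mult_ac)
  qed
  have dR1: "(R1 has_field_derivative pair_sum tay2 s (of_real t)) (at (of_real t))" if t: "t > 0" for t
  proof -
    have "(exp_series (- s + 1) has_field_derivative - (p2 * exp_series (- s + 1 + 1) (of_real t))) (at (of_real t))"
      unfolding p2_def by (rule exp_series_deriv[OF _ t]) (use s in simp)
    moreover have "((\<lambda>u. u powr (s - 2)) has_field_derivative (s - 2) * of_real t powr (s - 3)) (at (of_real t))"
    proof -
      have "((\<lambda>u. u powr (s - 2)) has_field_derivative (s - 2) * of_real t powr (s - 2 - 1)) (at (of_real t))"
        using npos[OF t] by (intro has_field_derivative_powr)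
      moreover have "s - 2 - 1 = s - 3" by simp
      ultimately show ?thesis by (simp only:)
    qed
    ultimately have "(R1 has_field_derivative (- p2 * P * - (p2 * exp_series (- s + 1 + 1) (of_real t)) - (s - 1) * ((s - 2) * of_real t powr (s - 3)) + 0)) (at (of_real t))"
      unfolding R1_def[abs_def] by (intro DERIV_add DERIV_diff DERIV_cmult DERIV_const)
    moreover have "p2 powr (3 - s) = p2 * p2 * p2 powr (1 - s)"
      using powr_add[of p2 2 "1 - s"] p2 by (simp add: power2_eq_square)
    moreover have "- s + 1 + 1 = 2 - s" by simp
    ultimately show ?thesis
      unfolding pair_sum_tay2[OF s t] p2_def[symmetric] P_def by (simp add: mult_ac)
  qed
  let ?D = "\<lambda>u. pair_sum tay s u - R u" and ?D1 = "\<lambda>u. pair_sum tay1 s u - R1 u"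
  define C where "C = (\<Sum>k. 2 * tay_const s * real (Suc k) powr (Re s - 3))"
  have "?D (of_real v) = 0"
  proof (rule zero_of_second_derivative[where f = ?D and g = ?D1])
    show "(?D has_field_derivative ?D1 (of_real t)) (at (of_real t))" if "t > 0" for t
      using pair_sum_derivs(1)[OF s(2) that] dR[OF that] by (rule DERIV_diff)
    show "(?D1 has_field_derivative 0) (at (of_real t))" if "t > 0" for t
      using DERIV_diff[OF pair_sum_derivs(2)[OF s(2) that] dR1[OF that]] by simp
    have lim0: "((\<lambda>t. C * t ^ j) \<longlongrightarrow> 0) (at_right 0)" if "j \<ge> 1" for j
    proof -
      have "((\<lambda>t. C * t ^ j) \<longlongrightarrow> C * 0 ^ j) (at_right 0)" by (intro tendsto_intros)
      moreover have "C * 0 ^ j = 0" using that by (simp add: power_0_left)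
      ultimately show ?thesis by (simp only:)
    qed
    have ps: "((\<lambda>t. pair_sum T s (of_real t)) \<longlongrightarrow> 0) (at_right 0)" if T: "(T, j) \<in> {(tay, 2), (tay1, 1), (tay2, 0)}" "j \<ge> 1" for T and j :: nat
    proof (rule Lim_null_comparison[OF _ lim0[OF T(2)]])
      show "\<forall>\<^sub>F t in at_right 0. norm (pair_sum T s (of_real t)) \<le> C * t ^ j"
        using eventually_at_right_less[of 0]
      proof eventually_elim
        case (elim t)
        thus ?case using summable_pair(2)[OF s(2) real_in_half_strip T(1), of t] by (simp add: C_def)
      qed
    qed
    have vp: "((\<lambda>t. complex_of_real t powr (s - 1)) \<longlongrightarrow> 0) (at_right 0)"
    proof (rule Lim_null_comparison[OF _ tendsto_powr_at_right_0])
      show "\<forall>\<^sub>F t in at_right 0. norm (complex_of_real t powr (s - 1)) \<le> t powr (Re s - 1)"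
        using eventually_at_right_less[of 0] by eventually_elim (simp add: norm_powr_of_real)
    qed (use s in simp)
    have id0: "((\<lambda>t. complex_of_real t) \<longlongrightarrow> 0) (at_right 0)"
      using tendsto_of_real[OF tendsto_ident_at[of 0 "{0<..}"], where 'a = complex] by simp
    have "((\<lambda>t. R (of_real t)) \<longlongrightarrow> P * zeta s - 0 - P * zeta s + p2 * P * zeta (s - 1) * 0) (at_right 0)"
      unfolding R_def by (intro tendsto_intros exp_series_tendsto_zeta s vp id0)
    from tendsto_diff[OF ps[of tay 2] this]
    show "((\<lambda>t. ?D (of_real t)) \<longlongrightarrow> 0) (at_right 0)" by simp
    \<comment> \<open>The Abel limit at \<open>z = s - 1\<close>, in the critical strip, with
      \<epsilon> = 2 pi t.\<close>
    have "((\<lambda>t. exp_series (- s + 1) (of_real t) - Gamma (1 - (s - 1)) * of_real (2 * pi * t) powr (s - 1 - 1)) \<longlongrightarrow> zeta (s - 1)) (at_right 0)"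
    proof -
      have "filterlim (\<lambda>t. 2 * pi * t) (at_right 0) (at_right (0::real))" by real_asymp
      from filterlim_compose[OF zeta_Abel_limit[of "s - 1"] this] s
      show ?thesis by (simp add: exp_series_def exp_of_real[symmetric] mult_ac del: of_nat_Suc)
    qed
    hence "((\<lambda>t. - p2 * P * (exp_series (- s + 1) (of_real t) - Gamma (1 - (s - 1)) * of_real (2 * pi * t) powr (s - 1 - 1)) + p2 * P * zeta (s - 1))
       \<longlongrightarrow> - p2 * P * zeta (s - 1) + p2 * P * zeta (s - 1)) (at_right 0)"
      by (intro tendsto_intros)
    hence "((\<lambda>t. - p2 * P * (exp_series (- s + 1) (of_real t) - Gamma (1 - (s - 1)) * of_real (2 * pi * t) powr (s - 1 - 1)) + p2 * P * zeta (s - 1))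
       \<longlongrightarrow> 0) (at_right 0)" by simp
    moreover have "\<forall>\<^sub>F t in at_right 0. - p2 * P * (exp_series (- s + 1) (of_real t) - Gamma (1 - (s - 1)) * of_real (2 * pi * t) powr (s - 1 - 1)) + p2 * P * zeta (s - 1) = R1 (of_real t)"
      using eventually_at_right_less[of 0]
    proof eventually_elim
      case (elim t)
      have e: "s - 1 - 1 = s - 2" "1 - (s - 1) = 2 - s" by simp_all
      have a1: "complex_of_real (2 * pi * t) powr (s - 2) = p2 powr (s - 2) * of_real t powr (s - 2)"
        using powr_mult_of_real[of "2 * pi" "of_real t" "s - 2"] elim by (simp add: p2_def)
      have a2: "Gamma (2 - s) = (1 - s) * Gamma (1 - s)"
      proof -
        have "1 - s \<notin> \<int>\<^sub>\<le>\<^sub>0" using G0 by (auto simp: Gamma_eq_zero_iff)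
        from Gamma_plus1[OF this] show ?thesis by simp
      qed
      \<comment> \<open>With the factors \<Gamma>(1 - s) and powers of 2 pi gone, the divergent part
        subtracted in the Abel limit is exactly the power \<open>(s - 1) * t powr (s - 2)\<close>
        contained in \<open>R1\<close>.\<close>
      have a3: "p2 * P * ((1 - s) * Gamma (1 - s) * (p2 powr (s - 2) * y)) = (1 - s) * y" for y
      proof -
        have "p2 powr (1 - s) * p2 powr (s - 2) = p2 powr (-1)" by (simp flip: powr_add)
        also have "\<dots> = 1 / p2" using p2 by (simp add: powr_minus inverse_eq_divide)
        finally have "p2 * (p2 powr (1 - s) * p2 powr (s - 2)) = 1" using p2 by simp
        moreover have "p2 * P * ((1 - s) * Gamma (1 - s) * (p2 powr (s - 2) * y)) = (p2 * (p2 powr (1 - s) * p2 powr (s - 2))) * ((1 - s) * y)"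
          unfolding P_def p2_def[symmetric] using G0 by (simp add: mult_ac)
        ultimately show ?thesis by simp
      qed
      have a4: "- q * r * (E - G) + Z = - q * r * E + q * r * G + Z" for q r E G Z :: complex by (simp add: algebra_simps)
      show ?case unfolding R1_def e a1 a2 a4 a3 by (simp add: algebra_simps)
    qed
    ultimately have "((\<lambda>t. R1 (of_real t)) \<longlongrightarrow> 0) (at_right 0)" by (rule Lim_transform_eventually)
    from tendsto_diff[OF ps[of tay1 1] this]
    show "((\<lambda>t. ?D1 (of_real t)) \<longlongrightarrow> 0) (at_right 0)" by simp
  qed (rule v)
  thus ?thesis unfolding R_def p2_def by simp
qed

section \<open>The double sum of integrals\<close>

text \<open>The product majorant makes the family absolutely summable. The unordered form permits
  regrouping by divisors, the ordered form the exchange of rows and columns; both refer to one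
  value.\<close>

lemma double_series_sums:
  fixes H :: "nat \<Rightarrow> nat \<Rightarrow> complex"
  assumes le: "\<And>k l. norm (H k l) \<le> A k * B l" and A: "summable A" and B: "summable B"
    and nonneg: "\<And>k. A k \<ge> 0" "\<And>l. B l \<ge> 0"
  shows "((\<lambda>(k, l). H k l) has_sum (\<Sum>k. \<Sum>l. H k l)) (UNIV \<times> UNIV)"
    and "(\<lambda>l. \<Sum>k. H k l) sums (\<Sum>k. \<Sum>l. H k l)"
proof -
  have As: "A summable_on UNIV" and Bs: "B summable_on UNIV"
    using A B nonneg by (auto intro!: norm_summable_imp_summable_on)
  have "(\<lambda>(k, l). A k * B l) summable_on (UNIV \<times> UNIV)"
  proof (rule summable_on_SigmaI[where g = "\<lambda>k. A k * infsum B UNIV"])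
    show "((\<lambda>y. case (k, y) of (k, l) \<Rightarrow> A k * B l) has_sum A k * infsum B UNIV) UNIV" for k
      using has_sum_cmult_right[OF has_sum_infsum[OF Bs], of "A k"] by simp
    show "(\<lambda>k. A k * infsum B UNIV) summable_on UNIV" by (rule summable_on_cmult_left[OF As])
  qed (use nonneg in auto)
  hence "(\<lambda>p. norm (case p of (k, l) \<Rightarrow> H k l)) summable_on (UNIV \<times> UNIV)"
    by (rule summable_on_comparison_test) (use le in auto)
  hence sm: "(\<lambda>(k, l). H k l) summable_on (UNIV \<times> UNIV)" by (rule Infinite_Sum.abs_summable_summable)
  define S where "S = infsum (\<lambda>(k, l). H k l) (UNIV \<times> UNIV)"
  have hs: "((\<lambda>(k, l). H k l) has_sum S) (UNIV \<times> UNIV)" unfolding S_def using sm by (rule has_sum_infsum)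
  have inner: "((\<lambda>l. H k l) has_sum (\<Sum>l. H k l)) UNIV" for k
  proof (rule norm_summable_imp_has_sum)
    show n: "summable (\<lambda>l. norm (H k l))"
      by (rule summable_comparison_test'[OF summable_mult[OF B, of "A k"]]) (use le in simp)
    show "(\<lambda>l. H k l) sums (\<Sum>l. H k l)" by (rule summable_sums[OF summable_norm_cancel[OF n]])
  qed
  have inner': "((\<lambda>k. H k l) has_sum (\<Sum>k. H k l)) UNIV" for l
  proof (rule norm_summable_imp_has_sum)
    show n: "summable (\<lambda>k. norm (H k l))"
      by (rule summable_comparison_test'[OF summable_mult2[OF A, of "B l"]]) (use le in simp)
    show "(\<lambda>k. H k l) sums (\<Sum>k. H k l)" by (rule summable_sums[OF summable_norm_cancel[OF n]])
  qed
  have "((\<lambda>k. \<Sum>l. H k l) has_sum S) UNIV"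
    by (rule has_sum_SigmaD[where f = "\<lambda>(k, l). H k l" and B = "\<lambda>_. UNIV"]) (use hs inner in auto)
  hence S: "S = (\<Sum>k. \<Sum>l. H k l)" by (intro sums_unique has_sum_imp_sums)
  show "((\<lambda>(k, l). H k l) has_sum (\<Sum>k. \<Sum>l. H k l)) (UNIV \<times> UNIV)" using hs unfolding S .
  have hs': "((\<lambda>(l, k). H k l) has_sum S) (UNIV \<times> UNIV)"
    using hs by (subst (asm) has_sum_swap) (simp add: case_prod_unfold)
  have "((\<lambda>l. \<Sum>k. H k l) has_sum S) UNIV"
    by (rule has_sum_SigmaD[where f = "\<lambda>(l, k). H k l" and B = "\<lambda>_. UNIV"]) (use hs' inner' in auto)
  thus "(\<lambda>l. \<Sum>k. H k l) sums (\<Sum>k. \<Sum>l. H k l)" unfolding S by (rule has_sum_imp_sums)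
qed

text \<open>A pair \<open>(k, l)\<close> corresponds to \<open>Suc n = Suc k * Suc l\<close> with
  the divisor \<open>d = Suc k\<close>. Divisors of \<open>Suc n\<close> and their cofactors are
  positive, so the truncated subtractions of 1 are exact.\<close>

lemma has_sum_divisors:
  fixes H :: "nat \<Rightarrow> nat \<Rightarrow> complex"
  assumes "((\<lambda>(k, l). H k l) has_sum S) (UNIV \<times> UNIV)"
  shows "(\<lambda>n. \<Sum>d | d dvd Suc n. H (d - 1) (Suc n div d - 1)) sums S"
proof -
  let ?D = "SIGMA n:UNIV. {d. d dvd Suc n}"
  have "((\<lambda>(n, d). H (d - 1) (Suc n div d - 1)) has_sum S) ?D"
  proof (subst has_sum_reindex_bij_witness[where S = ?D and T = "UNIV \<times> UNIV"
        and i = "\<lambda>(k, l). (Suc k * Suc l - 1, Suc k)" and j = "\<lambda>(n, d). (d - 1, Suc n div d - 1)"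
        and h = "\<lambda>(k, l). H k l"])
    fix p assume "p \<in> ?D"
    then obtain n d where p: "p = (n, d)" "d dvd Suc n" by auto
    then obtain e where e: "Suc n = d * e" by (elim dvdE)
    hence "d > 0" "e > 0" using gr0I by fastforce+
    hence 1: "Suc n div d = e" "Suc (d - 1) = d" "Suc (e - 1) = e" using e by auto
    have 2: "d * e - 1 = n" using e[symmetric] by simp
    show "(case case p of (n, d) \<Rightarrow> (d - 1, Suc n div d - 1) of (k, l) \<Rightarrow> (Suc k * Suc l - 1, Suc k)) = p"
      unfolding p split 1 2 ..
  next
    fix p :: "nat \<times> nat"
    obtain k l where p: "p = (k, l)" by (cases p)
    have *: "Suc (Suc k * Suc l - 1) = Suc k * Suc l" by simp
    have **: "Suc k * Suc l div Suc k = Suc l" by (rule nonzero_mult_div_cancel_left) simp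
    show "(case case p of (k, l) \<Rightarrow> (Suc k * Suc l - 1, Suc k) of (n, d) \<Rightarrow> (d - 1, Suc n div d - 1)) = p"
      unfolding p split * ** by simp
    show "(case p of (k, l) \<Rightarrow> (Suc k * Suc l - 1, Suc k)) \<in> ?D"
      unfolding p split mem_Sigma_iff * mem_Collect_eq by (intro conjI UNIV_I dvd_triv_left)
  qed (use assms in auto)
  hence "((\<lambda>n. \<Sum>d | d dvd Suc n. H (d - 1) (Suc n div d - 1)) has_sum S) UNIV"
    by (rule has_sum_SigmaD) (auto intro!: has_sum_finite)
  thus ?thesis by (rule has_sum_imp_sums)
qed

section \<open>The integrals of the double sum and their relation to the Bessel terms\<close>

definition kernel :: "complex \<Rightarrow> real \<Rightarrow> real \<Rightarrow> complex" where
  "kernel s e v = of_real v powr (s - 1) * exp (- (of_real (2 * pi * e) * of_real v))"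

lemma norm_kernel: "v > 0 \<Longrightarrow> norm (kernel s e v) = v powr (Re s - 1) * exp (- (2 * pi * e * v))"
  by (simp add: kernel_def norm_mult norm_powr_of_real)

lemma continuous_kernel: "continuous_on {0<..} (kernel s e)"
  unfolding kernel_def by (auto intro!: continuous_intros)

lemma kernel_integral:
  assumes "Re s > 0" "e > 0"
  shows "has_bochner_integral lhalf (kernel s e) (Gamma s * of_real (2 * pi * e) powr (- s))"
  unfolding kernel_def using assms by (intro has_bochner_integral_Gamma_scaled_real) auto

definition pair_int :: "complex \<Rightarrow> real \<Rightarrow> real \<Rightarrow> complex" where
  "pair_int s d e = (LINT v|lhalf. kernel s e v * pair_term s d (of_real v))"

lemma continuous_pair_term:
  assumes "d > 0" shows "continuous_on {0<..} (\<lambda>v. pair_term s d (complex_of_real v))"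
proof -
  have "complex_of_real v + c \<notin> \<real>\<^sub>\<le>\<^sub>0" "complex_of_real v + c \<noteq> 0" if "v > 0" "Re c = 0" for v c
    using that by (auto simp: complex_nonpos_Reals_iff complex_eq_iff)
  thus ?thesis unfolding pair_term_def tay_def by (auto intro!: continuous_intros)
qed

text \<open>The quadratic factor in the bound for \<open>pair_term\<close> raises the Gamma
  parameter from \<open>Re s\<close> to \<open>Re s + 2\<close>. The integrated bound serves the
  double series, the pointwise one the summation over \<open>d\<close> under the integral.\<close>

lemma pair_int:
  assumes d: "d \<ge> 1" and e: "e > 0" and s: "1 < Re s" "Re s < 2"
  shows "has_bochner_integral lhalf (\<lambda>v. kernel s e v * pair_term s d (of_real v)) (pair_int s d e)"
    and "norm (pair_int s d e) \<le> 2 * tay_const s * d powr (Re s - 3) * (Gamma (Re s + 2) * (2 * pi * e) powr (- (Re s + 2)))"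
    and "\<And>v. v > 0 \<Longrightarrow> norm (kernel s e v * pair_term s d (of_real v)) \<le>
       2 * tay_const s * d powr (Re s - 3) * (v powr (Re s + 2 - 1) * exp (- (2 * pi * e * v)))"
proof -
  let ?C = "2 * tay_const s * d powr (Re s - 3)"
  show b: "norm (kernel s e v * pair_term s d (of_real v)) \<le> ?C * (v powr (Re s + 2 - 1) * exp (- (2 * pi * e * v)))"
    if v: "v > 0" for v
  proof -
    have "norm (pair_term s d (of_real v)) \<le> ?C * (norm (complex_of_real v))\<^sup>2"
      using d s v by (intro norm_pair_term_le real_in_half_strip) auto
    hence "norm (kernel s e v * pair_term s d (of_real v)) \<le> norm (kernel s e v) * (?C * v\<^sup>2)"
      unfolding norm_mult by (intro mult_left_mono) auto
    also have "\<dots> = ?C * (v powr (Re s - 1) * v powr 2 * exp (- (2 * pi * e * v)))"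
      using v by (simp add: norm_kernel)
    also have "v powr (Re s - 1) * v powr 2 = v powr (Re s + 2 - 1)" by (simp add: algebra_simps flip: powr_add)
    finally show ?thesis .
  qed
  have G: "has_bochner_integral lhalf (\<lambda>v. ?C * (v powr (Re s + 2 - 1) * exp (- (2 * pi * e * v)))) (?C * (Gamma (Re s + 2) * (2 * pi * e) powr (- (Re s + 2))))"
    using s e by (intro has_bochner_integral_mult_right has_bochner_integral_Gamma_real) auto
  hence Gi: "integrable lhalf (\<lambda>v. ?C * (v powr (Re s + 2 - 1) * exp (- (2 * pi * e * v))))"
    by (simp add: has_bochner_integral_iff)
  have int: "integrable lhalf (\<lambda>v. kernel s e v * pair_term s d (of_real v))"
  proof (rule Bochner_Integration.integrable_bound[OF Gi])
    show "(\<lambda>v. kernel s e v * pair_term s d (of_real v)) \<in> borel_measurable lhalf"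
      using d by (intro measurable_lhalf_continuous continuous_intros continuous_kernel continuous_pair_term) auto
    show "AE v in lhalf. norm (kernel s e v * pair_term s d (of_real v)) \<le> norm (?C * (v powr (Re s + 2 - 1) * exp (- (2 * pi * e * v))))"
      by (rule AE_I2) (use b in \<open>force intro: order_trans\<close>)
  qed
  thus "has_bochner_integral lhalf (\<lambda>v. kernel s e v * pair_term s d (of_real v)) (pair_int s d e)"
    by (simp add: has_bochner_integral_iff pair_int_def)
  have "norm (pair_int s d e) \<le> integral\<^sup>L lhalf (\<lambda>v. ?C * (v powr (Re s + 2 - 1) * exp (- (2 * pi * e * v))))"
    unfolding pair_int_def using int Gi b
    by (intro order_trans[OF integral_norm_bound] integral_mono integrable_norm) auto
  thus "norm (pair_int s d e) \<le> ?C * (Gamma (Re s + 2) * (2 * pi * e) powr (- (Re s + 2)))"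
    using G unfolding has_bochner_integral_iff by (simp only:)
qed

text \<open>The powers are homogeneous of degree \<open>s - 1\<close> in \<open>v\<close> and
  \<open>d\<close> jointly, and their Taylor polynomials inherit this.\<close>

lemma pair_term_scale:
  assumes d: "d > 0" and v: "v > 0"
  shows "pair_term s d (of_real v) = of_real d powr (s - 1) * pair_term s 1 (of_real (v / d))"
proof -
  have t: "tay s (of_real d * c) (of_real v) = of_real d powr (s - 1) * tay s c (of_real (v / d))"
    if c: "Re c = 0" "c \<noteq> 0" for c
  proof -
    have nz: "of_real (v / d) + c \<noteq> 0" using c d v by (auto simp: complex_eq_iff)
    have "of_real v + of_real d * c = of_real d * (of_real (v / d) + c)" using d by (simp add: field_simps)
    hence 1: "(of_real v + of_real d * c) powr (s - 1) = of_real d powr (s - 1) * (of_real (v / d) + c) powr (s - 1)"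
      using powr_mult_of_real[OF d nz] by (simp only:)
    have 2: "(of_real d * c) powr a = of_real d powr a * c powr a" for a
      by (rule powr_mult_of_real[OF d c(2)])
    have 3: "of_real v * of_real d powr (s - 2) = of_real (v / d) * of_real d powr (s - 1)"
      using powr_minus_2_eq[of "of_real d" s] d by simp
    have "(s - 1) * of_real v * (of_real d * c) powr (s - 2) = (s - 1) * (of_real v * of_real d powr (s - 2)) * c powr (s - 2)"
      unfolding 2 by (simp only: mult_ac)
    also have "\<dots> = of_real d powr (s - 1) * ((s - 1) * of_real (v / d) * c powr (s - 2))"
      unfolding 3 by (simp only: mult_ac)
    finally have 4: "(s - 1) * of_real v * (of_real d * c) powr (s - 2) = \<dots>" .
    show ?thesis unfolding tay_def 1 4 unfolding 2 by (simp only: right_diff_distrib)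
  qed
  have t1: "tay s (of_real d * \<i>) (of_real v) = of_real d powr (s - 1) * tay s \<i> (of_real (v / d))"
    and t2: "tay s (of_real d * - \<i>) (of_real v) = of_real d powr (s - 1) * tay s (- \<i>) (of_real (v / d))"
    by (rule t; simp)+
  have "pair_term s d (of_real v) = tay s (of_real d * \<i>) (of_real v) + tay s (of_real d * - \<i>) (of_real v)"
    by (simp add: pair_term_def mult.commute)
  also have "\<dots> = of_real d powr (s - 1) * (tay s \<i> (of_real (v / d)) + tay s (- \<i>) (of_real (v / d)))"
    unfolding t1 t2 by (rule distrib_left[symmetric])
  finally show ?thesis by (simp add: pair_term_def)
qed

text \<open>Under \<open>v = d * u\<close> the kernel and \<open>pair_term\<close> each give
  \<open>d powr (s - 1)\<close> and the measure gives \<open>d\<close>. Their product is the weight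
  in \<open>divisor_sigma (2 * s - 1)\<close>, and the integral depends only on
  \<open>d * e\<close>.\<close>

lemma pair_int_scale:
  assumes d: "d \<ge> 1" and e: "e > 0" and s: "1 < Re s" "Re s < 2"
  shows "pair_int s d e = of_real d powr (2 * s - 1) * pair_int s 1 (d * e)"
proof -
  have d0: "d > 0" using d by simp
  let ?D = "complex_of_real d powr (s - 1)"
  have D0: "?D \<noteq> 0" using d0 by simp
  have "has_bochner_integral lhalf (\<lambda>v. kernel s (d * e) v * pair_term s 1 (of_real v)) (pair_int s 1 (d * e))"
    using d0 e by (intro pair_int(1) s) auto
  from lhalf_scale[OF _ this, of "1 / d"] d0
  have "has_bochner_integral lhalf (\<lambda>v. kernel s (d * e) (v / d) * pair_term s 1 (of_real (v / d))) (of_real d * pair_int s 1 (d * e))"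
    by (simp add: scaleR_conv_of_real)
  from has_bochner_integral_mult_right[OF this, of "?D * ?D"]
  have "has_bochner_integral lhalf (\<lambda>v. ?D * ?D * (kernel s (d * e) (v / d) * pair_term s 1 (of_real (v / d)))) (?D * ?D * (of_real d * pair_int s 1 (d * e)))" .
  moreover have "?D * ?D * (kernel s (d * e) (v / d) * pair_term s 1 (of_real (v / d))) = kernel s e v * pair_term s d (of_real v)"
    if "v \<in> space lhalf" for v
  proof -
    have v: "v > 0" using that by simp
    have "complex_of_real v powr (s - 1) = ?D * of_real (v / d) powr (s - 1)"
      using powr_mult_of_real[OF d0, of "of_real (v / d)" "s - 1"] d0 v by simp
    moreover have "of_real (2 * pi * (d * e)) * complex_of_real (v / d) = of_real (2 * pi * e) * of_real v"
      using d0 by simp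
    ultimately have "kernel s e v = ?D * kernel s (d * e) (v / d)"
      unfolding kernel_def by (simp only: mult_ac)
    thus ?thesis unfolding pair_term_scale[OF d0 v] by (simp only: mult_ac)
  qed
  ultimately have "has_bochner_integral lhalf (\<lambda>v. kernel s e v * pair_term s d (of_real v)) (?D * ?D * (of_real d * pair_int s 1 (d * e)))"
    by (subst has_bochner_integral_cong[OF refl _ refl, symmetric])
  from has_bochner_integral_eq[OF pair_int(1)[OF d e s] this]
  have "pair_int s d e = ?D * ?D * of_real d * pair_int s 1 (d * e)" by (simp only: mult.assoc)
  also have "?D * ?D * of_real d = of_real d powr (2 * s - 1)"
  proof -
    have "?D * ?D * of_real d powr 1 = of_real d powr ((s - 1) + (s - 1) + 1)" by (simp only: powr_add)
    thus ?thesis using d0 by (simp add: algebra_simps)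
  qed
  finally show ?thesis .
qed

text \<open>As \<open>c\<^sup>2 = - 1\<close>, the base \<open>u + c\<close> equals
  \<open>c * (1 - c * u)\<close>. Both factors have argument at most pi/2 in modulus and not both
  equal to it, so the power splits; then \<open>u\<close> is rescaled by
  \<open>2 * pi * n\<close>.\<close>

lemma kernel_hankel:
  fixes n :: nat
  assumes n: "n > 0" and s: "Re s > 0" and c: "c = \<i> \<or> c = - \<i>"
  shows "has_bochner_integral lhalf (\<lambda>u. kernel s (real n) u * (of_real u + c) powr (s - 1))
    (of_real (2 * pi * real n) powr (- s) * Gamma s * (c powr (s - 1) * hankel_int s (- c / of_real (2 * (pi * real n)))))"
proof -
  define y where "y = 2 * pi * real n"
  have y: "y > 0" using n by (simp add: y_def)
  have yy: "2 * (pi * real n) = y" by (simp add: y_def)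
  let ?c = "- c / of_real y"
  let ?K = "complex_of_real y powr (1 - s) * c powr (s - 1)"
  have Rc: "Re ?c = 0" using c by auto
  have "has_bochner_integral lhalf (hankel_integrand s ?c) (Gamma s * hankel_int s ?c)"
    using integrable_hankel_integrand[OF Rc s] Gamma_neq_0[OF s]
    by (simp add: has_bochner_integral_iff hankel_int_def rGamma_inverse_Gamma)
  from has_bochner_integral_mult_right[OF lhalf_scale[OF y this], of ?K]
  have "has_bochner_integral lhalf (\<lambda>u. ?K * hankel_integrand s ?c (y * u)) (?K * (Gamma s * hankel_int s ?c /\<^sub>R y))" .
  moreover have "?K * (Gamma s * hankel_int s ?c /\<^sub>R y) = of_real y powr (- s) * Gamma s * (c powr (s - 1) * hankel_int s ?c)"
  proof -
    have "complex_of_real y powr (1 - s) = of_real y * of_real y powr (- s)"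
      using powr_add[of "complex_of_real y" 1 "- s"] y by simp
    thus ?thesis using y by (simp add: scaleR_conv_of_real field_simps)
  qed
  moreover have "?K * hankel_integrand s ?c (y * u) = kernel s (real n) u * (of_real u + c) powr (s - 1)"
    if "u \<in> space lhalf" for u
  proof -
    have u: "u > 0" using that by simp
    let ?w = "1 + - c * of_real u"
    have c0: "c \<noteq> 0" using c by auto
    have Rw: "Re ?w > 0" using c by auto
    hence w0: "?w \<noteq> 0" by (metis less_irrefl zero_complex.simps(1))
    have "\<bar>Im (Ln c)\<bar> \<le> pi / 2" using c by auto
    hence "(c * ?w) powr (s - 1) = c powr (s - 1) * ?w powr (s - 1)"
      using Re_Ln_pos_lt_imp[OF Rw] by (intro powr_mult_Im_Ln c0 w0) (simp_all add: abs_le_iff abs_less_iff)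
    moreover have "c * ?w = of_real u + c" using c by (elim disjE) (simp_all add: algebra_simps)
    ultimately have 1: "(of_real u + c) powr (s - 1) = c powr (s - 1) * ?w powr (s - 1)" by (simp only:)
    have 2: "1 + ?c * of_real (y * u) = ?w" using y by simp
    have "complex_of_real (y * u) powr (s - 1) = of_real y powr (s - 1) * of_real u powr (s - 1)"
      using powr_mult_of_real[OF y, of "of_real u" "s - 1"] u by simp
    moreover have "complex_of_real y powr (1 - s) * of_real y powr (s - 1) = 1"
      using y by (simp flip: powr_add)
    ultimately have 3: "complex_of_real y powr (1 - s) * of_real (y * u) powr (s - 1) = of_real u powr (s - 1)"
      by (simp add: mult.assoc[symmetric])
    have 4: "exp (- (of_real (2 * pi * real n) * of_real u)) = exp (- complex_of_real (y * u))" by (simp add: y_def)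
    have "?K * hankel_integrand s ?c (y * u) = (of_real y powr (1 - s) * of_real (y * u) powr (s - 1)) * exp (- complex_of_real (y * u)) * (c powr (s - 1) * ?w powr (s - 1))"
      unfolding hankel_integrand_def 2 by (simp only: mult_ac)
    also have "\<dots> = kernel s (real n) u * (of_real u + c) powr (s - 1)"
      unfolding 3 1 kernel_def 4 ..
    finally show ?thesis .
  qed
  ultimately have "has_bochner_integral lhalf (\<lambda>u. kernel s (real n) u * (of_real u + c) powr (s - 1)) (of_real y powr (- s) * Gamma s * (c powr (s - 1) * hankel_int s ?c))"
    by (subst has_bochner_integral_cong[OF refl _ refl, symmetric]) auto
  thus ?thesis unfolding yy unfolding y_def .
qed

lemma kernel_times_id: "v > 0 \<Longrightarrow> kernel s e v * of_real v = kernel (s + 1) e v"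
  using powr_add[of "complex_of_real v" "s - 1" 1] by (simp add: kernel_def algebra_simps)

text \<open>These sums give the value and, up to the factor \<open>s - 1\<close>, the slope at 0 of
  the two unsubtracted powers in \<open>F 1\<close>. They are the source of the sine and cosine in
  the formula.\<close>

lemma i_powr_sums:
  "\<i> powr (s - 1) + (- \<i>) powr (s - 1) = 2 * sin (of_real pi * s / 2)"
  "\<i> powr (s - 2) + (- \<i>) powr (s - 2) = - 2 * cos (of_real pi * s / 2)"
proof -
  define w where "w = exp (\<i> * (of_real pi * s / 2))"
  have w: "w \<noteq> 0" by (simp add: w_def)
  have e1: "exp (\<i> * of_real pi / 2) = \<i>" using exp_Ln[of \<i>] by simp
  have e2: "exp (- (\<i> * of_real pi / 2)) = - \<i>" unfolding exp_minus e1 by simp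
  note e = e1 e2
  have 1: "\<i> powr (s - 1) = w * - \<i>"
  proof -
    have "(s - 1) * Ln \<i> = \<i> * (of_real pi * s / 2) + - (\<i> * of_real pi / 2)" by (simp add: field_simps)
    thus ?thesis unfolding w_def by (simp only: powr_def exp_add e) simp
  qed
  have 2: "(- \<i>) powr (s - 1) = inverse w * \<i>"
  proof -
    have "(s - 1) * Ln (- \<i>) = - (\<i> * (of_real pi * s / 2)) + \<i> * of_real pi / 2" by (simp add: field_simps)
    thus ?thesis unfolding w_def by (simp only: powr_def exp_add exp_minus e) simp
  qed
  have ii: "\<i> * (u * \<i>) = - u" for u by (simp add: complex_eq_iff)
  have 3: "\<i> powr (s - 2) = - w" using powr_minus_2_eq[of \<i> s] by (simp add: 1 ii)
  have 4: "(- \<i>) powr (s - 2) = - inverse w" using powr_minus_2_eq[of "- \<i>" s] by (simp add: 2 ii)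
  have sn: "sin (of_real pi * s / 2) = (w - inverse w) / (2 * \<i>)" and cs: "cos (of_real pi * s / 2) = (w + inverse w) / 2"
    unfolding w_def sin_exp_eq cos_exp_eq exp_minus by simp_all
  have "2 * ((w - inverse w) / (2 * \<i>)) = (w - inverse w) / \<i>" by simp
  also have "\<dots> = w * - \<i> + inverse w * \<i>" by (simp add: divide_i algebra_simps)
  finally show "\<i> powr (s - 1) + (- \<i>) powr (s - 1) = 2 * sin (of_real pi * s / 2)"
    unfolding 1 2 sn by (rule sym)
  show "\<i> powr (s - 2) + (- \<i>) powr (s - 2) = - 2 * cos (of_real pi * s / 2)"
    unfolding 3 4 cs by simp
qed

lemma exp_i_pi_nat: "exp (\<i> * of_real (pi * real n)) = (- 1) ^ n" "exp (- \<i> * of_real (pi * real n)) = (- 1) ^ n"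
proof -
  have "exp (\<i> * of_real (pi * real n)) = exp (of_nat n * (of_real pi * \<i>))" by (simp add: mult_ac)
  also have "\<dots> = exp (of_real pi * \<i>) ^ n" by (rule exp_of_nat_mult)
  finally show 1: "exp (\<i> * of_real (pi * real n)) = (- 1) ^ n" by (simp add: exp_pi_i)
  have "exp (- \<i> * of_real (pi * real n)) = inverse (exp (\<i> * of_real (pi * real n)))"
    by (simp only: exp_minus[symmetric] mult_minus_left)
  thus "exp (- \<i> * of_real (pi * real n)) = (- 1) ^ n" unfolding 1 by (simp add: power_inverse[symmetric])
qed

lemma sin_cos_half_neq_0:
  fixes s :: complex
  assumes "s \<notin> \<int>"
  shows "sin (of_real pi * s / 2) \<noteq> 0" "cos (of_real pi * s / 2) \<noteq> 0"
proof -
  have "sin (of_real pi * s) = 2 * sin (of_real pi * s / 2) * cos (of_real pi * s / 2)"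
    using sin_double[of "of_real pi * s / 2"] by simp
  thus "sin (of_real pi * s / 2) \<noteq> 0" "cos (of_real pi * s / 2) \<noteq> 0"
    using sin_pi_neq_0[OF assms] by auto
qed

text \<open>What is left of \<open>hankel_p s x + hankel_m s x\<close> at \<open>x = pi * n\<close>
  once the common factor \<open>(- 1) ^ n\<close> is taken out.\<close>

definition hankel_sum :: "complex \<Rightarrow> nat \<Rightarrow> complex" where
  "hankel_sum s n = \<i> powr (s - 1) * hankel_int s (- \<i> / of_real (2 * (pi * real n))) +
     (- \<i>) powr (s - 1) * hankel_int s (\<i> / of_real (2 * (pi * real n)))"

text \<open>For a single integral the pieces of \<open>F 1\<close> may be separated, each being
  integrable against the kernel: two Hankel integrals, and Gamma integrals at \<open>s\<close> and
  \<open>s + 1\<close> from the subtracted polynomial.\<close>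

lemma pair_int_eq_hankel:
  fixes n :: nat
  assumes n: "n > 0" and s: "1 < Re s" "Re s < 2"
  shows "pair_int s 1 (real n) = of_real (2 * pi * real n) powr (- s) * Gamma s *
    (hankel_sum s n - 2 * sin (of_real pi * s / 2) + 2 * (s - 1) * cos (of_real pi * s / 2) * s / of_real (2 * pi * real n))"
proof -
  define y where "y = complex_of_real (2 * pi * real n)"
  let ?sn = "sin (of_real pi * s / 2)" and ?cs = "cos (of_real pi * s / 2)"
  have n0: "real n > 0" using n by simp
  have s0: "Re s > 0" "Re (s + 1) > 0" using s by simp_all
  note k = kernel_hankel[OF n s0(1)]
  have I: "has_bochner_integral lhalf (\<lambda>u. kernel s (real n) u * (of_real u + \<i>) powr (s - 1) + kernel s (real n) u * (of_real u + - \<i>) powr (s - 1)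
       - kernel s (real n) u * (2 * ?sn) - kernel (s + 1) (real n) u * ((s - 1) * (- 2 * ?cs)))
     (y powr (- s) * Gamma s * (\<i> powr (s - 1) * hankel_int s (- \<i> / of_real (2 * (pi * real n)))) +
      y powr (- s) * Gamma s * ((- \<i>) powr (s - 1) * hankel_int s (- (- \<i>) / of_real (2 * (pi * real n)))) -
      Gamma s * y powr (- s) * (2 * ?sn) - Gamma (s + 1) * y powr (- (s + 1)) * ((s - 1) * (- 2 * ?cs)))"
    unfolding y_def
    by (intro has_bochner_integral_diff has_bochner_integral_add has_bochner_integral_mult_left k
        kernel_integral s0 n0) auto
  moreover have "kernel s (real n) u * (of_real u + \<i>) powr (s - 1) + kernel s (real n) u * (of_real u + - \<i>) powr (s - 1)
       - kernel s (real n) u * (2 * ?sn) - kernel (s + 1) (real n) u * ((s - 1) * (- 2 * ?cs)) =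
      kernel s (real n) u * pair_term s 1 (of_real u)" if "u \<in> space lhalf" for u
  proof -
    have u: "u > 0" using that by simp
    show ?thesis unfolding kernel_times_id[OF u, symmetric] i_powr_sums[symmetric]
      by (simp add: pair_term_def tay_def algebra_simps)
  qed
  ultimately have "has_bochner_integral lhalf (\<lambda>u. kernel s (real n) u * pair_term s 1 (of_real u))
     (y powr (- s) * Gamma s * (\<i> powr (s - 1) * hankel_int s (- \<i> / of_real (2 * (pi * real n)))) +
      y powr (- s) * Gamma s * ((- \<i>) powr (s - 1) * hankel_int s (- (- \<i>) / of_real (2 * (pi * real n)))) -
      Gamma s * y powr (- s) * (2 * ?sn) - Gamma (s + 1) * y powr (- (s + 1)) * ((s - 1) * (- 2 * ?cs)))"
    by (subst has_bochner_integral_cong[OF refl _ refl, symmetric]) 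
  from has_bochner_integral_eq[OF pair_int(1)[OF order_refl n0 s] this]
  have h1: "pair_int s 1 (real n) = y powr (- s) * Gamma s * (hankel_sum s n - 2 * ?sn) + 2 * (s - 1) * ?cs * (Gamma (s + 1) * y powr (- (s + 1)))"
    by (simp add: hankel_sum_def algebra_simps)
  have h2: "Gamma (s + 1) = s * Gamma s"
    using Gamma_plus1[of s] Gamma_neq_0[OF s0(1)] by (auto simp: Gamma_eq_zero_iff)
  have h3: "y powr (- (s + 1)) = y powr (- s) / y"
    using powr_diff[of y "- s" 1] n by (simp add: y_def)
  show ?thesis unfolding h1 h2 h3 y_def[symmetric]
    by (simp add: algebra_simps add_divide_distrib diff_divide_distrib)
qed

lemma Bessel_bracket_eq_pair_int:
  fixes n :: nat
  assumes n: "n > 0" and s: "1 < Re s" "Re s < 2"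
  shows "1 / of_real (sqrt (real n))
           + of_real (pi / sqrt 2) * ((- 1) ^ n / sin (of_real pi * s / 2))
               * Bessel_Y (s - 1 / 2) (of_real (pi * real n))
           + s * (1 - s) / of_real (2 * pi * real n powr (3 / 2)) * cot (of_real pi * s / 2) =
     - (of_real (2 * pi * real n) powr s / (2 * Gamma s * sin (of_real pi * s / 2)) / of_real (sqrt (real n)) * pair_int s 1 (real n))"
proof -
  let ?sn = "sin (of_real pi * s / 2)" and ?cs = "cos (of_real pi * s / 2)"
  define r where "r = complex_of_real (sqrt (real n))"
  define q where "q = complex_of_real (sqrt 2)"
  define p where "p = complex_of_real pi"
  define N where "N = complex_of_real (real n)"
  define H where "H = hankel_sum s n"
  define y where "y = complex_of_real (2 * pi * real n)"
  have nz: "r \<noteq> 0" "q \<noteq> 0" "p \<noteq> 0" "N \<noteq> 0" "y \<noteq> 0" using n by (simp_all add: r_def q_def p_def N_def y_def)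
  have sn: "?sn \<noteq> 0" by (rule sin_cos_half_neq_0(1)[OF notin_Ints_strip[OF s]])
  have G: "Gamma s \<noteq> 0" using s by (intro Gamma_neq_0) simp
  have x: "pi * real n > 0" using n by simp
  have "real n powr (1 + 1 / 2) = real n * sqrt (real n)" unfolding powr_add by (simp add: powr_half_sqrt)
  moreover have "1 + 1 / 2 = (3 / 2 :: real)" by simp
  ultimately have n32: "real n powr (3 / 2) = real n * sqrt (real n)" by (simp only:)
  have hc: "hankel_const (pi * real n) = 1 / (p * q * r)"
  proof -
    have "sqrt (2 * pi * (pi * real n)) = pi * sqrt 2 * sqrt (real n)"
      by (simp add: real_sqrt_mult mult_ac)
    thus ?thesis by (simp add: hankel_const_def p_def q_def r_def)
  qed
  have Y: "Bessel_Y (s - 1 / 2) (of_real (pi * real n)) = - ((- 1) ^ n * H / (p * q * r))"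
  proof -
    have "Bessel_Y (s - 1 / 2) (of_real (pi * real n)) = - (hankel_const (pi * real n) * (hankel_p (s - 1/2 + 1/2) (pi * real n) + hankel_m (s - 1/2 + 1/2) (pi * real n)))"
      by (rule Bessel_Y_eq_hankel[OF x]) (use s in simp)
    also have "s - 1/2 + 1/2 = s" by simp
    also have "hankel_p s (pi * real n) + hankel_m s (pi * real n) = (- 1) ^ n * H"
      unfolding hankel_p_def hankel_m_def exp_i_pi_nat H_def hankel_sum_def by (simp only: ring_distribs mult_ac)
    finally show ?thesis unfolding hc by simp
  qed
  \<comment> \<open>The sign written in the series meets the sign from
    \<open>exp (\<plusminus> \<i> * pi * n)\<close> in Hankel's formula.\<close>
  have m1: "(- 1) ^ n * ((- 1) ^ n * u) = (u :: complex)" for u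
    by (simp add: mult.assoc[symmetric] flip: power_mult_distrib)
  have yN: "y = 2 * p * N" by (simp add: y_def p_def N_def)
  have "1 / r + p / q * ((- 1) ^ n / ?sn) * - ((- 1) ^ n * H / (p * q * r)) + s * (1 - s) / (2 * p * (N * r)) * (?cs / ?sn)
     = 1 / r - ((- 1) ^ n * ((- 1) ^ n * H)) / (q * q * ?sn * r) + s * (1 - s) * ?cs / (y * r * ?sn)"
    using nz sn unfolding yN by (simp add: field_simps)
  also have "\<dots> = 1 / r - H / (2 * ?sn * r) + s * (1 - s) * ?cs / (y * r * ?sn)"
    unfolding m1 by (simp add: q_def flip: of_real_mult)
  also have "\<dots> = - (1 / (2 * ?sn) / r * (H - 2 * ?sn + 2 * (s - 1) * ?cs * s / y))"
    using nz sn by (simp add: field_simps)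
  also have "\<dots> = - (y powr s / (2 * Gamma s * ?sn) / r * (y powr (- s) * Gamma s * (H - 2 * ?sn + 2 * (s - 1) * ?cs * s / y)))"
  proof -
    have "y powr s * y powr (- s) = 1" using nz by (simp flip: powr_add)
    hence "y powr s / (2 * Gamma s * ?sn) / r * (y powr (- s) * Gamma s * u) = 1 / (2 * ?sn) / r * u" for u
      using G sn nz by (simp add: powr_minus field_simps)
    thus ?thesis by simp
  qed
  finally show ?thesis
    unfolding Y n32 pair_int_eq_hankel[OF n s] cot_def
    by (simp add: r_def q_def p_def N_def H_def y_def)
qed

text \<open>The divisor weights enter through \<open>pair_int_scale\<close>. All powers of
  \<open>n\<close> cancel, since \<open>n powr (s - 1 / 2)\<close> times the square root of
  \<open>n\<close> is \<open>n powr s\<close>.\<close>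

lemma summand_eq_pair_int_sum:
  fixes n :: nat
  assumes n: "n > 0" and s: "1 < Re s" "Re s < 2"
  shows "divisor_sigma (2 * s - 1) n / of_nat n powr (s - 1 / 2) *
     (1 / of_real (sqrt (real n))
           + of_real (pi / sqrt 2) * ((- 1) ^ n / sin (of_real pi * s / 2))
               * Bessel_Y (s - 1 / 2) (of_real (pi * real n))
           + s * (1 - s) / of_real (2 * pi * real n powr (3 / 2)) * cot (of_real pi * s / 2)) =
    - (of_real (2 * pi) powr s / (2 * Gamma s * sin (of_real pi * s / 2))) *
      (\<Sum>d | d dvd n. pair_int s (real d) (real (n div d)))"
proof -
  define N where "N = complex_of_nat n"
  define r where "r = complex_of_real (sqrt (real n))"
  have N: "N \<noteq> 0" "r \<noteq> 0" using n by (simp_all add: N_def r_def)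
  have "complex_of_nat n powr (1 / 2) = of_real (real n powr (1 / 2))"
    using powr_of_real[of "real n" "1/2"] by simp
  hence "N powr (1 / 2) = r" by (simp add: N_def r_def powr_half_sqrt)
  hence "N powr (s - 1 / 2) * r = N powr (s - 1 / 2 + 1 / 2)" by (simp only: powr_add)
  hence Nr: "N powr (s - 1 / 2) * r = N powr s" by simp
  have "complex_of_real (2 * pi * real n) powr s = of_real (2 * pi) powr s * N powr s"
    using powr_mult_of_real[of "2 * pi" N s] N by (simp add: N_def)
  hence y: "complex_of_real (2 * pi * real n) powr s = of_real (2 * pi) powr s * (N powr (s - 1 / 2) * r)"
    unfolding Nr .
  have "divisor_sigma (2 * s - 1) n * pair_int s 1 (real n) = (\<Sum>d | d dvd n. pair_int s (real d) (real (n div d)))"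
    unfolding divisor_sigma_def sum_distrib_right
  proof (intro sum.cong refl)
    fix d assume "d \<in> {d. d dvd n}"
    then obtain e where e: "n = d * e" by (auto elim: dvdE)
    hence de: "d > 0" "e > 0" using n by auto
    hence "pair_int s (real d) (real e) = of_real (real d) powr (2 * s - 1) * pair_int s 1 (real d * real e)"
      by (intro pair_int_scale s) auto
    thus "of_nat d powr (2 * s - 1) * pair_int s 1 (real n) = pair_int s (real d) (real (n div d))"
      using e de by simp
  qed
  moreover have "N powr (s - 1 / 2) \<noteq> 0" using N by simp
  ultimately show ?thesis
    unfolding Bessel_bracket_eq_pair_int[OF n s] unfolding y N_def[symmetric] r_def[symmetric] using N(2)
    by (simp add: field_simps)
qed

section \<open>Summation by columns and the evaluation of the double series\<close>

lemma sums_Suc_powr_scaled: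
  assumes z: "Re z > 1"
  shows "(\<lambda>l. of_real (2 * pi * real (Suc l)) powr (- z)) sums (of_real (2 * pi) powr (- z) * zeta z)"
proof -
  have "(\<lambda>l. of_nat (Suc l) powr (- z)) sums zeta z"
    unfolding zeta_eq_dirichlet[OF z] dirichlet_zeta_def
    by (rule summable_sums[OF summable_norm_cancel[OF summable_norm_Suc_powr[OF z]]])
  moreover have "complex_of_real (2 * pi * real (Suc l)) powr (- z) = of_real (2 * pi) powr (- z) * of_nat (Suc l) powr (- z)" for l
    using powr_mult_of_real[of "2 * pi" "of_nat (Suc l)" "- z"] by (simp del: of_nat_Suc)
  ultimately show ?thesis by (simp only: sums_mult)
qed

text \<open>The summand splits because \<open>m\<^sup>2 + m * n = m * (m + n)\<close>. From
  \<open>m + n \<ge> n\<close> follows a product majorant, so the order of summation can be reversed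
  to match the columns of the double sum.\<close>

lemma L2_sums:
  assumes s: "Re s > 1"
  shows "(\<lambda>l. \<Sum>n. of_nat (Suc n) powr (- s) * of_nat (Suc n + Suc l) powr (- s)) sums L2 s"
proof -
  have "(\<lambda>l. \<Sum>n. of_nat (Suc n) powr (- s) * complex_of_nat (Suc n + Suc l) powr (- s)) sums
      (\<Sum>n. \<Sum>l. of_nat (Suc n) powr (- s) * complex_of_nat (Suc n + Suc l) powr (- s))"
  proof (rule double_series_sums(2))
    show "norm (of_nat (Suc n) powr (- s) * complex_of_nat (Suc n + Suc l) powr (- s)) \<le> real (Suc n) powr (- Re s) * real (Suc l) powr (- Re s)" for n l
    proof -
      have "norm (complex_of_nat (Suc n + Suc l) powr (- s)) = real (Suc n + Suc l) powr (- Re s)"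
        using norm_Suc_powr[of "n + Suc l" "- s"] by simp
      also have "\<dots> \<le> real (Suc l) powr (- Re s)" using s by (intro powr_mono2') auto
      finally show ?thesis unfolding norm_mult norm_Suc_powr by (simp add: mult_left_mono)
    qed
    show "summable (\<lambda>n. real (Suc n) powr (- Re s))" using s by (intro summable_Suc_powr) simp
    thus "summable (\<lambda>n. real (Suc n) powr (- Re s))" .
  qed auto
  moreover have "of_nat (Suc n) powr (- s) * complex_of_nat (Suc n + Suc l) powr (- s) = of_nat ((Suc n)\<^sup>2 + Suc n * Suc l) powr (- s)" for n l
  proof -
    have "of_nat ((Suc n)\<^sup>2 + Suc n * Suc l) = complex_of_real (real (Suc n)) * of_nat (Suc n + Suc l)"
      by (simp add: power2_eq_square algebra_simps)
    moreover have "(complex_of_real (real (Suc n)) * of_nat (Suc n + Suc l)) powr (- s) = of_real (real (Suc n)) powr (- s) * of_nat (Suc n + Suc l) powr (- s)"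
      by (rule powr_mult_of_real) (simp_all del: of_nat_Suc of_nat_add)
    ultimately show ?thesis by (simp del: of_nat_Suc of_nat_add)
  qed
  ultimately show ?thesis unfolding L2_def by (simp only:)
qed

text \<open>Summation over \<open>k\<close> under the integral inserts \<open>pair_sum_eq\<close>.
  In its first term the exponentials of kernel and series merge into decay rate
  \<open>2 * pi * (Suc n + e)\<close>; the other terms are single Gamma integrals. Summed over
  \<open>e\<close>, the four terms become multiples of \<open>L2 s\<close>, \<zeta>(2s - 1),
  \<zeta>(s)^2 and \<zeta>(s - 1) \<zeta>(s + 1).\<close>

lemma pair_int_column_sum:
  assumes s: "1 < Re s" "Re s < 2" and e: "e = real (Suc l)"
  defines "P \<equiv> of_real (2 * pi) powr (1 - s) / Gamma (1 - s)"
  shows "(\<Sum>k. pair_int s (real (Suc k)) e) =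
      P * (Gamma s * of_real (2 * pi) powr (- s) * (\<Sum>n. of_nat (Suc n) powr (- s) * of_nat (Suc n + Suc l) powr (- s)))
      - Gamma (2 * s - 1) * of_real (2 * pi * e) powr (- (2 * s - 1))
      - Gamma s * of_real (2 * pi * e) powr (- s) * (P * zeta s)
      + Gamma (s + 1) * of_real (2 * pi * e) powr (- (s + 1)) * (of_real (2 * pi) * P * zeta (s - 1))"
proof -
  have e0: "e > 0" using e by simp
  have A: "has_bochner_integral lhalf (\<lambda>v. kernel s e v * pair_sum tay s (of_real v)) (\<Sum>k. pair_int s (real (Suc k)) e)"
  proof (rule has_bochner_integral_sums(1))
    show "has_bochner_integral lhalf (\<lambda>v. kernel s e v * pair_term s (real (Suc k)) (of_real v)) (pair_int s (real (Suc k)) e)" for k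
      using e0 s by (intro pair_int(1)) auto
    show "(\<lambda>k. kernel s e v * pair_term s (real (Suc k)) (of_real v)) sums (kernel s e v * pair_sum tay s (of_real v))" if "v \<in> space lhalf" for v
    proof -
      have h: "complex_of_real v \<in> half_strip" using that by (intro real_in_half_strip) simp
      have "(\<lambda>k. pair_term s (real (Suc k)) (of_real v)) sums pair_sum tay s (of_real v)"
        unfolding pair_term_def pair_sum_def by (intro summable_sums summable_pair(1)[where j = "2 :: nat", OF s(2) h]) simp
      thus ?thesis by (rule sums_mult)
    qed
    show "norm (kernel s e v * pair_term s (real (Suc k)) (of_real v)) \<le>
       (2 * tay_const s * real (Suc k) powr (Re s - 3)) * (v powr (Re s + 2 - 1) * exp (- (2 * pi * e * v)))"
      if "v \<in> space lhalf" for v k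
      using that e0 s by (intro pair_int(3)) auto
    show "integrable lhalf (\<lambda>v. v powr (Re s + 2 - 1) * exp (- (2 * pi * e * v)))"
      using has_bochner_integral_Gamma_real[of "Re s + 2" "2 * pi * e"] e0 s by (simp add: has_bochner_integral_iff)
    show "summable (\<lambda>k. 2 * tay_const s * real (Suc k) powr (Re s - 3))"
      using s by (intro summable_mult summable_Suc_powr) simp
  qed
  have s0: "Re s > 0" using s by simp
  let ?I = "\<lambda>n. of_nat (Suc n) powr (- s) * (Gamma s * of_real (2 * pi * (real (Suc n) + e)) powr (- s))"
  have B: "has_bochner_integral lhalf (\<lambda>v. kernel s e v * exp_series (- s) (of_real v)) (\<Sum>n. ?I n)" and Is: "summable ?I"
  proof -
    have hb: "has_bochner_integral lhalf (\<lambda>v. of_nat (Suc n) powr (- s) * kernel s (real (Suc n) + e) v) (?I n)" for n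
      using e0 by (intro has_bochner_integral_mult_right kernel_integral s0) auto
    have sm: "(\<lambda>n. of_nat (Suc n) powr (- s) * kernel s (real (Suc n) + e) v) sums (kernel s e v * exp_series (- s) (of_real v))"
      if "v \<in> space lhalf" for v
    proof -
      have v: "v > 0" using that by simp
      have "summable (\<lambda>n. norm (of_nat (Suc n) powr (- s) * exp (- (of_real (2 * pi * real (Suc n)) * complex_of_real v))))"
        unfolding norm_exp_series_term using summable_powr_exp[of "Re (- s)" v] v s0 by simp
      hence "(\<lambda>n. of_nat (Suc n) powr (- s) * exp (- (of_real (2 * pi * real (Suc n)) * complex_of_real v))) sums exp_series (- s) (of_real v)"
        unfolding exp_series_def by (rule summable_sums[OF summable_norm_cancel])
      from sums_mult[OF this, of "kernel s e v"]
      have "(\<lambda>n. kernel s e v * (of_nat (Suc n) powr (- s) * exp (- (of_real (2 * pi * real (Suc n)) * complex_of_real v)))) sums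
         (kernel s e v * exp_series (- s) (of_real v))" .
      moreover have "kernel s e v * (of_nat (Suc n) powr (- s) * exp (- (of_real (2 * pi * real (Suc n)) * complex_of_real v))) =
         of_nat (Suc n) powr (- s) * kernel s (real (Suc n) + e) v" for n
      proof -
        have "- (complex_of_real (2 * pi * (real (Suc n) + e)) * of_real v) = - (of_real (2 * pi * e) * of_real v) + - (of_real (2 * pi * real (Suc n)) * of_real v)"
          by (simp add: algebra_simps)
        thus ?thesis unfolding kernel_def by (simp only: exp_add mult_ac)
      qed
      ultimately show ?thesis by (simp only:)
    qed
    have bd: "norm (of_nat (Suc n) powr (- s) * kernel s (real (Suc n) + e) v) \<le>
        real (Suc n) powr (- Re s) * (v powr (Re s - 1) * exp (- (2 * pi * e * v)))" if "v \<in> space lhalf" for n v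
    proof -
      have v: "v > 0" using that by simp
      have "2 * pi * e * v \<le> 2 * pi * (real (Suc n) + e) * v"
        using v by (intro mult_right_mono mult_left_mono) auto
      hence "exp (- (2 * pi * (real (Suc n) + e) * v)) \<le> exp (- (2 * pi * e * v))" by simp
      thus ?thesis unfolding norm_mult norm_Suc_powr norm_kernel[OF v] by (simp add: mult_left_mono)
    qed
    have Gi: "integrable lhalf (\<lambda>v. v powr (Re s - 1) * exp (- (2 * pi * e * v)))"
      using has_bochner_integral_Gamma_real[of "Re s" "2 * pi * e"] e0 s0 by (simp add: has_bochner_integral_iff)
    have Bs: "summable (\<lambda>n. real (Suc n) powr (- Re s))" using s by (intro summable_Suc_powr) simp
    show "has_bochner_integral lhalf (\<lambda>v. kernel s e v * exp_series (- s) (of_real v)) (\<Sum>n. ?I n)"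
      by (rule has_bochner_integral_sums(1)[OF hb sm bd Gi Bs])
    show "summable ?I" by (rule has_bochner_integral_sums(2)[OF hb sm bd Gi Bs])
  qed
  have K1: "has_bochner_integral lhalf (kernel (2 * s - 1) e) (Gamma (2 * s - 1) * of_real (2 * pi * e) powr (- (2 * s - 1)))"
    and K2: "has_bochner_integral lhalf (kernel s e) (Gamma s * of_real (2 * pi * e) powr (- s))"
    and K3: "has_bochner_integral lhalf (kernel (s + 1) e) (Gamma (s + 1) * of_real (2 * pi * e) powr (- (s + 1)))"
    using s e0 by (intro kernel_integral; simp)+
  have "has_bochner_integral lhalf (\<lambda>v. P * (kernel s e v * exp_series (- s) (of_real v)) - kernel (2 * s - 1) e v
      - kernel s e v * (P * zeta s) + kernel (s + 1) e v * (of_real (2 * pi) * P * zeta (s - 1)))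
    (P * (\<Sum>n. ?I n) - Gamma (2 * s - 1) * of_real (2 * pi * e) powr (- (2 * s - 1))
      - Gamma s * of_real (2 * pi * e) powr (- s) * (P * zeta s)
      + Gamma (s + 1) * of_real (2 * pi * e) powr (- (s + 1)) * (of_real (2 * pi) * P * zeta (s - 1)))"
    by (intro has_bochner_integral_add has_bochner_integral_diff has_bochner_integral_mult_left
        has_bochner_integral_mult_right B K1 K2 K3)
  moreover have "P * (kernel s e v * exp_series (- s) (of_real v)) - kernel (2 * s - 1) e v
      - kernel s e v * (P * zeta s) + kernel (s + 1) e v * (of_real (2 * pi) * P * zeta (s - 1)) =
     kernel s e v * pair_sum tay s (of_real v)" if "v \<in> space lhalf" for v
  proof -
    have v: "v > 0" using that by simp
    \<comment> \<open>The subtracted \<open>v powr (s - 1)\<close> turns the kernel into that of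
      parameter \<open>2 * s - 1\<close>.\<close>
    have k: "kernel (2 * s - 1) e v = kernel s e v * of_real v powr (s - 1)"
      using powr_add[of "complex_of_real v" "s - 1" "s - 1"] by (simp add: kernel_def algebra_simps)
    show ?thesis unfolding pair_sum_eq[OF s v] P_def[symmetric] k kernel_times_id[OF v, symmetric]
      by (simp add: algebra_simps)
  qed
  ultimately have "has_bochner_integral lhalf (\<lambda>v. kernel s e v * pair_sum tay s (of_real v))
    (P * (\<Sum>n. ?I n) - Gamma (2 * s - 1) * of_real (2 * pi * e) powr (- (2 * s - 1))
      - Gamma s * of_real (2 * pi * e) powr (- s) * (P * zeta s)
      + Gamma (s + 1) * of_real (2 * pi * e) powr (- (s + 1)) * (of_real (2 * pi) * P * zeta (s - 1)))"
    by (subst has_bochner_integral_cong[OF refl _ refl, symmetric])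
  from has_bochner_integral_eq[OF A this]
  have eq: "(\<Sum>k. pair_int s (real (Suc k)) e) = P * (\<Sum>n. ?I n) - Gamma (2 * s - 1) * of_real (2 * pi * e) powr (- (2 * s - 1))
      - Gamma s * of_real (2 * pi * e) powr (- s) * (P * zeta s)
      + Gamma (s + 1) * of_real (2 * pi * e) powr (- (s + 1)) * (of_real (2 * pi) * P * zeta (s - 1))" .
  let ?J = "\<lambda>n. of_nat (Suc n) powr (- s) * complex_of_nat (Suc n + Suc l) powr (- s)"
  have I: "?I n = (Gamma s * of_real (2 * pi) powr (- s)) * ?J n" for n
  proof -
    have "complex_of_real (2 * pi * (real (Suc n) + e)) = of_real (2 * pi) * of_nat (Suc n + Suc l)" by (simp add: e)
    moreover have "(complex_of_real (2 * pi) * of_nat (Suc n + Suc l)) powr (- s) = of_real (2 * pi) powr (- s) * of_nat (Suc n + Suc l) powr (- s)"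
      by (rule powr_mult_of_real) (simp_all del: of_nat_Suc of_nat_add)
    ultimately show ?thesis by (simp only: mult_ac)
  qed
  have c0: "Gamma s * complex_of_real (2 * pi) powr (- s) \<noteq> 0" using Gamma_neq_0[OF s0] by simp
  have "summable ?J" using Is unfolding I by (rule summable_mult_D[OF _ c0])
  hence "(\<Sum>n. ?I n) = Gamma s * of_real (2 * pi) powr (- s) * (\<Sum>n. ?J n)" unfolding I by (rule suminf_mult)
  thus ?thesis unfolding eq by (simp only:)
qed

text \<open>Here \<open>p\<close> is 2 pi and \<open>X\<close> its power \<open>s\<close>;
  \<open>z\<close>, \<open>z2\<close>, \<open>zp\<close>, \<open>zm\<close> are the zeta values at
  \<open>s\<close>, \<open>2 * s - 1\<close>, \<open>s + 1\<close>, \<open>s - 1\<close>. The double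
  sum \<open>S\<close> is linear in \<open>L\<close> and proportional to the Bessel series
  \<open>A\<close>; solving for \<open>L\<close> brings sine and cosine together, where
  \<open>refl\<close> absorbs them.\<close>

lemma L2_from_pair_int_sum:
  fixes X p G1 Gs si co P S L :: complex
  assumes nz: "X \<noteq> 0" "p \<noteq> 0" "G1 \<noteq> 0" "Gs \<noteq> 0" "si \<noteq> 0" "co \<noteq> 0"
    and refl: "Gs * G1 * (4 * si * co) = p"
    and S: "S = p / X / G1 * (Gs * (1 / X) * L) - G2 * (p / X\<^sup>2 * z2) - Gs * (1 / X * z) * (p / X / G1 * z)
       + s * Gs * (1 / (p * X) * zp) * (p * (p / X / G1) * zm)"
    and A: "A = - (X / (2 * Gs * si)) * S"
  shows "L = z\<^sup>2 - s * zm * zp + G1 * G2 * z2 / Gs - X / (2 * Gs * co) * A"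
proof -
  have "X / (2 * Gs * co) * A = - (X\<^sup>2 * G1 / (Gs * (Gs * G1 * (4 * si * co)))) * S"
    unfolding A using nz by (simp add: field_simps power2_eq_square)
  also have "\<dots> = - (X\<^sup>2 * G1 / (Gs * p)) * S" unfolding refl ..
  also have "X\<^sup>2 * G1 / (Gs * p) * S = L - G1 * G2 * z2 / Gs - z\<^sup>2 + s * zm * zp"
    unfolding S using nz by (simp add: field_simps power2_eq_square)
  hence "- (X\<^sup>2 * G1 / (Gs * p)) * S = - (L - G1 * G2 * z2 / Gs - z\<^sup>2 + s * zm * zp)" by simp
  finally show ?thesis by simp
qed


theorem theorem1p10:
  fixes s :: complex
  assumes "1 < Re s" and "Re s < 2"
  shows
    "let a = (\<lambda>n::nat.
        divisor_sigma (2 * s - 1) n / of_nat n powr (s - 1 / 2) *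
          (1 / of_real (sqrt (real n))
           + of_real (pi / sqrt 2) * ((- 1) ^ n / sin (of_real pi * s / 2))
               * Bessel_Y (s - 1 / 2) (of_real (pi * real n))
           + s * (1 - s) / of_real (2 * pi * real n powr (3 / 2)) * cot (of_real pi * s / 2)))
     in summable (\<lambda>n. a (Suc n)) \<and>
        L2 s = (zeta s)\<^sup>2 - s * zeta (s - 1) * zeta (s + 1)
          + Gamma (1 - s) * Gamma (2 * s - 1) * zeta (2 * s - 1) / Gamma s
          - of_real (2 * pi) powr s / (2 * Gamma s * cos (of_real pi * s / 2))
              * (\<Sum>n. a (Suc n))"
proof -
  note s = assms
  let ?sn = "sin (of_real pi * s / 2)" and ?cs = "cos (of_real pi * s / 2)"
  define p where "p = complex_of_real (2 * pi)"
  define X where "X = p powr s"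
  define P where "P = p powr (1 - s) / Gamma (1 - s)"
  have nz: "p \<noteq> 0" "X \<noteq> 0" by (simp_all add: p_def X_def)
  have sc: "?sn \<noteq> 0" "?cs \<noteq> 0" by (rule sin_cos_half_neq_0[OF notin_Ints_strip[OF s]])+
  have Gs: "Gamma s \<noteq> 0" using s by (intro Gamma_neq_0) simp
  \<comment> \<open>The double angle splits the sine of the reflection formula: the half-angle sine
    belongs to the terms of the series, the half-angle cosine to its prefactor.\<close>
  have reflection: "Gamma s * Gamma (1 - s) * (4 * ?sn * ?cs) = p"
  proof -
    have "sin (of_real pi * s) = 2 * ?sn * ?cs" using sin_double[of "of_real pi * s / 2"] by simp
    hence "Gamma s * Gamma (1 - s) = of_real pi / (2 * ?sn * ?cs)" using Gamma_reflection_complex[of s] by simp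
    thus ?thesis using sc by (simp add: p_def field_simps)
  qed
  hence G1: "Gamma (1 - s) \<noteq> 0" using nz by auto
  define H where "H k l = pair_int s (real (Suc k)) (real (Suc l))" for k l
  define S where "S = (\<Sum>k. \<Sum>l. H k l)"
  have H_le: "norm (H k l) \<le> (2 * tay_const s * real (Suc k) powr (Re s - 3)) *
      (Gamma (Re s + 2) * (2 * pi * real (Suc l)) powr (- (Re s + 2)))" for k l
    unfolding H_def by (intro pair_int(2) s) auto
  have A: "summable (\<lambda>k. 2 * tay_const s * real (Suc k) powr (Re s - 3))"
    using s by (intro summable_mult summable_Suc_powr) simp
  have B: "summable (\<lambda>l. Gamma (Re s + 2) * (2 * pi * real (Suc l)) powr (- (Re s + 2)))"
    unfolding powr_mult[of "2 * pi"] using s by (intro summable_mult summable_Suc_powr) simp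
  have A0: "0 \<le> 2 * tay_const s * real (Suc k) powr (Re s - 3)" for k by (simp add: tay_const_def)
  have B0: "0 \<le> Gamma (Re s + 2) * (2 * pi * real (Suc l)) powr (- (Re s + 2))" for l
    using Gamma_real_pos[of "Re s + 2"] s by simp
  note double = double_series_sums[OF H_le A B A0 B0, folded S_def]
  define a where "a = (\<lambda>n::nat.
        divisor_sigma (2 * s - 1) n / of_nat n powr (s - 1 / 2) *
          (1 / of_real (sqrt (real n))
           + of_real (pi / sqrt 2) * ((- 1) ^ n / sin (of_real pi * s / 2))
               * Bessel_Y (s - 1 / 2) (of_real (pi * real n))
           + s * (1 - s) / of_real (2 * pi * real n powr (3 / 2)) * cot (of_real pi * s / 2)))"
  \<comment> \<open>First evaluation of the double sum: grouped by the product
    \<open>d * e = Suc n\<close> it is the Bessel series, whose convergence follows as well.\<close>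
  have "(\<lambda>n. - (X / (2 * Gamma s * ?sn)) * (\<Sum>d | d dvd Suc n. H (d - 1) (Suc n div d - 1))) sums (- (X / (2 * Gamma s * ?sn)) * S)"
    by (intro sums_mult has_sum_divisors double(1))
  moreover have "- (X / (2 * Gamma s * ?sn)) * (\<Sum>d | d dvd Suc n. H (d - 1) (Suc n div d - 1)) = a (Suc n)" for n
  proof -
    have "(\<Sum>d | d dvd Suc n. H (d - 1) (Suc n div d - 1)) = (\<Sum>d | d dvd Suc n. pair_int s (real d) (real (Suc n div d)))"
    proof (intro sum.cong refl)
      fix d assume d: "d \<in> {d. d dvd Suc n}"
      hence "d > 0" by (auto intro!: Nat.gr0I)
      moreover have "Suc n div d > 0" using d \<open>d > 0\<close> by (auto simp: div_greater_zero_iff intro: dvd_imp_le)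
      ultimately show "H (d - 1) (Suc n div d - 1) = pair_int s (real d) (real (Suc n div d))"
        by (simp add: H_def del: of_nat_Suc)
    qed
    thus ?thesis unfolding a_def summand_eq_pair_int_sum[OF zero_less_Suc s] by (simp only: X_def p_def)
  qed
  ultimately have a: "(\<lambda>n. a (Suc n)) sums (- (X / (2 * Gamma s * ?sn)) * S)" by (simp only:)

  define W where "W l = (\<Sum>n. of_nat (Suc n) powr (- s) * complex_of_nat (Suc n + Suc l) powr (- s))" for l
  have column: "(\<Sum>k. H k l) =
      P * (Gamma s * p powr (- s) * W l)
      - Gamma (2 * s - 1) * of_real (2 * pi * real (Suc l)) powr (- (2 * s - 1))
      - Gamma s * of_real (2 * pi * real (Suc l)) powr (- s) * (P * zeta s)
      + Gamma (s + 1) * of_real (2 * pi * real (Suc l)) powr (- (s + 1)) * (p * P * zeta (s - 1))" for l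
    unfolding H_def W_def P_def p_def by (rule pair_int_column_sum[OF s refl])
  \<comment> \<open>Second evaluation: the columns in closed form, summed over
    \<open>l\<close>.\<close>
  have "(\<lambda>l. P * (Gamma s * p powr (- s) * W l)
      - Gamma (2 * s - 1) * of_real (2 * pi * real (Suc l)) powr (- (2 * s - 1))
      - Gamma s * of_real (2 * pi * real (Suc l)) powr (- s) * (P * zeta s)
      + Gamma (s + 1) * of_real (2 * pi * real (Suc l)) powr (- (s + 1)) * (p * P * zeta (s - 1))) sums
     (P * (Gamma s * p powr (- s) * L2 s) - Gamma (2 * s - 1) * (p powr (- (2 * s - 1)) * zeta (2 * s - 1))
      - Gamma s * (p powr (- s) * zeta s) * (P * zeta s)
      + Gamma (s + 1) * (p powr (- (s + 1)) * zeta (s + 1)) * (p * P * zeta (s - 1)))"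
    unfolding W_def p_def using s
    by (intro sums_add sums_diff sums_mult sums_mult2 L2_sums sums_Suc_powr_scaled) auto
  hence "(\<lambda>l. \<Sum>k. H k l) sums
     (P * (Gamma s * p powr (- s) * L2 s) - Gamma (2 * s - 1) * (p powr (- (2 * s - 1)) * zeta (2 * s - 1))
      - Gamma s * (p powr (- s) * zeta s) * (P * zeta s)
      + Gamma (s + 1) * (p powr (- (s + 1)) * zeta (s + 1)) * (p * P * zeta (s - 1)))"
    unfolding column .
  from sums_unique2[OF double(2) this]
  have S: "S = P * (Gamma s * p powr (- s) * L2 s) - Gamma (2 * s - 1) * (p powr (- (2 * s - 1)) * zeta (2 * s - 1))
      - Gamma s * (p powr (- s) * zeta s) * (P * zeta s)
      + Gamma (s + 1) * (p powr (- (s + 1)) * zeta (s + 1)) * (p * P * zeta (s - 1))" .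
  have pw: "p powr (- s) = 1 / X" "P = p / X / Gamma (1 - s)" "p powr (- (2 * s - 1)) = p / X\<^sup>2" "p powr (- (s + 1)) = 1 / (p * X)"
  proof -
    show 1: "p powr (- s) = 1 / X" using nz by (simp add: X_def powr_minus inverse_eq_divide)
    show "P = p / X / Gamma (1 - s)" using nz by (simp add: P_def X_def powr_diff)
    have "p powr (- (2 * s - 1)) = p powr (1 - s - s)" by (simp add: algebra_simps)
    also have "\<dots> = p / X / X" using nz by (simp only: powr_diff X_def) simp
    finally show "p powr (- (2 * s - 1)) = p / X\<^sup>2" by (simp add: power2_eq_square)
    have "- (s + 1) = - s - 1" by simp
    hence "p powr (- (s + 1)) = p powr (- s - 1)" by (simp only:)
    also have "\<dots> = 1 / X / p" using nz 1 by (simp only: powr_diff) simp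
    finally show "p powr (- (s + 1)) = 1 / (p * X)" by (simp add: mult.commute)
  qed
  have Gs1: "Gamma (s + 1) = s * Gamma s"
    using Gamma_plus1[of s] Gs by (auto simp: Gamma_eq_zero_iff)
  have "L2 s = (zeta s)\<^sup>2 - s * zeta (s - 1) * zeta (s + 1)
          + Gamma (1 - s) * Gamma (2 * s - 1) * zeta (2 * s - 1) / Gamma s
          - X / (2 * Gamma s * ?cs) * (\<Sum>n. a (Suc n))"
    by (rule L2_from_pair_int_sum[OF nz(2,1) G1 Gs sc reflection S[unfolded pw Gs1] sums_unique[OF a, symmetric]])
  moreover have "summable (\<lambda>n. a (Suc n))" using a by (rule sums_summable)
  ultimately show ?thesis unfolding Let_def a_def X_def p_def by (rule conjI[rotated])
qed

end
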